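(* Let $\delta\in\mathbb{C}$ and let $\delta\text{-}N$ be the operad governing the variety of $\delta$-Novikov algebras over $\mathbb{C}$. Then the operad $\delta\text{-}N$ is not Koszul.
   Context: A (left) $\delta$-Novikov algebra is a (not necessarily associative) algebra satisfying, for all $x,y,z$, $\delta(xy)z-x(yz)=\delta(yx)z-y(xz)$ and $(xy)z=(xz)y$. The operad $\delta\text{-}N$ is the binary quadratic symmetric operad generated by one binary operation without symmetry, subject to the relations given by these two identities. Koszulness is in the sense of Ginzburg and Kapranov. *)

theory Defs
  imports Complex_Main "HOL-Library.FuncSet" "HOL-Library.Nat_Bijection"
begin

section \<open>Symmetric operads over the complex numbers\<close>

text \<open>
  Operads are given in coordinate-free form, as functors on finite sets of labels (here: finite
  sets of natural numbers) and bijections, with partial compositions. The usual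
  \<open>S\<^sub>n\<close>-module \<open>P(n)\<close> is the value at \<open>{..<n}\<close>. \<open>op_comp P I i J x y\<close> inserts
  \<open>y \<in> P(J)\<close> into the input \<open>i\<close> of \<open>x \<in> P(I)\<close>.
\<close>

record 'a operad =
  op_space :: "nat set \<Rightarrow> 'a set"
  op_zero :: "nat set \<Rightarrow> 'a"
  op_add :: "nat set \<Rightarrow> 'a \<Rightarrow> 'a \<Rightarrow> 'a"
  op_scale :: "nat set \<Rightarrow> complex \<Rightarrow> 'a \<Rightarrow> 'a"
  op_relabel :: "(nat \<Rightarrow> nat) \<Rightarrow> nat set \<Rightarrow> 'a \<Rightarrow> 'a"
  op_unit :: "nat \<Rightarrow> 'a"
  op_comp :: "nat set \<Rightarrow> nat \<Rightarrow> nat set \<Rightarrow> 'a \<Rightarrow> 'a \<Rightarrow> 'a"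

definition graft :: "nat set \<Rightarrow> nat \<Rightarrow> nat set \<Rightarrow> nat set" where
  "graft I i J = (I - {i}) \<union> J"

text \<open>The inserted labels may reuse the label \<open>i\<close>, which disappears from \<open>I\<close>.\<close>

definition composable :: "nat set \<Rightarrow> nat \<Rightarrow> nat set \<Rightarrow> bool" where
  "composable I i J \<longleftrightarrow> finite I \<and> finite J \<and> i \<in> I \<and> J \<inter> (I - {i}) = {}"

definition op_linear :: "'a operad \<Rightarrow> nat set \<Rightarrow> nat set \<Rightarrow> ('a \<Rightarrow> 'a) \<Rightarrow> bool" where
  "op_linear P I J f \<longleftrightarrow>
     (\<forall>x\<in>op_space P I. f x \<in> op_space P J) \<and>
     (\<forall>x\<in>op_space P I. \<forall>y\<in>op_space P I. f (op_add P I x y) = op_add P J (f x) (f y)) \<and>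
     (\<forall>c. \<forall>x\<in>op_space P I. f (op_scale P I c x) = op_scale P J c (f x))"

locale symmetric_operad =
  fixes P :: "'a operad"
  assumes zero_closed: "finite I \<Longrightarrow> op_zero P I \<in> op_space P I"
    and add_closed: "\<lbrakk>finite I; x \<in> op_space P I; y \<in> op_space P I\<rbrakk> \<Longrightarrow> op_add P I x y \<in> op_space P I"
    and scale_closed: "\<lbrakk>finite I; x \<in> op_space P I\<rbrakk> \<Longrightarrow> op_scale P I c x \<in> op_space P I"
    and add_assoc: "\<lbrakk>finite I; x \<in> op_space P I; y \<in> op_space P I; z \<in> op_space P I\<rbrakk>
      \<Longrightarrow> op_add P I (op_add P I x y) z = op_add P I x (op_add P I y z)"
    and add_commute: "\<lbrakk>finite I; x \<in> op_space P I; y \<in> op_space P I\<rbrakk>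
      \<Longrightarrow> op_add P I x y = op_add P I y x"
    and add_zero: "\<lbrakk>finite I; x \<in> op_space P I\<rbrakk> \<Longrightarrow> op_add P I (op_zero P I) x = x"
    and scale_zero: "\<lbrakk>finite I; x \<in> op_space P I\<rbrakk> \<Longrightarrow> op_scale P I 0 x = op_zero P I"
    and scale_one: "\<lbrakk>finite I; x \<in> op_space P I\<rbrakk> \<Longrightarrow> op_scale P I 1 x = x"
    and scale_scale: "\<lbrakk>finite I; x \<in> op_space P I\<rbrakk>
      \<Longrightarrow> op_scale P I c (op_scale P I d x) = op_scale P I (c * d) x"
    and scale_add_left: "\<lbrakk>finite I; x \<in> op_space P I\<rbrakk>
      \<Longrightarrow> op_scale P I (c + d) x = op_add P I (op_scale P I c x) (op_scale P I d x)"
    and scale_add_right: "\<lbrakk>finite I; x \<in> op_space P I; y \<in> op_space P I\<rbrakk>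
      \<Longrightarrow> op_scale P I c (op_add P I x y) = op_add P I (op_scale P I c x) (op_scale P I c y)"
    and relabel_linear: "\<lbrakk>finite I; inj_on \<sigma> I\<rbrakk> \<Longrightarrow> op_linear P I (\<sigma> ` I) (op_relabel P \<sigma> I)"
    and relabel_cong: "\<lbrakk>finite I; x \<in> op_space P I; inj_on \<sigma> I; \<And>i. i \<in> I \<Longrightarrow> \<sigma> i = \<tau> i\<rbrakk>
      \<Longrightarrow> op_relabel P \<sigma> I x = op_relabel P \<tau> I x"
    and relabel_id: "\<lbrakk>finite I; x \<in> op_space P I\<rbrakk> \<Longrightarrow> op_relabel P id I x = x"
    and relabel_relabel: "\<lbrakk>finite I; x \<in> op_space P I; inj_on \<sigma> I; inj_on \<tau> (\<sigma> ` I)\<rbrakk>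
      \<Longrightarrow> op_relabel P \<tau> (\<sigma> ` I) (op_relabel P \<sigma> I x) = op_relabel P (\<tau> \<circ> \<sigma>) I x"
    and unit_closed: "op_unit P i \<in> op_space P {i}"
    and relabel_unit: "op_relabel P \<sigma> {i} (op_unit P i) = op_unit P (\<sigma> i)"
    and comp_linear_left: "\<lbrakk>composable I i J; y \<in> op_space P J\<rbrakk>
      \<Longrightarrow> op_linear P I (graft I i J) (\<lambda>x. op_comp P I i J x y)"
    and comp_linear_right: "\<lbrakk>composable I i J; x \<in> op_space P I\<rbrakk>
      \<Longrightarrow> op_linear P J (graft I i J) (op_comp P I i J x)"
    and comp_unit_right: "\<lbrakk>finite I; i \<in> I; x \<in> op_space P I\<rbrakk>
      \<Longrightarrow> op_comp P I i {i} x (op_unit P i) = x"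
    and comp_unit_left: "\<lbrakk>finite J; y \<in> op_space P J\<rbrakk>
      \<Longrightarrow> op_comp P {i} i J (op_unit P i) y = y"
    and comp_equivariant: "\<lbrakk>composable I i J; x \<in> op_space P I; y \<in> op_space P J;
        inj_on \<sigma> (graft I i J); inj_on \<tau> I; \<And>k. k \<in> I - {i} \<Longrightarrow> \<tau> k = \<sigma> k\<rbrakk>
      \<Longrightarrow> op_comp P (\<tau> ` I) (\<tau> i) (\<sigma> ` J) (op_relabel P \<tau> I x) (op_relabel P \<sigma> J y)
        = op_relabel P \<sigma> (graft I i J) (op_comp P I i J x y)"
    and comp_assoc: "\<lbrakk>composable I i J; composable J j K; composable (graft I i J) j K;
        x \<in> op_space P I; y \<in> op_space P J; z \<in> op_space P K\<rbrakk>
      \<Longrightarrow> op_comp P (graft I i J) j K (op_comp P I i J x y) z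
        = op_comp P I i (graft J j K) x (op_comp P J j K y z)"
    and comp_parallel: "\<lbrakk>composable I i J; composable I k K; i \<noteq> k; J \<inter> K = {};
        x \<in> op_space P I; y \<in> op_space P J; z \<in> op_space P K\<rbrakk>
      \<Longrightarrow> op_comp P (graft I i J) k K (op_comp P I i J x y) z
        = op_comp P (graft I k K) i J (op_comp P I k K x z) y"


section \<open>Operadic ideals and quotients\<close>

inductive_set generated_ideal :: "'a operad \<Rightarrow> (nat set \<times> 'a) set \<Rightarrow> (nat set \<times> 'a) set"
  for P :: "'a operad" and G :: "(nat set \<times> 'a) set" where
  gen: "(I, x) \<in> G \<Longrightarrow> (I, x) \<in> generated_ideal P G"
| zero: "finite I \<Longrightarrow> (I, op_zero P I) \<in> generated_ideal P G"
| add: "\<lbrakk>(I, x) \<in> generated_ideal P G; (I, y) \<in> generated_ideal P G\<rbrakk>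
    \<Longrightarrow> (I, op_add P I x y) \<in> generated_ideal P G"
| scale: "(I, x) \<in> generated_ideal P G \<Longrightarrow> (I, op_scale P I c x) \<in> generated_ideal P G"
| relabel: "\<lbrakk>(I, x) \<in> generated_ideal P G; inj_on \<sigma> I\<rbrakk>
    \<Longrightarrow> (\<sigma> ` I, op_relabel P \<sigma> I x) \<in> generated_ideal P G"
| comp_left: "\<lbrakk>(I, x) \<in> generated_ideal P G; composable I i J; y \<in> op_space P J\<rbrakk>
    \<Longrightarrow> (graft I i J, op_comp P I i J x y) \<in> generated_ideal P G"
| comp_right: "\<lbrakk>x \<in> op_space P I; composable I i J; (J, y) \<in> generated_ideal P G\<rbrakk>
    \<Longrightarrow> (graft I i J, op_comp P I i J x y) \<in> generated_ideal P G"

definition op_coset :: "'a operad \<Rightarrow> (nat set \<times> 'a) set \<Rightarrow> nat set \<Rightarrow> 'a \<Rightarrow> 'a set" where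
  "op_coset P K I x = {op_add P I x r | r. (I, r) \<in> K}"

definition quotient_operad :: "'a operad \<Rightarrow> (nat set \<times> 'a) set \<Rightarrow> 'a set operad" where
  "quotient_operad P K = \<lparr>
     op_space = (\<lambda>I. op_coset P K I ` op_space P I),
     op_zero = (\<lambda>I. op_coset P K I (op_zero P I)),
     op_add = (\<lambda>I X Y. \<Union>x\<in>X. \<Union>y\<in>Y. op_coset P K I (op_add P I x y)),
     op_scale = (\<lambda>I c X. \<Union>x\<in>X. op_coset P K I (op_scale P I c x)),
     op_relabel = (\<lambda>\<sigma> I X. \<Union>x\<in>X. op_coset P K (\<sigma> ` I) (op_relabel P \<sigma> I x)),
     op_unit = (\<lambda>i. op_coset P K {i} (op_unit P i)),
     op_comp = (\<lambda>I i J X Y. \<Union>x\<in>X. \<Union>y\<in>Y. op_coset P K (graft I i J) (op_comp P I i J x y)) \<rparr>"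


section \<open>The free operad on one binary operation without symmetry\<close>

datatype magma = Var nat | Mul magma magma  (infixl \<open>\<cdot>\<close> 70)

primrec leaves :: "magma \<Rightarrow> nat list" where
  "leaves (Var i) = [i]"
| "leaves (s \<cdot> t) = leaves s @ leaves t"

primrec rename :: "(nat \<Rightarrow> nat) \<Rightarrow> magma \<Rightarrow> magma" where
  "rename \<sigma> (Var i) = Var (\<sigma> i)"
| "rename \<sigma> (s \<cdot> t) = rename \<sigma> s \<cdot> rename \<sigma> t"

primrec subst :: "nat \<Rightarrow> magma \<Rightarrow> magma \<Rightarrow> magma" where
  "subst i u (Var j) = (if j = i then u else Var j)"
| "subst i u (s \<cdot> t) = subst i u s \<cdot> subst i u t"

definition multilinear_words :: "nat set \<Rightarrow> magma set" where
  "multilinear_words I = {t. distinct (leaves t) \<and> set (leaves t) = I}"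

definition word :: "magma \<Rightarrow> magma \<Rightarrow> complex" where
  "word t = (\<lambda>s. if s = t then 1 else 0)"

text \<open>\<open>push A h F\<close> is the linear combination \<open>\<Sum>a\<in>A. F a * h a\<close> of words.\<close>

definition push :: "'b set \<Rightarrow> ('b \<Rightarrow> 'c) \<Rightarrow> ('b \<Rightarrow> complex) \<Rightarrow> 'c \<Rightarrow> complex" where
  "push A h F = (\<lambda>t. \<Sum>a\<in>A. if h a = t then F a else 0)"

text \<open>
  The component at \<open>I\<close> is the multilinear part, in the variables \<open>I\<close>, of the free non-associative
  algebra: formal combinations of bracketed words containing each variable of \<open>I\<close> exactly once.
\<close>

definition magmatic_operad :: "(magma \<Rightarrow> complex) operad" where
  "magmatic_operad = \<lparr>
     op_space = (\<lambda>I. {f. \<forall>t. t \<notin> multilinear_words I \<longrightarrow> f t = 0}),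
     op_zero = (\<lambda>I t. 0),
     op_add = (\<lambda>I f g t. f t + g t),
     op_scale = (\<lambda>I c f t. c * f t),
     op_relabel = (\<lambda>\<sigma> I. push (multilinear_words I) (rename \<sigma>)),
     op_unit = (\<lambda>i. word (Var i)),
     op_comp = (\<lambda>I i J f g. push (multilinear_words I \<times> multilinear_words J)
                  (\<lambda>(s, u). subst i u s) (\<lambda>(s, u). f s * g u)) \<rparr>"


section \<open>The operad of \<open>\<delta>\<close>-Novikov algebras\<close>

definition delta_left_symmetry :: "complex \<Rightarrow> magma \<Rightarrow> complex" where
  "delta_left_symmetry \<delta> = (let x = Var 0; y = Var 1; z = Var 2 in
     (\<lambda>t. (\<delta> * word ((x \<cdot> y) \<cdot> z) t - word (x \<cdot> (y \<cdot> z)) t)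
        - (\<delta> * word ((y \<cdot> x) \<cdot> z) t - word (y \<cdot> (x \<cdot> z)) t)))"

definition right_commutativity :: "magma \<Rightarrow> complex" where
  "right_commutativity = (let x = Var 0; y = Var 1; z = Var 2 in
     (\<lambda>t. word ((x \<cdot> y) \<cdot> z) t - word ((x \<cdot> z) \<cdot> y) t))"

definition delta_novikov_operad :: "complex \<Rightarrow> (magma \<Rightarrow> complex) set operad" where
  "delta_novikov_operad \<delta> = quotient_operad magmatic_operad
     (generated_ideal magmatic_operad
        {({0, 1, 2}, delta_left_symmetry \<delta>), ({0, 1, 2}, right_commutativity)})"


section \<open>Koszulness\<close>

text \<open>
  A reduced tree with leaves \<open>L\<close> (every vertex has at least two inputs), up to isomorphism, is
  the family of the leaf sets of its vertices, where the leaf set of a vertex consists of the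
  leaves above it. \<open>L\<close> is the root vertex, and the internal edges
  correspond to the other vertices (each to the edge leaving it towards the root).
\<close>

definition reduced_tree :: "nat set \<Rightarrow> nat set set \<Rightarrow> bool" where
  "reduced_tree L T \<longleftrightarrow> L \<in> T \<and> (\<forall>A\<in>T. A \<subseteq> L \<and> 2 \<le> card A) \<and>
     (\<forall>A\<in>T. \<forall>B\<in>T. A \<subseteq> B \<or> B \<subseteq> A \<or> A \<inter> B = {})"

text \<open>
  The inputs of a vertex \<open>A\<close> are the maximal vertices or leaves strictly above it; they
  partition \<open>A\<close>, and each of them is labelled by its least leaf.
\<close>

definition inputs :: "nat set set \<Rightarrow> nat set \<Rightarrow> nat set" where
  "inputs T A = (let S = {B. B \<in> T \<union> (\<lambda>a. {a}) ` A \<and> B \<subset> A} in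
     Min ` {B \<in> S. \<not> (\<exists>C\<in>S. B \<subset> C)})"

definition parent :: "nat set set \<Rightarrow> nat set \<Rightarrow> nat set" where
  "parent T A = \<Inter>{B \<in> T. A \<subset> B}"

text \<open>
  Decorations of the vertices of \<open>T\<close> by elements of \<open>P(In(v))\<close>, and the effect of contracting the
  edge from \<open>A\<close> to its parent.
\<close>

definition decorations :: "'a operad \<Rightarrow> nat set set \<Rightarrow> (nat set \<Rightarrow> 'a) set" where
  "decorations P T = (\<Pi>\<^sub>E A\<in>T. op_space P (inputs T A))"

definition contract :: "'a operad \<Rightarrow> nat set set \<Rightarrow> nat set \<Rightarrow> (nat set \<Rightarrow> 'a) \<Rightarrow> nat set \<Rightarrow> 'a" where
  "contract P T A p = (\<lambda>B\<in>T - {A}.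
     if B = parent T A then op_comp P (inputs T B) (Min A) (inputs T A) (p B) (p A) else p B)"

text \<open>
  The complex dual to the decorated trees, i.e. the component with leaf set \<open>L\<close> of the dual dg
  operad (cobar complex) \<open>D(P)\<close>, up to the twist by the sign representation, which does not
  affect exactness. An \<open>m\<close>-cochain is an element of the direct sum, over
  all reduced trees \<open>T\<close> with \<open>m\<close> vertices (so \<open>m - 1\<close> internal edges), of the dual of
  \<open>\<Otimes>\<^sub>v P(In(v))\<close>, that is, a multilinear form on the decorations of \<open>T\<close>. The
  determinant line of the set of internal edges of \<open>T\<close> is trivialized by ordering these edges by
  the binary encoding \<^const>\<open>set_encode\<close> of finite sets, as in simplicial cochains.
\<close>

definition cochains ::
    "'a operad \<Rightarrow> nat set \<Rightarrow> nat \<Rightarrow> (nat set set \<Rightarrow> (nat set \<Rightarrow> 'a) \<Rightarrow> complex) set" where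
  "cochains P L m = {\<phi>. \<forall>T. reduced_tree L T \<and> card T = m \<longrightarrow>
     (\<forall>A\<in>T. \<forall>p\<in>decorations P T. \<forall>x\<in>op_space P (inputs T A). \<forall>y\<in>op_space P (inputs T A).
        \<phi> T (p(A := op_add P (inputs T A) x y)) = \<phi> T (p(A := x)) + \<phi> T (p(A := y)) \<and>
        (\<forall>c. \<phi> T (p(A := op_scale P (inputs T A) c x)) = c * \<phi> T (p(A := x))))}"

definition differential ::
    "'a operad \<Rightarrow> nat set \<Rightarrow> (nat set set \<Rightarrow> (nat set \<Rightarrow> 'a) \<Rightarrow> complex)
       \<Rightarrow> nat set set \<Rightarrow> (nat set \<Rightarrow> 'a) \<Rightarrow> complex" where
  "differential P L \<phi> T p = (\<Sum>A\<in>T - {L}.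
     (- 1) ^ card {B \<in> T - {L}. set_encode B < set_encode A} * \<phi> (T - {A}) (contract P T A p))"

text \<open>Equality of \<open>m\<close>-cochains: values outside the trees with \<open>m\<close> vertices are irrelevant.\<close>

definition cochain_eq ::
    "'a operad \<Rightarrow> nat set \<Rightarrow> nat \<Rightarrow> (nat set set \<Rightarrow> (nat set \<Rightarrow> 'a) \<Rightarrow> complex)
       \<Rightarrow> (nat set set \<Rightarrow> (nat set \<Rightarrow> 'a) \<Rightarrow> complex) \<Rightarrow> bool" where
  "cochain_eq P L m \<phi> \<psi> \<longleftrightarrow>
     (\<forall>T. reduced_tree L T \<and> card T = m \<longrightarrow> (\<forall>p\<in>decorations P T. \<phi> T p = \<psi> T p))"

text \<open>For \<open>m = 1\<close> this says that the differential is injective on \<open>1\<close>-cochains: there are no trees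
  without vertices, so the only coboundary among the \<open>1\<close>-cochains is zero.\<close>

definition cobar_exact_at :: "'a operad \<Rightarrow> nat set \<Rightarrow> nat \<Rightarrow> bool" where
  "cobar_exact_at P L m \<longleftrightarrow>
     (\<forall>\<phi>\<in>cochains P L m. cochain_eq P L (m + 1) (differential P L \<phi>) (\<lambda>T p. 0) \<longrightarrow>
        (\<exists>\<psi>\<in>cochains P L (m - 1). cochain_eq P L m \<phi> (differential P L \<psi>)))"

text \<open>
  Ginzburg and Kapranov call a quadratic operad \<open>P\<close> Koszul if \<open>D(P) \<rightarrow> P\<^sup>!\<close> is a
  quasi-isomorphism, i.e. if each complex \<open>D(P)(n)\<close> is exact everywhere but the right end
  (the binary trees, with \<open>n - 1\<close> vertices); at the right end the cohomology of a quadratic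
  operad is always \<open>P\<^sup>!(n)\<close>.
\<close>

definition koszul :: "'a operad \<Rightarrow> bool" where
  "koszul P \<longleftrightarrow> (\<forall>n m. 1 \<le> m \<and> m < n - 1 \<longrightarrow> cobar_exact_at P {..<n} m)"


section \<open>The operad axioms hold for the \<open>\<delta>\<close>-Novikov operad\<close>


lemma push_push:
  assumes "finite A" "finite B" "h ` A \<subseteq> B"
  shows "push B g (push A h F) = push A (g \<circ> h) F"
proof
  fix t
  have "push B g (push A h F) t = (\<Sum>b\<in>B. \<Sum>a\<in>A. if h a = b then (if g b = t then F a else 0) else 0)"
    unfolding push_def by (intro sum.cong refl) (auto intro!: sum.cong sum.neutral)
  also have "\<dots> = (\<Sum>a\<in>A. \<Sum>b\<in>B. if h a = b then (if g b = t then F a else 0) else 0)"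
    by (rule sum.swap)
  also have "\<dots> = (\<Sum>a\<in>A. if g (h a) = t then F a else 0)"
    using assms by (intro sum.cong refl) (simp add: image_subset_iff)
  finally show "push B g (push A h F) t = push A (g \<circ> h) F t"
    by (simp add: push_def)
qed

lemma push_tensor:
  "push A h F s * push B k G u = push (A \<times> B) (map_prod h k) (\<lambda>(a, b). F a * G b) (s, u)"
  unfolding push_def sum_product sum.cartesian_product
  by (intro sum.cong refl) auto

lemma push_tensor_fun:
  "(\<lambda>(s, u). push A h F s * push B k G u) = push (A \<times> B) (map_prod h k) (\<lambda>(a, b). F a * G b)"
  by (auto simp: push_tensor)

lemma push_outside: "t \<notin> h ` A \<Longrightarrow> push A h F t = 0"
  unfolding push_def by (intro sum.neutral) auto

lemma push_reindex:
  assumes "bij_betw r A B" "\<And>a. a \<in> A \<Longrightarrow> h a = k (r a)" "\<And>a. a \<in> A \<Longrightarrow> F a = G (r a)"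
  shows "push A h F = push B k G"
  unfolding push_def
  by (rule ext) (subst sum.reindex_bij_betw[OF assms(1), symmetric], intro sum.cong, auto simp: assms)

lemma push_cong:
  assumes "\<And>a. a \<in> A \<Longrightarrow> h a = k a" "\<And>a. a \<in> A \<Longrightarrow> F a = G a"
  shows "push A h F = push A k G"
  using push_reindex[of id A A h k F G] assms by auto

lemma push_id:
  assumes "finite A" "\<And>t. t \<notin> A \<Longrightarrow> F t = 0"
  shows "push A (\<lambda>a. a) F = F"
  unfolding push_def using assms by (auto simp: fun_eq_iff)

lemma push_add: "push A h (\<lambda>a. F a + G a) = (\<lambda>t. push A h F t + push A h G t)"
  unfolding push_def sum.distrib[symmetric] by (intro ext sum.cong) auto

lemma push_scale: "push A h (\<lambda>a. c * F a) = (\<lambda>t. c * push A h F t)"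
  unfolding push_def sum_distrib_left by (intro ext sum.cong) auto

lemma finite_multilinear_words:
  assumes "finite I" shows "finite (multilinear_words I)"
proof -
  have "finite {t. set (leaves t) \<subseteq> I \<and> length (leaves t) \<le> n}" for n
  proof (induction n)
    case 0
    have ne: "leaves t \<noteq> []" for t by (induction t) auto
    show ?case by (simp add: ne)
  next
    case (Suc n)
    let ?S = "{t. set (leaves t) \<subseteq> I \<and> length (leaves t) \<le> n}"
    have ne: "1 \<le> length (leaves t)" for t by (induction t) auto
    have "{t. set (leaves t) \<subseteq> I \<and> length (leaves t) \<le> Suc n}
        \<subseteq> Var ` I \<union> (\<lambda>(s, t). s \<cdot> t) ` (?S \<times> ?S)"
    proof
      fix t assume t: "t \<in> {t. set (leaves t) \<subseteq> I \<and> length (leaves t) \<le> Suc n}"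
      show "t \<in> Var ` I \<union> (\<lambda>(s, t). s \<cdot> t) ` (?S \<times> ?S)"
      proof (cases t)
        case (Mul a b)
        have "a \<in> ?S" "b \<in> ?S" using t Mul ne[of a] ne[of b] by auto
        then show ?thesis using Mul by auto
      qed (use t in auto)
    qed
    then show ?case
      using Suc assms by (meson finite_SigmaI finite_UnI finite_imageI finite_subset)
  qed
  from this[of "card I"] show ?thesis
    by (rule rev_finite_subset) (auto simp: multilinear_words_def distinct_card[symmetric])
qed

lemma leaves_rename: "leaves (rename \<sigma> t) = map \<sigma> (leaves t)"
  by (induction t) auto

lemma rename_words:
  "\<lbrakk>t \<in> multilinear_words I; inj_on \<sigma> I\<rbrakk> \<Longrightarrow> rename \<sigma> t \<in> multilinear_words (\<sigma> ` I)"
  by (auto simp: multilinear_words_def leaves_rename distinct_map)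

lemma rename_cong: "(\<And>i. i \<in> set (leaves t) \<Longrightarrow> \<sigma> i = \<tau> i) \<Longrightarrow> rename \<sigma> t = rename \<tau> t"
  by (induction t) auto

lemma rename_rename: "rename \<tau> (rename \<sigma> t) = rename (\<tau> \<circ> \<sigma>) t"
  by (induction t) auto

lemma rename_id: "rename id t = t"
  by (induction t) auto

lemma subst_fresh: "i \<notin> set (leaves s) \<Longrightarrow> subst i u s = s"
  by (induction s) auto

lemma set_leaves_subst:
  "set (leaves (subst i u s)) = (set (leaves s) - {i}) \<union> (if i \<in> set (leaves s) then set (leaves u) else {})"
  by (induction s) auto

lemma distinct_leaves_subst:
  "\<lbrakk>distinct (leaves s); distinct (leaves u); set (leaves u) \<inter> (set (leaves s) - {i}) = {}\<rbrakk>
    \<Longrightarrow> distinct (leaves (subst i u s))"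
proof (induction s)
  case (Mul s t)
  then have "distinct (leaves (subst i u s))" "distinct (leaves (subst i u t))" by auto
  then show ?case using Mul.prems by (auto simp: set_leaves_subst split: if_splits)
qed auto

lemma subst_words:
  assumes "composable I i J" "s \<in> multilinear_words I" "u \<in> multilinear_words J"
  shows "subst i u s \<in> multilinear_words (graft I i J)"
  using assms distinct_leaves_subst[of s u i]
  by (auto simp: multilinear_words_def composable_def graft_def set_leaves_subst)

lemma finite_graft: "composable I i J \<Longrightarrow> finite (graft I i J)"
  by (auto simp: composable_def graft_def)

lemma subst_subst:
  "\<lbrakk>j \<notin> set (leaves s) - {i}\<rbrakk> \<Longrightarrow> subst j w (subst i u s) = subst i (subst j w u) s"
  by (induction s) auto

lemma subst_commute:
  "\<lbrakk>i \<noteq> k; k \<notin> set (leaves u); i \<notin> set (leaves w)\<rbrakk>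
    \<Longrightarrow> subst k w (subst i u s) = subst i u (subst k w s)"
  by (induction s) (auto simp: subst_fresh)

lemma rename_subst:
  "\<lbrakk>\<And>k. k \<in> set (leaves s) \<Longrightarrow> k \<noteq> i \<Longrightarrow> \<tau> k = \<sigma> k;
    \<And>k. k \<in> set (leaves s) \<Longrightarrow> k \<noteq> i \<Longrightarrow> \<tau> k \<noteq> \<tau> i\<rbrakk>
    \<Longrightarrow> subst (\<tau> i) (rename \<sigma> u) (rename \<tau> s) = rename \<sigma> (subst i u s)"
  by (induction s) auto

lemma words_singleton: "multilinear_words {i} = {Var i}"
proof -
  have ne: "leaves t \<noteq> []" for t by (induction t) auto
  have "t = Var i" if "distinct (leaves t)" "set (leaves t) = {i}" for t
  proof (cases t)
    case (Mul a b)
    have "length (leaves a) > 0" "length (leaves b) > 0" using ne by auto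
    moreover have "length (leaves t) = 1" using that distinct_card[of "leaves t"] by simp
    ultimately show ?thesis using Mul by (auto simp: Suc_le_eq neq_Nil_conv)
  qed (use that in auto)
  then show ?thesis by (auto simp: multilinear_words_def)
qed

lemma mag_sel:
  "op_space magmatic_operad I = {f. \<forall>t. t \<notin> multilinear_words I \<longrightarrow> f t = 0}"
  "op_zero magmatic_operad I = (\<lambda>t. 0)"
  "op_add magmatic_operad I f g = (\<lambda>t. f t + g t)"
  "op_scale magmatic_operad I c f = (\<lambda>t. c * f t)"
  "op_relabel magmatic_operad \<sigma> I f = push (multilinear_words I) (rename \<sigma>) f"
  "op_unit magmatic_operad i = word (Var i)"
  "op_comp magmatic_operad I i J f g = push (multilinear_words I \<times> multilinear_words J)
                  (\<lambda>(s, u). subst i u s) (\<lambda>(s, u). f s * g u)"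
  by (simp_all add: magmatic_operad_def)

lemma push_mag_left:
  assumes "finite I" "finite J" "finite C" "h ` C \<subseteq> multilinear_words I"
    "\<And>u. u \<notin> multilinear_words J \<Longrightarrow> y u = 0"
  shows "push (multilinear_words I \<times> multilinear_words J) k (\<lambda>(s, u). push C h F s * y u)
    = push (C \<times> multilinear_words J) (\<lambda>(c, u). k (h c, u)) (\<lambda>(c, u). F c * y u)"
proof -
  have y: "y = push (multilinear_words J) (\<lambda>a. a) y"
    using assms push_id finite_multilinear_words by metis
  have "(\<lambda>(s, u). push C h F s * y u)
      = push (C \<times> multilinear_words J) (map_prod h (\<lambda>a. a)) (\<lambda>(c, u). F c * y u)"
    by (subst y) (auto simp: push_tensor)
  then show ?thesis
    using assms by (simp, subst push_push) (auto simp: finite_multilinear_words comp_def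
      case_prod_beta' intro!: push_cong)
qed

lemma push_mag_right:
  assumes "finite I" "finite J" "finite C" "h ` C \<subseteq> multilinear_words J"
    "\<And>u. u \<notin> multilinear_words I \<Longrightarrow> x u = 0"
  shows "push (multilinear_words I \<times> multilinear_words J) k (\<lambda>(s, u). x s * push C h F u)
    = push (multilinear_words I \<times> C) (\<lambda>(s, c). k (s, h c)) (\<lambda>(s, c). x s * F c)"
proof -
  have x: "x = push (multilinear_words I) (\<lambda>a. a) x"
    using assms push_id finite_multilinear_words by metis
  have "(\<lambda>(s, u). x s * push C h F u)
      = push (multilinear_words I \<times> C) (map_prod (\<lambda>a. a) h) (\<lambda>(s, c). x s * F c)"
    by (subst x) (auto simp: push_tensor)
  then show ?thesis
    using assms by (simp, subst push_push) (auto simp: finite_multilinear_words comp_def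
      case_prod_beta' intro!: push_cong)
qed

lemma symmetric_operad_magmatic: "symmetric_operad magmatic_operad"
proof
  fix I :: "nat set" and \<sigma> :: "nat \<Rightarrow> nat"
  assume "finite I" "inj_on \<sigma> I"
  then show "op_linear magmatic_operad I (\<sigma> ` I) (op_relabel magmatic_operad \<sigma> I)"
    by (auto simp: op_linear_def mag_sel push_add push_scale intro!: push_outside rename_words)
next
  fix I :: "nat set" and \<sigma> \<tau> :: "nat \<Rightarrow> nat" and x
  assume "\<And>i. i \<in> I \<Longrightarrow> \<sigma> i = \<tau> i"
  then show "op_relabel magmatic_operad \<sigma> I x = op_relabel magmatic_operad \<tau> I x"
    by (auto simp: mag_sel multilinear_words_def intro!: push_cong rename_cong)
next
  fix I :: "nat set" and x
  assume "finite I" "x \<in> op_space magmatic_operad I"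
  then show "op_relabel magmatic_operad id I x = x"
    using push_id[of "multilinear_words I" x]
    by (simp add: mag_sel finite_multilinear_words rename_id[abs_def])
next
  fix I :: "nat set" and \<sigma> \<tau> :: "nat \<Rightarrow> nat" and x
  assume "finite I" "inj_on \<sigma> I"
  then show "op_relabel magmatic_operad \<tau> (\<sigma> ` I) (op_relabel magmatic_operad \<sigma> I x)
      = op_relabel magmatic_operad (\<tau> \<circ> \<sigma>) I x"
    unfolding mag_sel
    by (subst push_push) (auto simp: finite_multilinear_words rename_rename intro: rename_words intro!: push_cong)
next
  fix i
  show "op_unit magmatic_operad i \<in> op_space magmatic_operad {i}"
    by (auto simp: mag_sel words_singleton word_def)
next
  fix \<sigma> :: "nat \<Rightarrow> nat" and i
  show "op_relabel magmatic_operad \<sigma> {i} (op_unit magmatic_operad i) = op_unit magmatic_operad (\<sigma> i)"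
    by (auto simp: mag_sel words_singleton word_def push_def fun_eq_iff)
next
  fix I J i and y
  assume c: "composable I i J" and "y \<in> op_space magmatic_operad J"
  have out: "push (multilinear_words I \<times> multilinear_words J) (\<lambda>(s, u). subst i u s) F t = 0"
    if "t \<notin> multilinear_words (graft I i J)" for F t
    using that c by (auto intro!: push_outside subst_words)
  show "op_linear magmatic_operad I (graft I i J) (\<lambda>x. op_comp magmatic_operad I i J x y)"
    unfolding op_linear_def mag_sel
    by (auto simp: out push_add[symmetric] push_scale[symmetric] algebra_simps intro!: push_cong)
next
  fix I J i and x
  assume c: "composable I i J" and "x \<in> op_space magmatic_operad I"
  have out: "push (multilinear_words I \<times> multilinear_words J) (\<lambda>(s, u). subst i u s) F t = 0"
    if "t \<notin> multilinear_words (graft I i J)" for F t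
    using that c by (auto intro!: push_outside subst_words)
  show "op_linear magmatic_operad J (graft I i J) (op_comp magmatic_operad I i J x)"
    unfolding op_linear_def mag_sel
    by (auto simp: out push_add[symmetric] push_scale[symmetric] algebra_simps intro!: push_cong)
next
  fix I i and x
  assume I: "finite I" "i \<in> I" "x \<in> op_space magmatic_operad I"
  have s: "subst i (Var i) s = s" for s by (induction s) auto
  have "op_comp magmatic_operad I i {i} x (op_unit magmatic_operad i) = push (multilinear_words I) (\<lambda>a. a) x"
    unfolding mag_sel words_singleton
    by (rule push_reindex[where r = fst])
       (auto simp: s word_def bij_betw_def inj_on_def image_def)
  then show "op_comp magmatic_operad I i {i} x (op_unit magmatic_operad i) = x"
    using I by (simp add: push_id finite_multilinear_words mag_sel)
next
  fix J :: "nat set" and i and y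
  assume J: "finite J" "y \<in> op_space magmatic_operad J"
  have "op_comp magmatic_operad {i} i J (op_unit magmatic_operad i) y = push (multilinear_words J) (\<lambda>a. a) y"
    unfolding mag_sel words_singleton
    by (rule push_reindex[where r = snd])
       (auto simp: word_def bij_betw_def inj_on_def image_def)
  then show "op_comp magmatic_operad {i} i J (op_unit magmatic_operad i) y = y"
    using J by (simp add: push_id finite_multilinear_words mag_sel)
next
  fix I J i x y and \<sigma> \<tau> :: "nat \<Rightarrow> nat"
  assume c: "composable I i J" and x: "x \<in> op_space magmatic_operad I"
    and y: "y \<in> op_space magmatic_operad J"
    and inj: "inj_on \<sigma> (graft I i J)" "inj_on \<tau> I" and eq: "\<And>k. k \<in> I - {i} \<Longrightarrow> \<tau> k = \<sigma> k"
  let ?W = multilinear_words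
  have fin: "finite I" "finite J" "finite (?W I)" "finite (?W J)"
    using c by (auto simp: composable_def finite_multilinear_words)
  have injJ: "inj_on \<sigma> J" using inj(1) by (rule inj_on_subset) (simp add: graft_def)
  have "op_comp magmatic_operad (\<tau> ` I) (\<tau> i) (\<sigma> ` J)
       (op_relabel magmatic_operad \<tau> I x) (op_relabel magmatic_operad \<sigma> J y)
     = push (?W I \<times> ?W J) ((\<lambda>(s, u). subst (\<tau> i) u s) \<circ> map_prod (rename \<tau>) (rename \<sigma>)) (\<lambda>(s, u). x s * y u)"
    unfolding mag_sel push_tensor_fun
    using fin inj injJ
    by (subst push_push) (auto simp: finite_multilinear_words intro: rename_words)
  also have "\<dots> = push (?W I \<times> ?W J) (rename \<sigma> \<circ> (\<lambda>(s, u). subst i u s)) (\<lambda>(s, u). x s * y u)"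
  proof (rule push_cong)
    fix a assume "a \<in> ?W I \<times> ?W J"
    then obtain s u where a: "a = (s, u)" "s \<in> ?W I" "u \<in> ?W J" by auto
    have s: "set (leaves s) = I" using a by (simp add: multilinear_words_def)
    have "i \<in> I" using c by (simp add: composable_def)
    then have "\<tau> k \<noteq> \<tau> i" if "k \<in> I" "k \<noteq> i" for k
      using that inj(2) by (auto dest: inj_onD)
    with s eq have "subst (\<tau> i) (rename \<sigma> u) (rename \<tau> s) = rename \<sigma> (subst i u s)"
      by (intro rename_subst) auto
    then show "((\<lambda>(s, u). subst (\<tau> i) u s) \<circ> map_prod (rename \<tau>) (rename \<sigma>)) a
        = (rename \<sigma> \<circ> (\<lambda>(s, u). subst i u s)) a" using a by simp
  qed simp
  also have "\<dots> = op_relabel magmatic_operad \<sigma> (graft I i J) (op_comp magmatic_operad I i J x y)"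
    unfolding mag_sel using fin c finite_graft[OF c]
    by (subst push_push) (auto simp: finite_multilinear_words intro: subst_words)
  finally show "op_comp magmatic_operad (\<tau> ` I) (\<tau> i) (\<sigma> ` J)
       (op_relabel magmatic_operad \<tau> I x) (op_relabel magmatic_operad \<sigma> J y)
     = op_relabel magmatic_operad \<sigma> (graft I i J) (op_comp magmatic_operad I i J x y)" .
next
  fix I J K i j x y z
  assume c: "composable I i J" "composable J j K" "composable (graft I i J) j K"
    and x: "x \<in> op_space magmatic_operad I" and y: "y \<in> op_space magmatic_operad J"
    and z: "z \<in> op_space magmatic_operad K"
  let ?W = multilinear_words
  have fin: "finite I" "finite J" "finite K" "finite (?W I)" "finite (?W J)" "finite (?W K)"
    using c by (auto simp: composable_def finite_multilinear_words)
  have "op_comp magmatic_operad (graft I i J) j K (op_comp magmatic_operad I i J x y) z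
     = push ((?W I \<times> ?W J) \<times> ?W K) (\<lambda>((s, u), w). subst j w (subst i u s)) (\<lambda>((s, u), w). x s * y u * z w)"
    unfolding mag_sel using fin z finite_graft[OF c(1)] c
    by (subst push_mag_left) (auto simp: mag_sel intro: subst_words intro!: push_cong)
  also have "\<dots> = push (?W I \<times> ?W J \<times> ?W K) (\<lambda>(s, u, w). subst i (subst j w u) s) (\<lambda>(s, u, w). x s * (y u * z w))"
  proof (rule push_reindex[where r = "\<lambda>((s, u), w). (s, u, w)"], goal_cases)
    case 1
    show ?case by (rule bij_betw_byWitness[where f' = "\<lambda>(s, u, w). ((s, u), w)"]) auto
  next
    case (2 a)
    have "j \<notin> I - {i}" using c by (auto simp: composable_def)
    with 2 show ?case by (auto simp: multilinear_words_def intro!: subst_subst)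
  qed auto
  also have "\<dots> = op_comp magmatic_operad I i (graft J j K) x (op_comp magmatic_operad J j K y z)"
    unfolding mag_sel using fin x finite_graft[OF c(2)] c
    by (subst push_mag_right) (auto simp: mag_sel intro: subst_words intro!: push_cong)
  finally show "op_comp magmatic_operad (graft I i J) j K (op_comp magmatic_operad I i J x y) z
     = op_comp magmatic_operad I i (graft J j K) x (op_comp magmatic_operad J j K y z)" .
next
  fix I J K i k x y z
  assume c: "composable I i J" "composable I k K" "i \<noteq> k" "J \<inter> K = {}"
    and x: "x \<in> op_space magmatic_operad I" and y: "y \<in> op_space magmatic_operad J"
    and z: "z \<in> op_space magmatic_operad K"
  let ?W = multilinear_words
  have fin: "finite I" "finite J" "finite K" "finite (?W I)" "finite (?W J)" "finite (?W K)"
    using c by (auto simp: composable_def finite_multilinear_words)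
  have ik: "k \<notin> J" "i \<notin> K" using c by (auto simp: composable_def)
  have "op_comp magmatic_operad (graft I i J) k K (op_comp magmatic_operad I i J x y) z
     = push ((?W I \<times> ?W J) \<times> ?W K) (\<lambda>((s, u), w). subst k w (subst i u s)) (\<lambda>((s, u), w). x s * y u * z w)"
    unfolding mag_sel using fin z finite_graft[OF c(1)] c
    by (subst push_mag_left) (auto simp: mag_sel intro: subst_words intro!: push_cong)
  also have "\<dots> = push ((?W I \<times> ?W K) \<times> ?W J) (\<lambda>((s, w), u). subst i u (subst k w s)) (\<lambda>((s, w), u). x s * z w * y u)"
  proof (rule push_reindex[where r = "\<lambda>((s, u), w). ((s, w), u)"], goal_cases)
    case 1
    show ?case by (rule bij_betw_byWitness[where f' = "\<lambda>((s, w), u). ((s, u), w)"]) auto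
  next
    case (2 a)
    with ik c show ?case by (auto simp: multilinear_words_def intro!: subst_commute)
  qed auto
  also have "\<dots> = op_comp magmatic_operad (graft I k K) i J (op_comp magmatic_operad I k K x z) y"
    unfolding mag_sel using fin y finite_graft[OF c(2)] c
    by (subst push_mag_left) (auto simp: mag_sel intro: subst_words intro!: push_cong)
  finally show "op_comp magmatic_operad (graft I i J) k K (op_comp magmatic_operad I i J x y) z
     = op_comp magmatic_operad (graft I k K) i J (op_comp magmatic_operad I k K x z) y" .
qed (auto simp: mag_sel algebra_simps)


locale operad_ideal = symmetric_operad P for P :: "'a operad" +
  fixes K :: "(nat set \<times> 'a) set"
  assumes ideal_finite: "(I, r) \<in> K \<Longrightarrow> finite I"
    and ideal_space: "(I, r) \<in> K \<Longrightarrow> r \<in> op_space P I"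
    and ideal_zero: "finite I \<Longrightarrow> (I, op_zero P I) \<in> K"
    and ideal_add: "\<lbrakk>(I, r) \<in> K; (I, s) \<in> K\<rbrakk> \<Longrightarrow> (I, op_add P I r s) \<in> K"
    and ideal_scale: "(I, r) \<in> K \<Longrightarrow> (I, op_scale P I c r) \<in> K"
    and ideal_relabel: "\<lbrakk>(I, r) \<in> K; inj_on \<sigma> I\<rbrakk> \<Longrightarrow> (\<sigma> ` I, op_relabel P \<sigma> I r) \<in> K"
    and ideal_comp_left: "\<lbrakk>(I, r) \<in> K; composable I i J; y \<in> op_space P J\<rbrakk>
      \<Longrightarrow> (graft I i J, op_comp P I i J r y) \<in> K"
    and ideal_comp_right: "\<lbrakk>x \<in> op_space P I; composable I i J; (J, s) \<in> K\<rbrakk>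
      \<Longrightarrow> (graft I i J, op_comp P I i J x s) \<in> K"
begin

abbreviation "cl \<equiv> op_coset P K"
abbreviation "Q \<equiv> quotient_operad P K"

lemma coset_self: "\<lbrakk>finite I; x \<in> op_space P I\<rbrakk> \<Longrightarrow> x \<in> cl I x"
  unfolding op_coset_def
  using ideal_zero[of I] add_zero[of I x] add_commute[of I x "op_zero P I"] zero_closed[of I] by force

lemma add_inverse: "\<lbrakk>finite I; x \<in> op_space P I\<rbrakk> \<Longrightarrow> op_add P I x (op_scale P I (- 1) x) = op_zero P I"
  using scale_add_left[of I x 1 "- 1"] by (simp add: scale_one scale_zero)

lemma coset_absorb:
  assumes I: "finite I" and x: "x \<in> op_space P I" and r: "(I, r) \<in> K"
  shows "cl I (op_add P I x r) = cl I x"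
proof (intro equalityI subsetI)
  note rs = ideal_space[OF r]
  fix w assume "w \<in> cl I (op_add P I x r)"
  then obtain s where s: "(I, s) \<in> K" "w = op_add P I (op_add P I x r) s" by (auto simp: op_coset_def)
  then have "w = op_add P I x (op_add P I r s)" using I x rs ideal_space[OF s(1)] by (simp add: add_assoc)
  then show "w \<in> cl I x" using ideal_add[OF r s(1)] by (auto simp: op_coset_def)
next
  note rs = ideal_space[OF r]
  fix w assume "w \<in> cl I x"
  then obtain s where s: "(I, s) \<in> K" "w = op_add P I x s" by (auto simp: op_coset_def)
  note ss = ideal_space[OF s(1)]
  let ?n = "op_scale P I (- 1) r"
  have n: "?n \<in> op_space P I" "(I, ?n) \<in> K" using I rs r by (auto intro: scale_closed ideal_scale)
  have "op_add P I (op_add P I x r) (op_add P I ?n s) = op_add P I x (op_add P I (op_add P I r ?n) s)"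
    using I x rs n ss by (simp add: add_assoc add_closed)
  also have "\<dots> = w" using I rs ss s by (simp add: add_inverse add_zero)
  finally show "w \<in> cl I (op_add P I x r)" using ideal_add[OF n(2) s(1)] by (force simp: op_coset_def)
qed

lemma coset_memE:
  assumes "w \<in> cl I x"
  obtains r where "(I, r) \<in> K" "w = op_add P I x r"
  using assms by (auto simp: op_coset_def)

lemma UN_coset:
  assumes "finite I" "x \<in> op_space P I"
    and "\<And>r. (I, r) \<in> K \<Longrightarrow> F (op_add P I x r) = F x"
  shows "(\<Union>w\<in>cl I x. F w) = F x"
proof -
  have "F w = F x" if "w \<in> cl I x" for w
    using that assms(3) by (auto elim!: coset_memE)
  moreover have "x \<in> cl I x" using assms by (simp add: coset_self)
  ultimately show ?thesis by blast
qed

lemma UN_coset_linear: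
  assumes "finite I" "x \<in> op_space P I" "finite J" "op_linear P I J f"
    and "\<And>r. (I, r) \<in> K \<Longrightarrow> (J, f r) \<in> K"
  shows "(\<Union>w\<in>cl I x. cl J (f w)) = cl J (f x)"
proof (rule UN_coset)
  fix r assume r: "(I, r) \<in> K"
  have "f (op_add P I x r) = op_add P J (f x) (f r)"
    using assms(2,4) ideal_space[OF r] by (auto simp: op_linear_def)
  then show "cl J (f (op_add P I x r)) = cl J (f x)"
    using assms r coset_absorb[of J "f x" "f r"] by (auto simp: op_linear_def)
qed (use assms in auto)

lemma q_space: "op_space Q I = cl I ` op_space P I"
  and q_zero: "op_zero Q I = cl I (op_zero P I)"
  and q_unit: "op_unit Q i = cl {i} (op_unit P i)"
  by (simp_all add: quotient_operad_def)

lemma q_add: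
  assumes I: "finite I" and x: "x \<in> op_space P I" and y: "y \<in> op_space P I"
  shows "op_add Q I (cl I x) (cl I y) = cl I (op_add P I x y)"
proof -
  have "(\<Union>w\<in>cl I y. cl I (op_add P I v w)) = cl I (op_add P I v y)" if v: "v \<in> op_space P I" for v
  proof (rule UN_coset)
    fix r assume r: "(I, r) \<in> K"
    show "cl I (op_add P I v (op_add P I y r)) = cl I (op_add P I v y)"
      using coset_absorb[OF I add_closed[OF I v y] r] v y I ideal_space[OF r] by (simp add: add_assoc)
  qed (use I y in auto)
  moreover have "v \<in> op_space P I" if "v \<in> cl I x" for v
    using that I x by (auto elim!: coset_memE intro: add_closed ideal_space)
  ultimately have "op_add Q I (cl I x) (cl I y) = (\<Union>v\<in>cl I x. cl I (op_add P I v y))"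
    by (simp add: quotient_operad_def)
  also have "\<dots> = cl I (op_add P I x y)"
  proof (rule UN_coset)
    fix r assume r: "(I, r) \<in> K"
    note rs = ideal_space[OF r]
    have "op_add P I (op_add P I x r) y = op_add P I (op_add P I x y) r"
      using I x y rs add_assoc[of I x r y] add_assoc[of I x y r] add_commute[of I y r] by simp
    then show "cl I (op_add P I (op_add P I x r) y) = cl I (op_add P I x y)"
      using coset_absorb[OF I add_closed[OF I x y] r] by simp
  qed (use I x in auto)
  finally show ?thesis .
qed

lemma scale_linear: "finite I \<Longrightarrow> op_linear P I I (op_scale P I c)"
  by (auto simp: op_linear_def scale_closed scale_add_right scale_scale mult.commute)

lemma q_scale:
  assumes "finite I" "x \<in> op_space P I"
  shows "op_scale Q I c (cl I x) = cl I (op_scale P I c x)"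
  using UN_coset_linear[OF assms assms(1) scale_linear[OF assms(1)]] ideal_scale
  by (simp add: quotient_operad_def)

lemma q_relabel:
  assumes "finite I" "x \<in> op_space P I" "inj_on \<sigma> I"
  shows "op_relabel Q \<sigma> I (cl I x) = cl (\<sigma> ` I) (op_relabel P \<sigma> I x)"
  using UN_coset_linear[OF assms(1,2) _ relabel_linear[OF assms(1,3)]] assms ideal_relabel
  by (simp add: quotient_operad_def)

lemma finite_composable: "composable I i J \<Longrightarrow> finite I \<and> finite J \<and> finite (graft I i J)"
  by (auto simp: composable_def graft_def)

lemma q_comp:
  assumes c: "composable I i J" and x: "x \<in> op_space P I" and y: "y \<in> op_space P J"
  shows "op_comp Q I i J (cl I x) (cl J y) = cl (graft I i J) (op_comp P I i J x y)"
proof -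
  note fin = finite_composable[OF c]
  have "(\<Union>w\<in>cl J y. cl (graft I i J) (op_comp P I i J v w)) = cl (graft I i J) (op_comp P I i J v y)"
    if v: "v \<in> op_space P I" for v
    using UN_coset_linear[OF _ y _ comp_linear_right[OF c v]] fin ideal_comp_right[OF v c] by simp
  moreover have "v \<in> op_space P I" if "v \<in> cl I x" for v
    using that fin x by (auto elim!: coset_memE intro: add_closed ideal_space)
  ultimately have "op_comp Q I i J (cl I x) (cl J y)
      = (\<Union>v\<in>cl I x. cl (graft I i J) (op_comp P I i J v y))"
    by (simp add: quotient_operad_def)
  also have "\<dots> = cl (graft I i J) (op_comp P I i J x y)"
    using UN_coset_linear[OF _ x _ comp_linear_left[OF c y]] fin ideal_comp_left[OF _ c y] by simp
  finally show ?thesis .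
qed

lemma q_linear:
  assumes "finite I" "finite J" "op_linear P I J f"
    and "\<And>x. x \<in> op_space P I \<Longrightarrow> g (cl I x) = cl J (f x)"
  shows "op_linear Q I J g"
  using assms by (auto simp: op_linear_def q_space q_add q_scale add_closed scale_closed)

lemma relabel_closed:
  "\<lbrakk>finite I; inj_on \<sigma> I; x \<in> op_space P I\<rbrakk> \<Longrightarrow> op_relabel P \<sigma> I x \<in> op_space P (\<sigma> ` I)"
  using relabel_linear by (auto simp: op_linear_def)

lemma comp_closed:
  "\<lbrakk>composable I i J; x \<in> op_space P I; y \<in> op_space P J\<rbrakk>
    \<Longrightarrow> op_comp P I i J x y \<in> op_space P (graft I i J)"
  using comp_linear_left[of I i J y] by (auto simp: op_linear_def)

lemma symmetric_operad_quotient: "symmetric_operad Q"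
proof
  fix I :: "nat set" and \<sigma> :: "nat \<Rightarrow> nat"
  assume "finite I" "inj_on \<sigma> I"
  then show "op_linear Q I (\<sigma> ` I) (op_relabel Q \<sigma> I)"
    by (intro q_linear[OF _ _ relabel_linear]) (auto simp: q_relabel)
next
  fix I J i Y assume c: "composable I i J" and "Y \<in> op_space Q J"
  then obtain y where y: "Y = cl J y" "y \<in> op_space P J" by (auto simp: q_space)
  show "op_linear Q I (graft I i J) (\<lambda>X. op_comp Q I i J X Y)"
    using finite_composable[OF c] c y by (intro q_linear[OF _ _ comp_linear_left[OF c y(2)]]) (auto simp: q_comp)
next
  fix I J i X assume c: "composable I i J" and "X \<in> op_space Q I"
  then obtain x where x: "X = cl I x" "x \<in> op_space P I" by (auto simp: q_space)
  show "op_linear Q J (graft I i J) (op_comp Q I i J X)"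
    using finite_composable[OF c] c x by (intro q_linear[OF _ _ comp_linear_right[OF c x(2)]]) (auto simp: q_comp)
next
  fix I :: "nat set" and X and \<sigma> \<tau> :: "nat \<Rightarrow> nat"
  assume I: "finite I" and "X \<in> op_space Q I" and inj: "inj_on \<sigma> I"
    and eq: "\<And>i. i \<in> I \<Longrightarrow> \<sigma> i = \<tau> i"
  then obtain x where x: "X = cl I x" "x \<in> op_space P I" by (auto simp: q_space)
  have "inj_on \<tau> I" "\<sigma> ` I = \<tau> ` I" using inj eq by (auto cong: inj_on_cong)
  with I inj x show "op_relabel Q \<sigma> I X = op_relabel Q \<tau> I X"
    using relabel_cong[OF I x(2) inj, of \<tau>] eq by (simp add: q_relabel)
next
  fix \<sigma> :: "nat \<Rightarrow> nat" and i
  show "op_relabel Q \<sigma> {i} (op_unit Q i) = op_unit Q (\<sigma> i)"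
    by (simp add: q_unit q_relabel unit_closed relabel_unit)
next
  fix I i X assume I: "finite I" "i \<in> I" and "X \<in> op_space Q I"
  then obtain x where x: "X = cl I x" "x \<in> op_space P I" by (auto simp: q_space)
  have "composable I i {i}" "graft I i {i} = I" using I by (auto simp: composable_def graft_def)
  then show "op_comp Q I i {i} X (op_unit Q i) = X"
    using I x by (simp add: q_unit q_comp unit_closed comp_unit_right)
next
  fix J i Y assume J: "finite (J :: nat set)" and "Y \<in> op_space Q J"
  then obtain y where y: "Y = cl J y" "y \<in> op_space P J" by (auto simp: q_space)
  have "composable {i} i J" "graft {i} i J = J" using J by (auto simp: composable_def graft_def)
  then show "op_comp Q {i} i J (op_unit Q i) Y = Y"
    using J y by (simp add: q_unit q_comp unit_closed comp_unit_left)
next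
  fix I J i X Y and \<sigma> \<tau> :: "nat \<Rightarrow> nat"
  assume c: "composable I i J" and X: "X \<in> op_space Q I" and Y: "Y \<in> op_space Q J"
    and inj: "inj_on \<sigma> (graft I i J)" "inj_on \<tau> I" and eq: "\<And>k. k \<in> I - {i} \<Longrightarrow> \<tau> k = \<sigma> k"
  obtain x where x: "X = cl I x" "x \<in> op_space P I" using X by (auto simp: q_space)
  obtain y where y: "Y = cl J y" "y \<in> op_space P J" using Y by (auto simp: q_space)
  note fin = finite_composable[OF c]
  have J: "inj_on \<sigma> J" using inj(1) by (rule inj_on_subset) (simp add: graft_def)
  have i: "i \<in> I" using c by (simp add: composable_def)
  have d: "\<tau> ` I - {\<tau> i} = \<sigma> ` (I - {i})"
  proof -
    have "\<tau> ` I - {\<tau> i} = \<tau> ` (I - {i})"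
      using inj_on_image_set_diff[OF inj(2), of I "{i}"] i by simp
    also have "\<dots> = \<sigma> ` (I - {i})" using eq by (intro image_cong) auto
    finally show ?thesis .
  qed
  have g: "graft (\<tau> ` I) (\<tau> i) (\<sigma> ` J) = \<sigma> ` graft I i J"
    by (auto simp: graft_def d)
  have "\<sigma> ` J \<inter> \<sigma> ` (I - {i}) = \<sigma> ` (J \<inter> (I - {i}))"
    using inj(1) by (intro inj_on_image_Int[symmetric]) (auto simp: graft_def)
  then have c': "composable (\<tau> ` I) (\<tau> i) (\<sigma> ` J)"
    using c by (simp add: composable_def d)
  show "op_comp Q (\<tau> ` I) (\<tau> i) (\<sigma> ` J) (op_relabel Q \<tau> I X) (op_relabel Q \<sigma> J Y)
      = op_relabel Q \<sigma> (graft I i J) (op_comp Q I i J X Y)"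
    using fin c c' x y J inj comp_equivariant[OF c x(2) y(2) inj eq]
    by (simp add: q_comp q_relabel relabel_closed comp_closed g)
next
  fix I J K' i j X Y Z
  assume c: "composable I i J" "composable J j K'" "composable (graft I i J) j K'"
    and X: "X \<in> op_space Q I" and Y: "Y \<in> op_space Q J" and Z: "Z \<in> op_space Q K'"
  obtain x where x: "X = cl I x" "x \<in> op_space P I" using X by (auto simp: q_space)
  obtain y where y: "Y = cl J y" "y \<in> op_space P J" using Y by (auto simp: q_space)
  obtain z where z: "Z = cl K' z" "z \<in> op_space P K'" using Z by (auto simp: q_space)
  have c': "composable I i (graft J j K')" and g: "graft (graft I i J) j K' = graft I i (graft J j K')"
    using c by (auto simp: composable_def graft_def)
  show "op_comp Q (graft I i J) j K' (op_comp Q I i J X Y) Z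
      = op_comp Q I i (graft J j K') X (op_comp Q J j K' Y Z)"
    using c c' x y z comp_assoc[OF c x(2) y(2) z(2)]
    by (simp add: q_comp comp_closed g)
next
  fix I J K' i k X Y Z
  assume c: "composable I i J" "composable I k K'" "i \<noteq> k" "J \<inter> K' = {}"
    and X: "X \<in> op_space Q I" and Y: "Y \<in> op_space Q J" and Z: "Z \<in> op_space Q K'"
  obtain x where x: "X = cl I x" "x \<in> op_space P I" using X by (auto simp: q_space)
  obtain y where y: "Y = cl J y" "y \<in> op_space P J" using Y by (auto simp: q_space)
  obtain z where z: "Z = cl K' z" "z \<in> op_space P K'" using Z by (auto simp: q_space)
  have c': "composable (graft I i J) k K'" "composable (graft I k K') i J"
    and g: "graft (graft I i J) k K' = graft (graft I k K') i J"
    using c by (auto simp: composable_def graft_def)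
  show "op_comp Q (graft I i J) k K' (op_comp Q I i J X Y) Z
      = op_comp Q (graft I k K') i J (op_comp Q I k K' X Z) Y"
    using c c' x y z comp_parallel[OF c x(2) y(2) z(2)]
    by (simp add: q_comp comp_closed g)
next
  fix I :: "nat set" and X and \<sigma> \<tau> :: "nat \<Rightarrow> nat"
  assume I: "finite I" and "X \<in> op_space Q I" and inj: "inj_on \<sigma> I" "inj_on \<tau> (\<sigma> ` I)"
  then obtain x where x: "X = cl I x" "x \<in> op_space P I" by (auto simp: q_space)
  have "inj_on (\<tau> \<circ> \<sigma>) I" using inj by (rule comp_inj_on)
  then show "op_relabel Q \<tau> (\<sigma> ` I) (op_relabel Q \<sigma> I X) = op_relabel Q (\<tau> \<circ> \<sigma>) I X"
    using I inj x by (simp add: q_relabel relabel_closed relabel_relabel image_comp)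
next
  fix I :: "nat set" and X
  assume I: "finite I" and "X \<in> op_space Q I"
  then obtain x where x: "X = cl I x" "x \<in> op_space P I" by (auto simp: q_space)
  show "op_relabel Q id I X = X"
    using I x by (simp add: q_relabel relabel_id)
next
  fix I :: "nat set" and X and c d
  assume I: "finite I" and "X \<in> op_space Q I"
  then obtain x where x: "X = cl I x" "x \<in> op_space P I" by (auto simp: q_space)
  show "op_scale Q I (c + d) X = op_add Q I (op_scale Q I c X) (op_scale Q I d X)"
    using I x by (simp add: q_add q_scale scale_closed scale_add_left)
next
  fix I :: "nat set" and X Y
  assume I: "finite I" and X: "X \<in> op_space Q I" and Y: "Y \<in> op_space Q I"
  obtain x where x: "X = cl I x" "x \<in> op_space P I" using X by (auto simp: q_space)
  obtain y where y: "Y = cl I y" "y \<in> op_space P I" using Y by (auto simp: q_space)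
  show "op_add Q I X Y = op_add Q I Y X"
    using I x y add_commute[of I x y] by (simp add: q_add)
next
  fix I :: "nat set" and X Y Z
  assume I: "finite I" and X: "X \<in> op_space Q I" and Y: "Y \<in> op_space Q I" and Z: "Z \<in> op_space Q I"
  obtain x where x: "X = cl I x" "x \<in> op_space P I" using X by (auto simp: q_space)
  obtain y where y: "Y = cl I y" "y \<in> op_space P I" using Y by (auto simp: q_space)
  obtain z where z: "Z = cl I z" "z \<in> op_space P I" using Z by (auto simp: q_space)
  show "op_add Q I (op_add Q I X Y) Z = op_add Q I X (op_add Q I Y Z)"
    using I x y z by (simp add: q_add add_closed add_assoc)
next
  fix I :: "nat set" and X Y and c
  assume I: "finite I" and X: "X \<in> op_space Q I" and Y: "Y \<in> op_space Q I"
  obtain x where x: "X = cl I x" "x \<in> op_space P I" using X by (auto simp: q_space)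
  obtain y where y: "Y = cl I y" "y \<in> op_space P I" using Y by (auto simp: q_space)
  show "op_add Q I X Y \<in> op_space Q I"
    unfolding q_space using I x y by (simp add: q_add add_closed)
  show "op_scale Q I c (op_add Q I X Y) = op_add Q I (op_scale Q I c X) (op_scale Q I c Y)"
    using I x y by (simp add: q_add q_scale add_closed scale_closed scale_add_right)
next
  fix I :: "nat set" and X and c d
  assume I: "finite I" and "X \<in> op_space Q I"
  then obtain x where x: "X = cl I x" "x \<in> op_space P I" by (auto simp: q_space)
  show "op_scale Q I c X \<in> op_space Q I"
    unfolding q_space using I x by (simp add: q_scale scale_closed)
  show "op_add Q I (op_zero Q I) X = X"
    using I x by (simp add: q_zero q_add zero_closed add_zero)
  show "op_scale Q I 0 X = op_zero Q I"
    using I x by (simp add: q_zero q_scale scale_zero)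
  show "op_scale Q I 1 X = X"
    using I x by (simp add: q_scale scale_one)
  show "op_scale Q I c (op_scale Q I d X) = op_scale Q I (c * d) X"
    using I x by (simp add: q_scale scale_closed scale_scale)
qed (simp_all add: q_space q_zero q_unit zero_closed unit_closed)

end

lemma operad_ideal_generated:
  assumes "symmetric_operad P"
    and G: "\<And>I x. (I, x) \<in> G \<Longrightarrow> finite I \<and> x \<in> op_space P I"
  shows "operad_ideal P (generated_ideal P G)"
proof -
  interpret symmetric_operad P by fact
  have fin: "finite I \<and> x \<in> op_space P I" if "(I, x) \<in> generated_ideal P G" for I x
    using that
  proof induction
    case (relabel I x \<sigma>)
    then show ?case using relabel_linear[of I \<sigma>] by (auto simp: op_linear_def)
  next
    case (comp_left I x i J y)
    then show ?case using comp_linear_left[of I i J y] finite_graft by (auto simp: op_linear_def)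
  next
    case (comp_right x I i J y)
    then show ?case using comp_linear_left[of I i J y] finite_graft by (auto simp: op_linear_def)
  qed (auto simp: zero_closed add_closed scale_closed G)
  show ?thesis
    by unfold_locales (use fin in \<open>auto intro: generated_ideal.intros\<close>)
qed

theorem symmetric_operad_delta_novikov: "symmetric_operad (delta_novikov_operad \<delta>)"
proof -
  have W: "s \<in> multilinear_words {0, 1, 2}"
    if "leaves s \<in> {[0, 1, 2], [1, 0, 2], [0, 2, 1]}" for s
    using that by (auto simp: multilinear_words_def)
  have word: "word s t = 0" if "t \<notin> multilinear_words {0, 1, 2}"
    "leaves s \<in> {[0, 1, 2], [1, 0, 2], [0, 2, 1]}" for s t
    using that W[of s] by (auto simp: word_def)
  have "delta_left_symmetry \<delta> t = 0" "right_commutativity t = 0"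
    if "t \<notin> multilinear_words {0, 1, 2}" for t
    by (simp_all only: delta_left_symmetry_def right_commutativity_def Let_def
      word[OF that] leaves.simps append.simps insert_iff simp_thms) simp_all
  then have "operad_ideal magmatic_operad (generated_ideal magmatic_operad
      {({0, 1, 2}, delta_left_symmetry \<delta>), ({0, 1, 2}, right_commutativity)})"
    by (intro operad_ideal_generated symmetric_operad_magmatic) (auto simp: mag_sel)
  then show ?thesis
    unfolding delta_novikov_operad_def by (rule operad_ideal.symmetric_operad_quotient)
qed

end

theory Submission
  imports Defs
begin

text \<open>
  Koszulness already fails in arity five, at the trees with three vertices, and it fails for all values
  of \<open>\<delta>\<close> for the same reason. Write \<open>P\<close> for the operad. If its cobar complex were
  exact at these trees, every cocycle \<open>\<phi>\<close> there would be the coboundary of a cochain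
  \<open>\<psi>\<close> on trees with two vertices. This is refuted by a pairing: there are a cocycle
  \<open>\<phi>\<close> and a combination \<open>z\<close> of trees decorated with words such that
  \<open>\<phi>(z) = - 1\<close>, but \<open>(d\<psi>)(z) = 0\<close> for every \<open>\<psi>\<close>. In other words, \<open>z\<close> is a
  cycle of the dual complex that contracts edges, and \<open>\<phi>\<close> detects that its homology class is not
  zero. Seen from the Koszul dual operad, \<open>\<phi>\<close> is a linear dependence between consequences of its
  quadratic relations that does not follow from such dependences in arity four.

  A tree with five leaves and three vertices has one ternary and two binary vertices. So \<open>\<phi>\<close> only
  needs linear forms on \<open>P(2)\<close>, where the two products of the variables are a basis, and on
  \<open>P(3)\<close>. There the identities say that \<open>(xy)z\<close> is symmetric in \<open>y, z\<close>
  and that \<open>x(yz) - \<delta>(xy)z\<close> is symmetric in \<open>x, y\<close>, which gives six coordinates; that no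
  further relations occur in arity three is \<open>novikov_small_relations\<close>. The cocycle is a
  combination of eighteen products of coordinates, with coefficients \<open>1, - 1, \<delta>, - \<delta>\<close>. On the
  other side, \<open>(d\<psi>)(z) = 0\<close> says that the boundary of \<open>z\<close> vanishes in tensor products
  of components up to \<open>P(4)\<close>. For this it suffices to exhibit enough identities of \<open>P\<close>:
  rewriting all words with the two defining identities, used in a fixed direction, makes the terms cancel. The coefficients of \<open>z\<close> are \<open>1\<close> and
  \<open>- 1\<close>. Both \<open>\<phi>\<close> and \<open>z\<close> are solutions of linear systems, selected for small
  support.

  What connects these computations with the definition of the complex is a single encoding: a word with
  marked nodes stands for a tree with words at its vertices. Contracting an edge removes a mark
  (\<open>contract_decor\<close>), an identity of \<open>P\<close> becomes an identity between the values of a cochain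
  at marked words (\<open>val_expand\<close>), and a cochain that vanishes at all marked words is zero
  (\<open>cochain_vanishes_if_marked\<close>), because every tree with words at its vertices arises in this way
  (\<open>marked_of_tree\<close>) and cochains are multilinear. Hence it is a finite computation with lists that
  \<open>d\<phi> = 0\<close> (\<open>cocycle_check\<close>), that the boundary of \<open>z\<close> vanishes
  (\<open>boundary_check\<close>), and that \<open>\<phi>(z) = - 1\<close> (\<open>pairing_check\<close>).
\<close>

section \<open>Words with marked nodes\<close>

text \<open>
  A word together with a set of marked inner nodes encodes a reduced tree whose vertices are decorated
  with words: the marked nodes are the vertices, and an unmarked node is absorbed by the closest
  marked node below it. If the root is marked, the word of a vertex is obtained by cutting the subtrees
  of the next marked nodes and replacing each of them by its least leaf, which is the label that
  \<^const>\<open>inputs\<close> uses. Contracting an edge of the tree then just removes a mark.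
\<close>

datatype marked = Leaf nat | Node bool marked marked

primrec leaf_set :: "marked \<Rightarrow> nat set" where
  "leaf_set (Leaf i) = {i}"
| "leaf_set (Node b l r) = leaf_set l \<union> leaf_set r"

primrec multilinear :: "marked \<Rightarrow> bool" where
  "multilinear (Leaf i) \<longleftrightarrow> True"
| "multilinear (Node b l r) \<longleftrightarrow> multilinear l \<and> multilinear r \<and> leaf_set l \<inter> leaf_set r = {}"

primrec least :: "marked \<Rightarrow> nat" where
  "least (Leaf i) = i"
| "least (Node b l r) = min (least l) (least r)"

text \<open>
  The word that remains when everything above the lowest marked nodes is cut off.
\<close>

primrec cut :: "marked \<Rightarrow> magma" where
  "cut (Leaf i) = Var i"
| "cut (Node b l r) = (if b then Var (min (least l) (least r)) else cut l \<cdot> cut r)"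

primrec verts :: "marked \<Rightarrow> nat set set" where
  "verts (Leaf i) = {}"
| "verts (Node b l r) = (if b then {leaf_set l \<union> leaf_set r} else {}) \<union> verts l \<union> verts r"

text \<open>
  Only the values at vertices matter. A vertex other than the whole leaf set lies on one side, so the
  inclusion in the left leaf set decides where to look.
\<close>

primrec label :: "marked \<Rightarrow> nat set \<Rightarrow> magma" where
  "label (Leaf i) A = Var i"
| "label (Node b l r) A =
     (if A = leaf_set l \<union> leaf_set r then cut l \<cdot> cut r else if A \<subseteq> leaf_set l then label l A else label r A)"

primrec unmark :: "nat set \<Rightarrow> marked \<Rightarrow> marked" where
  "unmark A (Leaf i) = Leaf i"
| "unmark A (Node b l r) =
     (if A = leaf_set l \<union> leaf_set r then Node False l r else Node b (unmark A l) (unmark A r))"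

text \<open>
  The leaf sets of the parts that \<^const>\<open>cut\<close> replaces by variables.
\<close>

primrec tops :: "marked \<Rightarrow> nat set set" where
  "tops (Leaf i) = {{i}}"
| "tops (Node b l r) = (if b then {leaf_set l \<union> leaf_set r} else tops l \<union> tops r)"

lemma finite_leaf_set [simp]: "finite (leaf_set m)"
  by (induction m) auto

lemma leaf_set_nonempty [simp]: "leaf_set m \<noteq> {}"
  by (induction m) auto

lemma least_eq_Min: "least m = Min (leaf_set m)"
  by (induction m) (auto simp: Min_Un)

lemma finite_verts [simp]: "finite (verts m)"
  by (induction m) auto

lemma verts_subset: "A \<in> verts m \<Longrightarrow> A \<subseteq> leaf_set m"
  by (induction m) (auto split: if_splits)

lemma verts_nonempty: "A \<in> verts m \<Longrightarrow> A \<noteq> {}"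
  by (induction m) (auto split: if_splits)

lemma verts_card: "\<lbrakk>multilinear m; A \<in> verts m\<rbrakk> \<Longrightarrow> 2 \<le> card A"
proof (induction m)
  case (Node b l r)
  have "card (leaf_set l \<union> leaf_set r) = card (leaf_set l) + card (leaf_set r)"
    using Node.prems by (auto intro: card_Un_disjoint)
  moreover have "1 \<le> card (leaf_set l)" "1 \<le> card (leaf_set r)" by (simp_all add: Suc_le_eq card_gt_0_iff)
  ultimately have "2 \<le> card (leaf_set l \<union> leaf_set r)" by linarith
  then show ?case using Node by (auto split: if_splits)
qed auto

lemma verts_laminar:
  "\<lbrakk>multilinear m; A \<in> verts m; B \<in> verts m\<rbrakk> \<Longrightarrow> A \<subseteq> B \<or> B \<subseteq> A \<or> A \<inter> B = {}"
proof (induction m)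
  case (Node b l r)
  note * = verts_subset[of A l] verts_subset[of A r] verts_subset[of B l] verts_subset[of B r]
  have "leaf_set l \<inter> leaf_set r = {}" using Node.prems by simp
  then show ?case
    using Node.IH Node.prems * by (auto split: if_splits) blast+
qed auto

lemma reduced_tree_verts:
  "multilinear (Node True l r) \<Longrightarrow> reduced_tree (leaf_set l \<union> leaf_set r) (verts (Node True l r))"
  using verts_card[of "Node True l r"] verts_laminar[of "Node True l r"] verts_subset[of _ "Node True l r"]
  unfolding reduced_tree_def by auto

lemma verts_Node: "A \<in> verts (Node b l r) \<Longrightarrow> A = leaf_set l \<union> leaf_set r \<or> A \<in> verts l \<or> A \<in> verts r"
  by (simp split: if_splits)

lemma multilinear_split:
  assumes "multilinear (Node b l r)"
  shows "leaf_set l \<union> leaf_set r \<notin> verts l" "leaf_set l \<union> leaf_set r \<notin> verts r"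
    "A \<in> verts l \<Longrightarrow> \<not> A \<subseteq> leaf_set r"  "A \<in> verts r \<Longrightarrow> \<not> A \<subseteq> leaf_set l"
proof -
  note * = verts_subset[of A l] verts_subset[of A r] verts_nonempty[of A l] verts_nonempty[of A r]
  have d: "leaf_set l \<inter> leaf_set r = {}" using assms by simp
  have ne: "leaf_set l \<noteq> {}" "leaf_set r \<noteq> {}" by auto
  show "leaf_set l \<union> leaf_set r \<notin> verts l" using verts_subset[of "leaf_set l \<union> leaf_set r" l] d ne by blast
  show "leaf_set l \<union> leaf_set r \<notin> verts r" using verts_subset[of "leaf_set l \<union> leaf_set r" r] d ne by blast
  show "A \<in> verts r \<Longrightarrow> \<not> A \<subseteq> leaf_set l" using * d by blast
  show "A \<in> verts l \<Longrightarrow> \<not> A \<subseteq> leaf_set r" using * d by blast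
qed

lemma label_left: "\<lbrakk>multilinear (Node b l r); A \<in> verts l\<rbrakk> \<Longrightarrow> label (Node b l r) A = label l A"
  using multilinear_split(1)[of b l r] verts_subset[of A l] by auto

lemma label_right: "\<lbrakk>multilinear (Node b l r); A \<in> verts r\<rbrakk> \<Longrightarrow> label (Node b l r) A = label r A"
  using multilinear_split(2)[of b l r] multilinear_split(4)[of b l r A] by auto

lemma tops_subset: "B \<in> tops m \<Longrightarrow> B \<subseteq> leaf_set m \<and> B \<noteq> {} \<and> finite B"
  by (induction m) (auto split: if_splits)

lemma tops_in: "tops m \<subseteq> verts m \<union> (\<lambda>a. {a}) ` leaf_set m"
  by (induction m) auto

lemma tops_cover: "B \<in> verts m \<union> (\<lambda>a. {a}) ` leaf_set m \<Longrightarrow> \<exists>C\<in>tops m. B \<subseteq> C"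
proof (induction m)
  case (Node b l r)
  show ?case
  proof (cases b)
    case True
    then show ?thesis using Node.prems verts_subset[of B "Node b l r"] by auto
  next
    case False
    then have "B \<in> verts l \<union> (\<lambda>a. {a}) ` leaf_set l \<or> B \<in> verts r \<union> (\<lambda>a. {a}) ` leaf_set r"
      using Node.prems by auto
    then have "(\<exists>C\<in>tops l. B \<subseteq> C) \<or> (\<exists>C\<in>tops r. B \<subseteq> C)" using Node.IH by blast
    then show ?thesis using False by auto
  qed
qed auto

lemma tops_disjoint: "\<lbrakk>multilinear m; B \<in> tops m; C \<in> tops m; B \<noteq> C\<rbrakk> \<Longrightarrow> B \<inter> C = {}"
proof (induction m)
  case (Node b l r)
  then show ?case using tops_subset[of B l] tops_subset[of B r] tops_subset[of C l] tops_subset[of C r]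
    by (auto split: if_splits) blast+
qed auto

lemma leaves_cut: "set (leaves (cut m)) = Min ` tops m"
  by (induction m) (auto simp: least_eq_Min Min_Un)

lemma leaves_cut_subset: "set (leaves (cut m)) \<subseteq> leaf_set m"
  unfolding leaves_cut using tops_subset by (metis Min_in image_subsetI subset_iff)

lemma distinct_cut: "multilinear m \<Longrightarrow> distinct (leaves (cut m))"
proof (induction m)
  case (Node b l r)
  then show ?case using leaves_cut_subset[of l] leaves_cut_subset[of r] by auto
qed auto

lemma distinct_label: "multilinear m \<Longrightarrow> distinct (leaves (label m A))"
proof (induction m)
  case (Node b l r)
  then show ?case using leaves_cut_subset[of l] leaves_cut_subset[of r] distinct_cut[of l] distinct_cut[of r] by auto
qed auto

lemma inputs_cong: "{B \<in> T. B \<subset> A} = {B \<in> T'. B \<subset> A} \<Longrightarrow> inputs T A = inputs T' A"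
proof -
  assume eq: "{B \<in> T. B \<subset> A} = {B \<in> T'. B \<subset> A}"
  have "{B. B \<in> T \<union> X \<and> B \<subset> A} = {B \<in> T. B \<subset> A} \<union> {B \<in> X. B \<subset> A}"
    "{B. B \<in> T' \<union> X \<and> B \<subset> A} = {B \<in> T'. B \<subset> A} \<union> {B \<in> X. B \<subset> A}" for X by auto
  with eq show ?thesis by (simp only: inputs_def Let_def)
qed

lemma maximal_elements:
  assumes "U \<subseteq> S" "\<And>B. B \<in> S \<Longrightarrow> \<exists>C\<in>U. B \<subseteq> C" "\<And>B C. \<lbrakk>B \<in> U; C \<in> U; B \<noteq> C\<rbrakk> \<Longrightarrow> B \<inter> C = {}" "{} \<notin> U"
  shows "{B \<in> S. \<not> (\<exists>C\<in>S. B \<subset> C)} = U"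
proof (intro equalityI subsetI)
  fix B assume "B \<in> {B \<in> S. \<not> (\<exists>C\<in>S. B \<subset> C)}"
  then show "B \<in> U" using assms(1,2) by (metis (mono_tags, lifting) mem_Collect_eq psubsetI subsetD)
next
  fix B assume B: "B \<in> U"
  have "\<not> B \<subset> C" if C: "C \<in> S" for C
  proof
    assume "B \<subset> C"
    moreover obtain D where D: "D \<in> U" "C \<subseteq> D" using assms(2) C by blast
    ultimately have "B \<inter> D = B" "B \<noteq> D" by auto
    then show False using assms(3)[OF B D(1)] B assms(4) by auto
  qed
  then show "B \<in> {B \<in> S. \<not> (\<exists>C\<in>S. B \<subset> C)}" using B assms(1) by auto
qed

text \<open>
  The inputs of a vertex are labelled by the variables of its word, because the maximal blocks strictly
  inside the leaf set of the vertex are the tops of the two factors.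
\<close>

lemma inputs_verts:
  "\<lbrakk>multilinear m; A \<in> verts m\<rbrakk> \<Longrightarrow> inputs (verts m) A = set (leaves (label m A))"
proof (induction m)
  case (Node b l r)
  note split = multilinear_split[OF Node.prems(1)]
  have d: "leaf_set l \<inter> leaf_set r = {}" using Node.prems by simp
  consider "A = leaf_set l \<union> leaf_set r" | "A \<in> verts l" | "A \<in> verts r"
    using verts_Node[OF Node.prems(2)] by blast
  then show ?case
  proof cases
    case 1
    let ?S = "{B. B \<in> verts (Node b l r) \<union> (\<lambda>a. {a}) ` A \<and> B \<subset> A}"
    obtain x y where xy: "x \<in> leaf_set l" "y \<in> leaf_set r" using leaf_set_nonempty[of l] leaf_set_nonempty[of r] by blast
    then have "x \<noteq> y" using d by auto
    have sing: "{a} \<subset> A" if "a \<in> A" for a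
    proof (rule psubsetI)
      show "{a} \<subseteq> A" using that by simp
      show "{a} \<noteq> A"
      proof
        assume "{a} = A"
        then have "x \<in> {a}" "y \<in> {a}" using xy 1 by simp_all
        then show False using \<open>x \<noteq> y\<close> by simp
      qed
    qed
    have "B \<in> verts l \<union> verts r" if "B \<in> verts (Node b l r)" "B \<subset> A" for B
      using verts_Node[OF that(1)] that(2) 1 by blast
    moreover have "B \<in> verts (Node b l r) \<and> B \<subset> A" if "B \<in> verts l \<union> verts r" for B
    proof
      show "B \<in> verts (Node b l r)" using that by simp
      then show "B \<subset> A" using that verts_subset[of B "Node b l r"] 1 split(1,2) by auto
    qed
    ultimately have V: "{B \<in> verts (Node b l r). B \<subset> A} = verts l \<union> verts r" by blast
    have I: "{B \<in> (\<lambda>a. {a}) ` A. B \<subset> A} = (\<lambda>a. {a}) ` (leaf_set l \<union> leaf_set r)"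
      using sing 1 by blast
    have "?S = {B \<in> verts (Node b l r). B \<subset> A} \<union> {B \<in> (\<lambda>a. {a}) ` A. B \<subset> A}" by blast
    also have "\<dots> = (verts l \<union> verts r) \<union> (\<lambda>a. {a}) ` (leaf_set l \<union> leaf_set r)" by (simp only: V I)
    finally have S: "?S = (verts l \<union> (\<lambda>a. {a}) ` leaf_set l) \<union> (verts r \<union> (\<lambda>a. {a}) ` leaf_set r)"
      by (simp only: image_Un Un_ac)
    have "{B \<in> ?S. \<not> (\<exists>C\<in>?S. B \<subset> C)} = tops l \<union> tops r"
    proof (rule maximal_elements)
      show "tops l \<union> tops r \<subseteq> ?S" unfolding S using tops_in[of l] tops_in[of r] by blast
      show "\<exists>C\<in>tops l \<union> tops r. B \<subseteq> C" if "B \<in> ?S" for B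
        using that tops_cover[of B l] tops_cover[of B r] unfolding S by blast
      show "B \<inter> C = {}" if "B \<in> tops l \<union> tops r" "C \<in> tops l \<union> tops r" "B \<noteq> C" for B C
        using that tops_disjoint[of "Node False l r" B C] Node.prems by simp
      show "{} \<notin> tops l \<union> tops r" using tops_subset[of "{}" l] tops_subset[of "{}" r] by blast
    qed
    then have "inputs (verts (Node b l r)) A = Min ` (tops l \<union> tops r)"
      by (simp only: inputs_def Let_def)
    then show ?thesis using 1 by (simp add: leaves_cut image_Un)
  next
    case 2
    have "inputs (verts (Node b l r)) A = inputs (verts l) A"
    proof (rule inputs_cong)
      have "B \<in> verts l" if "B \<in> verts (Node b l r)" "B \<subset> A" for B
        using verts_Node[OF that(1)] that(2) verts_subset[OF 2] multilinear_split(4)[OF Node.prems(1), of B]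
        by blast
      moreover have "verts l \<subseteq> verts (Node b l r)" by auto
      ultimately show "{B \<in> verts (Node b l r). B \<subset> A} = {B \<in> verts l. B \<subset> A}" by blast
    qed
    then show ?thesis using Node 2 label_left by simp
  next
    case 3
    have "inputs (verts (Node b l r)) A = inputs (verts r) A"
    proof (rule inputs_cong)
      have "B \<in> verts r" if "B \<in> verts (Node b l r)" "B \<subset> A" for B
        using verts_Node[OF that(1)] that(2) verts_subset[OF 3] multilinear_split(3)[OF Node.prems(1), of B]
        by blast
      moreover have "verts r \<subseteq> verts (Node b l r)" by auto
      ultimately show "{B \<in> verts (Node b l r). B \<subset> A} = {B \<in> verts r. B \<subset> A}" by blast
    qed
    then show ?thesis using Node 3 label_right by simp
  qed
qed auto

lemma label_words: "\<lbrakk>multilinear m; A \<in> verts m\<rbrakk> \<Longrightarrow> label m A \<in> multilinear_words (inputs (verts m) A)"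
  by (simp add: multilinear_words_def distinct_label inputs_verts)

lemma leaf_set_unmark [simp]: "leaf_set (unmark A m) = leaf_set m"
  by (induction m) auto

lemma least_unmark [simp]: "least (unmark A m) = least m"
  by (simp add: least_eq_Min)

lemma multilinear_unmark [simp]: "multilinear (unmark A m) = multilinear m"
  by (induction m) auto

lemma unmark_fresh: "\<not> A \<subseteq> leaf_set m \<Longrightarrow> unmark A m = m"
  by (induction m) auto

lemma verts_unmark: "multilinear m \<Longrightarrow> verts (unmark A m) = verts m - {A}"
proof (induction m)
  case (Node b l r)
  note split = multilinear_split[OF Node.prems(1)]
  show ?case using Node split(1,2) by auto
qed auto

text \<open>
  A vertex is cut off itself exactly if no larger vertex is cut off with it. This turns the recursive
  description of the word of a vertex into the order on leaf sets that defines parents.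
\<close>

lemma tops_iff:
  assumes "multilinear m" "A \<in> verts m"
  shows "A \<in> tops m \<longleftrightarrow> \<not> (\<exists>C\<in>verts m. A \<subset> C)"
  using assms
proof (induction m)
  case (Node b l r)
  note split = multilinear_split[OF Node.prems(1)]
  show ?case
  proof (cases b)
    case True
    have "\<exists>C\<in>verts (Node b l r). A \<subset> C" if "A \<noteq> leaf_set l \<union> leaf_set r"
      using that True verts_subset[OF Node.prems(2)] by auto
    moreover have "\<not> A \<subset> C" if "A = leaf_set l \<union> leaf_set r" "C \<in> verts (Node b l r)" for C
      using that(1) verts_subset[OF that(2)] by auto
    ultimately show ?thesis using True by auto
  next
    case False
    have "leaf_set l \<inter> leaf_set r = {}" using Node.prems by simp
    then have "A \<in> verts l \<Longrightarrow> A \<notin> tops r" "A \<in> verts r \<Longrightarrow> A \<notin> tops l"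
      using tops_subset[of A r] tops_subset[of A l] split(3,4) by auto
    moreover have "A \<in> verts l \<Longrightarrow> C \<in> verts r \<Longrightarrow> \<not> A \<subset> C" "A \<in> verts r \<Longrightarrow> C \<in> verts l \<Longrightarrow> \<not> A \<subset> C" for C
      using split(3,4) verts_subset[of C l] verts_subset[of C r] by blast+
    ultimately show ?thesis using Node False by auto
  qed
qed auto

lemma subst_cut_disjoint:
  assumes "A \<in> verts m'" "leaf_set m \<inter> leaf_set m' = {}"
  shows "subst (Min A) u (cut m) = cut m"
proof (rule subst_fresh)
  have "finite A" using verts_subset[OF assms(1)] finite_leaf_set by (rule finite_subset)
  then have "Min A \<in> leaf_set m'" using verts_subset[OF assms(1)] verts_nonempty[OF assms(1)] Min_in by blast
  then show "Min A \<notin> set (leaves (cut m))" using leaves_cut_subset[of m] assms(2) by auto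
qed

lemma cut_unmark:
  assumes "multilinear m" "A \<in> verts m"
  shows "cut (unmark A m) = (if A \<in> tops m then subst (Min A) (label m A) (cut m) else cut m)"
  using assms
proof (induction m)
  case (Node b l r)
  note split = multilinear_split[OF Node.prems(1)]
  have d: "leaf_set l \<inter> leaf_set r = {}" using Node.prems by simp
  show ?case
  proof (cases b)
    case True
    then show ?thesis using split(1,2) Node.prems
      by (auto simp: least_eq_Min Min_Un)
  next
    case False
    consider "A \<in> verts l" | "A \<in> verts r" using Node.prems False by auto
    then show ?thesis
    proof cases
      case 1
      moreover have "A \<notin> tops r" using tops_subset[of A r] split(3)[OF 1] by auto
      moreover have "unmark A r = r" using split(3)[OF 1] by (rule unmark_fresh)
      moreover have "A \<noteq> leaf_set l \<union> leaf_set r" using 1 split(1) by auto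
      ultimately show ?thesis using False Node label_left[OF Node.prems(1) 1]
        subst_cut_disjoint[OF 1, of r] d by (simp add: Int_commute del: label.simps)
    next
      case 2
      moreover have "A \<notin> tops l" using tops_subset[of A l] split(4)[OF 2] by auto
      moreover have "unmark A l = l" using split(4)[OF 2] by (rule unmark_fresh)
      moreover have "A \<noteq> leaf_set l \<union> leaf_set r" using 2 split(2) by auto
      ultimately show ?thesis using False Node label_right[OF Node.prems(1) 2]
        subst_cut_disjoint[OF 2, of l] d by (simp del: label.simps)
    qed
  qed
qed auto

text \<open>
  Removing a mark substitutes the word of the vertex into the word of the vertex just below, and leaves
  all other words unchanged.
\<close>

lemma label_unmark:
  assumes "multilinear m" "A \<in> verts m" "B \<in> verts m" "B \<noteq> A"
  shows "label (unmark A m) B = (if A \<subset> B \<and> \<not> (\<exists>C\<in>verts m. A \<subset> C \<and> C \<subset> B)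
    then subst (Min A) (label m A) (label m B) else label m B)"
  using assms
proof (induction m)
  case (Node b l r)
  note lin = Node.prems(1)
  note split = multilinear_split[OF lin]
  have d: "leaf_set l \<inter> leaf_set r = {}" using lin by simp
  show ?case
  proof (cases "A = leaf_set l \<union> leaf_set r")
    case True
    then have "B \<in> verts l \<or> B \<in> verts r" using verts_Node[OF Node.prems(3)] Node.prems(4) by blast
    then have "\<not> A \<subset> B" using True verts_subset[of B l] verts_subset[of B r] by auto
    then show ?thesis using True by auto
  next
    case A: False
    then consider "A \<in> verts l" | "A \<in> verts r" using verts_Node[OF Node.prems(2)] by blast
    then show ?thesis
    proof cases
      case 1
      have r: "unmark A r = r" using split(3)[OF 1] by (rule unmark_fresh)
      have u: "unmark A (Node b l r) = Node b (unmark A l) r" using A r by simp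
      have lin': "multilinear (Node b (unmark A l) r)" using lin by simp
      show ?thesis
      proof (cases "B = leaf_set l \<union> leaf_set r")
        case True
        have "C \<in> verts l" if "C \<in> verts (Node b l r)" "A \<subset> C" "C \<subset> B" for C
          using verts_Node[OF that(1)] that(2,3) True split(3)[OF 1] verts_subset[of C] by blast
        moreover have "C \<subset> B" if "C \<in> verts l" for C
          using that True split(1) verts_subset[of C l] by auto
        moreover have "verts l \<subseteq> verts (Node b l r)" by auto
        ultimately have "(\<exists>C\<in>verts (Node b l r). A \<subset> C \<and> C \<subset> B) \<longleftrightarrow> (\<exists>C\<in>verts l. A \<subset> C)"
          by blast
        moreover have "subst (Min A) u (cut r) = cut r" for u
          using subst_cut_disjoint[OF 1, of r] d by (simp add: Int_commute)
        moreover have "A \<subset> B" using True A verts_subset[OF Node.prems(2)] by auto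
        moreover have "cut (unmark A l) = (if \<exists>C\<in>verts l. A \<subset> C then cut l else subst (Min A) (label l A) (cut l))"
          using cut_unmark[of l A] tops_iff[of l A] lin 1 by simp
        ultimately show ?thesis
          unfolding u label_left[OF lin 1] using True by simp
      next
        case False
        then consider (l) "B \<in> verts l" | (r) "B \<in> verts r" using verts_Node[OF Node.prems(3)] by blast
        then show ?thesis
        proof cases
          case l
          have "C \<in> verts l" if "C \<in> verts (Node b l r)" "A \<subset> C" "C \<subset> B" for C
            using verts_Node[OF that(1)] that(2,3) verts_subset[OF l] split(3)[OF 1] verts_subset[of C] by blast
          moreover have "verts l \<subseteq> verts (Node b l r)" by auto
          ultimately have "(\<exists>C\<in>verts (Node b l r). A \<subset> C \<and> C \<subset> B) \<longleftrightarrow> (\<exists>C\<in>verts l. A \<subset> C \<and> C \<subset> B)"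
            by blast
          moreover have "B \<in> verts (unmark A l)" using l lin Node.prems by (simp add: verts_unmark)
          ultimately show ?thesis
            unfolding u label_left[OF lin 1] label_left[OF lin l]
            using label_left[OF lin'] Node.IH(1)[OF _ 1 l] lin Node.prems by simp
        next
          case r
          have "\<not> A \<subset> B" using split(3)[OF 1] verts_subset[OF r] by auto
          then show ?thesis unfolding u using label_right[OF lin' r] label_right[OF lin r] by auto
        qed
      qed
    next
      case 2
      have l: "unmark A l = l" using split(4)[OF 2] by (rule unmark_fresh)
      have u: "unmark A (Node b l r) = Node b l (unmark A r)" using A l by simp
      have lin': "multilinear (Node b l (unmark A r))" using lin by simp
      show ?thesis
      proof (cases "B = leaf_set l \<union> leaf_set r")
        case True
        have "C \<in> verts r" if "C \<in> verts (Node b l r)" "A \<subset> C" "C \<subset> B" for C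
          using verts_Node[OF that(1)] that(2,3) True split(4)[OF 2] verts_subset[of C] by blast
        moreover have "C \<subset> B" if "C \<in> verts r" for C
          using that True split(2) verts_subset[of C r] by auto
        moreover have "verts r \<subseteq> verts (Node b l r)" by auto
        ultimately have "(\<exists>C\<in>verts (Node b l r). A \<subset> C \<and> C \<subset> B) \<longleftrightarrow> (\<exists>C\<in>verts r. A \<subset> C)"
          by blast
        moreover have "subst (Min A) u (cut l) = cut l" for u
          using subst_cut_disjoint[OF 2, of l] d by (simp add: Int_commute)
        moreover have "A \<subset> B" using True A verts_subset[OF Node.prems(2)] by auto
        moreover have "cut (unmark A r) = (if \<exists>C\<in>verts r. A \<subset> C then cut r else subst (Min A) (label r A) (cut r))"
          using cut_unmark[of r A] tops_iff[of r A] lin 2 by simp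
        ultimately show ?thesis
          unfolding u label_right[OF lin 2] using True by simp
      next
        case False
        then consider (l) "B \<in> verts l" | (r) "B \<in> verts r" using verts_Node[OF Node.prems(3)] by blast
        then show ?thesis
        proof cases
          case r
          have "C \<in> verts r" if "C \<in> verts (Node b l r)" "A \<subset> C" "C \<subset> B" for C
            using verts_Node[OF that(1)] that(2,3) verts_subset[OF r] split(4)[OF 2] verts_subset[of C] by blast
          moreover have "verts r \<subseteq> verts (Node b l r)" by auto
          ultimately have "(\<exists>C\<in>verts (Node b l r). A \<subset> C \<and> C \<subset> B) \<longleftrightarrow> (\<exists>C\<in>verts r. A \<subset> C \<and> C \<subset> B)"
            by blast
          moreover have "B \<in> verts (unmark A r)" using r lin Node.prems by (simp add: verts_unmark)
          ultimately show ?thesis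
            unfolding u label_right[OF lin 2] label_right[OF lin r]
            using label_right[OF lin'] Node.IH(2)[OF _ 2 r] lin Node.prems by simp
        next
          case l
          have "\<not> A \<subset> B" using split(4)[OF 2] verts_subset[OF l] by auto
          then show ?thesis unfolding u using label_left[OF lin' l] label_left[OF lin l] by auto
        qed
      qed
    qed
  qed
qed auto

text \<open>
  The vertices containing a given one form a chain, so their intersection is the smallest of them.
\<close>

lemma parent_iff:
  assumes T: "reduced_tree L T" "finite L" and A: "A \<in> T" and B: "B \<in> T" and AL: "A \<noteq> L"
  shows "B = parent T A \<longleftrightarrow> A \<subset> B \<and> \<not> (\<exists>C\<in>T. A \<subset> C \<and> C \<subset> B)"
proof -
  let ?U = "{C \<in> T. A \<subset> C}"
  have "2 \<le> card A" using T(1) A by (simp add: reduced_tree_def)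
  then have ne: "A \<noteq> {}" by auto
  have L: "L \<in> ?U" using T(1) A AL by (simp add: reduced_tree_def psubset_eq)
  have "T \<subseteq> Pow L" using T by (auto simp: reduced_tree_def)
  then have fin: "finite ?U" using T(2) finite_subset[of T "Pow L"] by simp
  have chain: "C \<subseteq> D \<or> D \<subseteq> C" if "C \<in> ?U" "D \<in> ?U" for C D
  proof -
    have "\<forall>A\<in>T. \<forall>B\<in>T. A \<subseteq> B \<or> B \<subseteq> A \<or> A \<inter> B = {}" using T(1) by (simp add: reduced_tree_def)
    then have "C \<subseteq> D \<or> D \<subseteq> C \<or> C \<inter> D = {}" using that by simp
    then show ?thesis using that ne by blast
  qed
  have "?U \<noteq> {}" using L by blast
  then obtain M where M: "M \<in> ?U" "\<forall>C\<in>?U. C \<subseteq> M \<longrightarrow> M = C"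
    using finite_has_minimal[OF fin] by blast
  have min: "M \<subseteq> C" if "C \<in> ?U" for C
    using chain[OF M(1) that] M(2) that by (metis order_refl)
  have p: "parent T A = M" unfolding parent_def
  proof (rule antisym)
    show "\<Inter>?U \<subseteq> M" using M(1) by (rule Inter_lower)
    show "M \<subseteq> \<Inter>?U" using min by (rule Inter_greatest)
  qed
  show ?thesis
  proof
    assume "B = parent T A"
    then have "B = M" using p by simp
    moreover have "\<not> C \<subset> M" if "C \<in> ?U" for C using min[OF that] by blast
    ultimately show "A \<subset> B \<and> \<not> (\<exists>C\<in>T. A \<subset> C \<and> C \<subset> B)" using M(1) by blast
  next
    assume *: "A \<subset> B \<and> \<not> (\<exists>C\<in>T. A \<subset> C \<and> C \<subset> B)"
    then have "M \<subseteq> B" using min B by simp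
    moreover have "\<not> M \<subset> B" using * M(1) by blast
    ultimately show "B = parent T A" using p by blast
  qed
qed

section \<open>Contracting edges of marked words\<close>

text \<open>
  Read backwards from the multilinearity of a composite word, this is the disjointness condition for the
  composition that produced it.
\<close>

lemma multilinear_leaves_disjoint:
  "\<lbrakk>distinct (leaves s); distinct (leaves (subst i u s)); i \<in> set (leaves s)\<rbrakk>
    \<Longrightarrow> set (leaves u) \<inter> (set (leaves s) - {i}) = {}"
proof (induction s)
  case (Mul s t)
  have s: "set (leaves u) \<inter> (set (leaves s) - {i}) = {}" "set (leaves u) \<inter> set (leaves t) = {}"
    if "i \<in> set (leaves s)" "i \<notin> set (leaves t)"
    using that Mul by (auto simp: subst_fresh set_leaves_subst)
  have t: "set (leaves u) \<inter> (set (leaves t) - {i}) = {}" "set (leaves u) \<inter> set (leaves s) = {}"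
    if "i \<in> set (leaves t)" "i \<notin> set (leaves s)"
    using that Mul by (auto simp: subst_fresh set_leaves_subst)
  show ?case using s t Mul.prems by auto
qed auto

lemma word_space: "t \<in> multilinear_words I \<Longrightarrow> word t \<in> op_space magmatic_operad I"
  by (auto simp: mag_sel word_def)

lemma push_indicator:
  assumes "finite A" "a \<in> A"
  shows "push A h (\<lambda>x. if x = a then c else 0) = (\<lambda>t. if t = h a then c else 0)"
proof
  fix t
  have "push A h (\<lambda>x. if x = a then c else 0) t = (\<Sum>x\<in>A. if x = a then (if h a = t then c else 0) else 0)"
    unfolding push_def by (intro sum.cong) auto
  then show "push A h (\<lambda>x. if x = a then c else 0) t = (if t = h a then c else 0)"
    using assms by auto
qed

lemma comp_word:
  assumes "finite I" "finite J" "s \<in> multilinear_words I" "u \<in> multilinear_words J"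
  shows "op_comp magmatic_operad I i J (word s) (word u) = word (subst i u s)"
proof -
  have eq: "(\<lambda>(s', u'). word s s' * word u u') = (\<lambda>x. if x = (s, u) then 1 else 0)"
    by (auto simp: word_def)
  have "op_comp magmatic_operad I i J (word s) (word u) = push (multilinear_words I \<times> multilinear_words J)
      (\<lambda>(s, u). subst i u s) (\<lambda>x. if x = (s, u) then 1 else 0)"
    by (simp only: mag_sel eq)
  also have "\<dots> = (\<lambda>t. if t = (\<lambda>(s, u). subst i u s) (s, u) then 1 else 0)"
    using assms by (intro push_indicator) (auto simp: finite_multilinear_words)
  finally show ?thesis by (simp add: word_def)
qed

lemma relabel_word:
  assumes "finite I" "t \<in> multilinear_words I"
  shows "op_relabel magmatic_operad \<sigma> I (word t) = word (rename \<sigma> t)"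
  using assms push_indicator[of "multilinear_words I" t] by (simp add: mag_sel finite_multilinear_words word_def)

locale magmatic_ideal = operad_ideal magmatic_operad K for K
begin

definition decor :: "marked \<Rightarrow> nat set \<Rightarrow> (magma \<Rightarrow> complex) set" where
  "decor m = (\<lambda>A\<in>verts m. cl (inputs (verts m) A) (word (label m A)))"

definition val :: "(nat set set \<Rightarrow> (nat set \<Rightarrow> (magma \<Rightarrow> complex) set) \<Rightarrow> complex) \<Rightarrow> marked \<Rightarrow> complex" where
  "val \<phi> m = \<phi> (verts m) (decor m)"

lemma decor_decorations: "multilinear m \<Longrightarrow> decor m \<in> decorations Q (verts m)"
  by (auto simp: decor_def decorations_def q_space label_words intro!: word_space)

lemma contract_labels:
  assumes m: "m = Node True l r" "multilinear m" and A: "A \<in> verts m" "A \<noteq> leaf_set m" and B: "B = parent (verts m) A"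
    and Bv: "B \<in> verts m"
  shows "composable (inputs (verts m) B) (Min A) (inputs (verts m) A)"
    and "graft (inputs (verts m) B) (Min A) (inputs (verts m) A) = inputs (verts m - {A}) B"
    and "label (unmark A m) B = subst (Min A) (label m A) (label m B)"
proof -
  have T: "reduced_tree (leaf_set m) (verts m)" using reduced_tree_verts m by simp
  have AB: "A \<subset> B" "\<not> (\<exists>C\<in>verts m. A \<subset> C \<and> C \<subset> B)"
    using parent_iff[OF T _ A(1) Bv A(2)] B by auto
  show label: "label (unmark A m) B = subst (Min A) (label m A) (label m B)"
    using label_unmark[OF m(2) A(1) Bv] AB by auto
  have ne: "A \<noteq> {}" using verts_nonempty A by blast
  have i: "Min A \<in> inputs (verts m) B"
    unfolding inputs_def Let_def using A(1) AB ne by (intro imageI) auto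
  have dj: "set (leaves (label m A)) \<inter> (set (leaves (label m B)) - {Min A}) = {}"
    using multilinear_leaves_disjoint[of "label m B" "Min A" "label m A"] i inputs_verts[OF m(2) Bv]
      distinct_label[OF m(2)] distinct_label[of "unmark A m" B] label m(2) by simp
  then show "composable (inputs (verts m) B) (Min A) (inputs (verts m) A)"
    using i by (simp add: composable_def inputs_verts[OF m(2)] A(1) Bv)
  have B': "B \<in> verts (unmark A m)" using verts_unmark[OF m(2), of A] Bv AB by auto
  then have "inputs (verts m - {A}) B = set (leaves (label (unmark A m) B))"
    using inputs_verts[of "unmark A m" B] m(2) by (simp add: verts_unmark)
  then show "graft (inputs (verts m) B) (Min A) (inputs (verts m) A) = inputs (verts m - {A}) B"
    using i label inputs_verts[OF m(2) Bv] inputs_verts[OF m(2) A(1)]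
    by (simp add: graft_def set_leaves_subst)
qed

lemma inputs_unmark_other:
  assumes m: "m = Node True l r" "multilinear m" and A: "A \<in> verts m" "A \<noteq> leaf_set m" and B: "B \<noteq> parent (verts m) A"
    and Bv: "B \<in> verts m" "B \<noteq> A"
  shows "label (unmark A m) B = label m B" and "inputs (verts m - {A}) B = inputs (verts m) B"
proof -
  have T: "reduced_tree (leaf_set m) (verts m)" using reduced_tree_verts m by simp
  show label: "label (unmark A m) B = label m B"
    using label_unmark[OF m(2) A(1) Bv] parent_iff[OF T _ A(1) Bv(1) A(2)] B by auto
  show "inputs (verts m - {A}) B = inputs (verts m) B"
    using inputs_verts[of "unmark A m" B] inputs_verts[OF m(2) Bv(1)] m(2) Bv label by (simp add: verts_unmark)
qed

text \<open>
  Contracting an edge composes the classes of two words, hence yields the class of the substituted word,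
  which is the word of the unmarked tree by \<open>label_unmark\<close>.
\<close>

lemma contract_decor:
  assumes m: "m = Node True l r" "multilinear m" and A: "A \<in> verts m" "A \<noteq> leaf_set m"
  shows "contract Q (verts m) A (decor m) = decor (unmark A m)"
proof
  fix B
  show "contract Q (verts m) A (decor m) B = decor (unmark A m) B"
  proof (cases "B \<in> verts m - {A}")
    case False
    then show ?thesis
      unfolding contract_def decor_def by (simp only: verts_unmark[OF m(2)] restrict_def if_False)
  next
    case True
    then have B: "B \<in> verts m" "B \<noteq> A" by auto
    show ?thesis
    proof (cases "B = parent (verts m) A")
      case True
      note c = contract_labels[OF m A True B(1)]
      have "op_comp Q (inputs (verts m) B) (Min A) (inputs (verts m) A) (decor m B) (decor m A)
        = cl (inputs (verts m - {A}) B) (word (label (unmark A m) B))"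
        using c m(2) A B finite_composable[OF c(1)]
        by (simp add: decor_def q_comp[OF c(1)] word_space label_words comp_word)
      then show ?thesis using B True m(2) A by (simp add: contract_def decor_def verts_unmark)
    next
      case False
      then show ?thesis using B m(2) A inputs_unmark_other[OF m A False B]
        by (simp add: contract_def decor_def verts_unmark)
    qed
  qed
qed

lemma differential_marked:
  assumes m: "m = Node True l r" "multilinear m"
  shows "differential Q (leaf_set m) \<phi> (verts m) (decor m) = (\<Sum>A\<in>verts m - {leaf_set m}.
     (- 1) ^ card {B \<in> verts m - {leaf_set m}. set_encode B < set_encode A} * val \<phi> (unmark A m))"
  unfolding differential_def val_def
  by (intro sum.cong refl) (simp add: contract_decor[OF m] verts_unmark[OF m(2)])

end

section \<open>Marked words describe all trees decorated with words\<close>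

primrec plug :: "(nat \<Rightarrow> marked) \<Rightarrow> magma \<Rightarrow> marked" where
  "plug \<sigma> (Var i) = \<sigma> i"
| "plug \<sigma> (s \<cdot> u) = Node False (plug \<sigma> s) (plug \<sigma> u)"

lemma leaf_set_plug: "leaf_set (plug \<sigma> t) = (\<Union>i\<in>set (leaves t). leaf_set (\<sigma> i))"
  by (induction t) auto

lemma verts_plug: "verts (plug \<sigma> t) = (\<Union>i\<in>set (leaves t). verts (\<sigma> i))"
  by (induction t) auto

lemma cut_plug: "(\<And>i. i \<in> set (leaves t) \<Longrightarrow> cut (\<sigma> i) = Var i) \<Longrightarrow> cut (plug \<sigma> t) = t"
  by (induction t) auto

lemma multilinear_plug:
  assumes "distinct (leaves t)" "\<And>i. i \<in> set (leaves t) \<Longrightarrow> multilinear (\<sigma> i)"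
    "\<And>i j. \<lbrakk>i \<in> set (leaves t); j \<in> set (leaves t); i \<noteq> j\<rbrakk> \<Longrightarrow> leaf_set (\<sigma> i) \<inter> leaf_set (\<sigma> j) = {}"
  shows "multilinear (plug \<sigma> t)"
  using assms
proof (induction t)
  case (Mul s u)
  have "leaf_set (plug \<sigma> s) \<inter> leaf_set (plug \<sigma> u) = {}"
    unfolding leaf_set_plug using Mul.prems(1) Mul.prems(3) by fastforce
  then show ?case using Mul by simp
qed auto

lemma label_plug:
  "\<lbrakk>multilinear (plug \<sigma> t); i \<in> set (leaves t); A \<in> verts (\<sigma> i)\<rbrakk> \<Longrightarrow> label (plug \<sigma> t) A = label (\<sigma> i) A"
proof (induction t)
  case (Mul s u)
  note m = Mul.prems(1)[unfolded plug.simps]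
  have "i \<in> set (leaves s) \<or> i \<in> set (leaves u)" using Mul.prems(2) by simp
  then show ?case
  proof
    assume i: "i \<in> set (leaves s)"
    then have "A \<in> verts (plug \<sigma> s)" using Mul.prems(3) by (auto simp: verts_plug)
    then show ?thesis using Mul.IH(1) i Mul.prems label_left[OF m] by simp
  next
    assume i: "i \<in> set (leaves u)"
    then have "A \<in> verts (plug \<sigma> u)" using Mul.prems(3) by (auto simp: verts_plug)
    then show ?thesis using Mul.IH(2) i Mul.prems label_right[OF m] by simp
  qed
qed auto

text \<open>
  The root word is read as a pattern, and each of its variables is replaced by the marked word of the
  subtree hanging at that input. By induction on the number of leaves every decorated tree is a marked
  word, so that checks on all trees and all basic decorations become checks on marked words.
\<close>

lemma marked_of_tree:
  assumes "finite L" "reduced_tree L T" "\<And>A. A \<in> T \<Longrightarrow> t A \<in> multilinear_words (inputs T A)"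
  shows "\<exists>l r. multilinear (Node True l r) \<and> leaf_set (Node True l r) = L \<and> verts (Node True l r) = T
    \<and> (\<forall>A\<in>T. label (Node True l r) A = t A)"
  using assms
proof (induction "card L" arbitrary: L T rule: less_induct)
  case less
  note fin = less.prems(1)
  have T: "L \<in> T" "\<And>A. A \<in> T \<Longrightarrow> A \<subseteq> L \<and> 2 \<le> card A" using less.prems(2) by (auto simp: reduced_tree_def)
  have lam: "A \<subseteq> B \<or> B \<subseteq> A \<or> A \<inter> B = {}" if "A \<in> T" "B \<in> T" for A B
  proof -
    have "\<forall>A\<in>T. \<forall>B\<in>T. A \<subseteq> B \<or> B \<subseteq> A \<or> A \<inter> B = {}" using less.prems(2) by (simp add: reduced_tree_def)
    then show ?thesis using that by blast
  qed
  define S where "S = {B. B \<in> T \<union> (\<lambda>a. {a}) ` L \<and> B \<subset> L}"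
  define kids where "kids = {B \<in> S. \<not> (\<exists>C\<in>S. B \<subset> C)}"
  have inp: "inputs T L = Min ` kids" by (simp only: inputs_def Let_def S_def kids_def)
  have finS: "finite S" using fin finite_subset[of S "Pow L"] by (auto simp: S_def)
  have kS: "C \<in> S" if "C \<in> kids" for C using that by (simp add: kids_def)
  have kL: "C \<subset> L" "finite C" "C \<in> T \<or> (\<exists>a\<in>L. C = {a})" if "C \<in> kids" for C
    using kS[OF that] fin finite_subset[of C L] by (auto simp: S_def)
  have kne: "C \<noteq> {}" if "C \<in> kids" for C
    using kL(3)[OF that]
  proof
    assume "C \<in> T"
    then have "2 \<le> card C" using T(2) by blast
    then show "C \<noteq> {}" by (metis card.empty not_numeral_le_zero)
  qed blast
  have cover: "\<exists>C\<in>kids. B \<subseteq> C" if B: "B \<in> S" for B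
  proof -
    obtain M where M: "M \<in> S" "B \<subseteq> M" "\<forall>C\<in>S. M \<subseteq> C \<longrightarrow> M = C"
      using finite_has_maximal2[OF finS B] by blast
    then have "M \<in> kids" unfolding kids_def by blast
    then show ?thesis using M(2) by blast
  qed
  have disj: "B \<inter> C = {}" if B: "B \<in> kids" and C: "C \<in> kids" and "B \<noteq> C" for B C
  proof -
    have "\<not> B \<subset> C" "\<not> C \<subset> B" using B C by (auto simp: kids_def)
    then have "\<not> B \<subseteq> C" "\<not> C \<subseteq> B" using \<open>B \<noteq> C\<close> by auto
    then show ?thesis using kL(3)[OF B] kL(3)[OF C] lam[of B C] by blast
  qed
  have cardL: "2 \<le> card L" using T by simp
  have sing: "{a} \<in> S" if "a \<in> L" for a
  proof -
    have "{a} \<noteq> L" using cardL by auto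
    then show ?thesis using that by (auto simp: S_def)
  qed
  have union: "\<Union>kids = L"
  proof
    show "\<Union>kids \<subseteq> L" using kL(1) by blast
    show "L \<subseteq> \<Union>kids" using sing cover by blast
  qed
  have inj: "inj_on Min kids"
  proof (rule inj_onI)
    fix B C assume B: "B \<in> kids" and C: "C \<in> kids" and eq: "Min B = Min C"
    have "Min B \<in> B" "Min C \<in> C" using kL(2) kne B C by (auto intro: Min_in)
    then show "B = C" using disj[OF B C] eq by auto
  qed
  have sub: "\<exists>l r. multilinear (Node True l r) \<and> leaf_set (Node True l r) = C \<and> verts (Node True l r) = {B \<in> T. B \<subseteq> C}
    \<and> (\<forall>A\<in>{B \<in> T. B \<subseteq> C}. label (Node True l r) A = t A)" if C: "C \<in> kids" "C \<in> T" for C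
  proof (rule less.hyps)
    show "card C < card L" using kL(1)[OF C(1)] fin psubset_card_mono by blast
    show "finite C" using kL(2)[OF C(1)] .
    show "reduced_tree C {B \<in> T. B \<subseteq> C}" using C(2) T(2) lam by (simp add: reduced_tree_def)
    fix A assume A: "A \<in> {B \<in> T. B \<subseteq> C}"
    then have "inputs {B \<in> T. B \<subseteq> C} A = inputs T A" by (intro inputs_cong) auto
    then show "t A \<in> multilinear_words (inputs {B \<in> T. B \<subseteq> C} A)" using A less.prems(3) by simp
  qed
  define good where "good C m \<longleftrightarrow> multilinear m \<and> leaf_set m = C \<and> cut m = Var (Min C) \<and> verts m = {B \<in> T. B \<subseteq> C}
    \<and> (\<forall>A\<in>verts m. label m A = t A)" for C m
  have ex: "\<exists>m. good C m" if C: "C \<in> kids" for C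
  proof (cases "C \<in> T")
    case True
    then obtain l r where lr: "multilinear (Node True l r)" "leaf_set (Node True l r) = C"
      "verts (Node True l r) = {B \<in> T. B \<subseteq> C}" "\<forall>A\<in>{B \<in> T. B \<subseteq> C}. label (Node True l r) A = t A"
      using sub[OF C] by blast
    have "cut (Node True l r) = Var (Min C)" using lr(2) by (simp add: least_eq_Min flip: Min_Un)
    then have "good C (Node True l r)" using lr unfolding good_def by simp
    then show ?thesis by blast
  next
    case False
    then obtain a where a: "C = {a}" using kL(3)[OF C] by auto
    have "B \<notin> T" if "B \<subseteq> {a}" for B
      using T(2)[of B] card_mono[OF _ that] by auto
    then have "good C (Leaf a)" using a by (auto simp: good_def)
    then show ?thesis by blast
  qed
  define K where "K j = the_inv_into kids Min j" for j
  have K: "K j \<in> kids" "Min (K j) = j" if "j \<in> inputs T L" for j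
    using that the_inv_into_into[OF inj _ order_refl, of j] f_the_inv_into_f[OF inj, of j]
    by (auto simp: K_def inp)
  define \<sigma> where "\<sigma> j = (SOME m. good (K j) m)" for j
  have \<sigma>: "good (K j) (\<sigma> j)" if "j \<in> inputs T L" for j
    using ex[OF K(1)[OF that]] unfolding \<sigma>_def by (rule someI_ex)
  have tL: "distinct (leaves (t L))" "set (leaves (t L)) = inputs T L"
    using less.prems(3)[OF T(1)] by (auto simp: multilinear_words_def)
  have Kimg: "K ` inputs T L = kids"
    using the_inv_into_onto[OF inj] by (simp add: K_def[abs_def] inp)
  have dK: "K i \<inter> K j = {}" if "i \<in> inputs T L" "j \<in> inputs T L" "i \<noteq> j" for i j
  proof -
    have "K i \<noteq> K j" using K(2)[OF that(1)] K(2)[OF that(2)] that(3) by metis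
    then show ?thesis using disj[OF K(1)[OF that(1)] K(1)[OF that(2)]] by blast
  qed
  have m: "multilinear (plug \<sigma> (t L))"
    using \<sigma> dK tL by (intro multilinear_plug) (auto simp: good_def)
  have leaf_set: "leaf_set (plug \<sigma> (t L)) = L"
  proof -
    have "leaf_set (plug \<sigma> (t L)) = (\<Union>j\<in>inputs T L. K j)"
      using \<sigma> tL by (auto simp: leaf_set_plug good_def)
    then show ?thesis using union Kimg by simp
  qed
  have verts: "verts (plug \<sigma> (t L)) = T - {L}"
  proof -
    have "verts (plug \<sigma> (t L)) = (\<Union>j\<in>inputs T L. {B \<in> T. B \<subseteq> K j})"
      using \<sigma> tL by (auto simp: verts_plug good_def)
    also have "\<dots> = (\<Union>C\<in>kids. {B \<in> T. B \<subseteq> C})" using Kimg by blast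
    also have "\<dots> = T - {L}"
    proof (intro equalityI subsetI)
      fix B assume "B \<in> (\<Union>C\<in>kids. {B \<in> T. B \<subseteq> C})"
      then obtain C where "C \<in> kids" "B \<in> T" "B \<subseteq> C" by blast
      then show "B \<in> T - {L}" using kL(1)[of C] by blast
    next
      fix B assume B: "B \<in> T - {L}"
      then have "B \<in> S" using T(2)[of B] by (auto simp: S_def)
      then show "B \<in> (\<Union>C\<in>kids. {B \<in> T. B \<subseteq> C})" using cover B by blast
    qed
    finally show ?thesis .
  qed
  have cut: "cut (plug \<sigma> (t L)) = t L"
    using \<sigma> K tL by (intro cut_plug) (auto simp: good_def)
  have label: "label (plug \<sigma> (t L)) A = t A" if "A \<in> T - {L}" for A
  proof -
    have "A \<in> verts (plug \<sigma> (t L))" using that verts by simp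
    then obtain j where j: "j \<in> set (leaves (t L))" "A \<in> verts (\<sigma> j)"
      by (auto simp: verts_plug)
    then show ?thesis using label_plug[OF m j] \<sigma>[of j] tL by (simp add: good_def)
  qed
  show ?case
  proof (cases "t L")
    case (Var i)
    then have "inputs T L = {i}" using tL by simp
    then have "kids = {K i}" using Kimg by simp
    then show ?thesis using union kL(1) by auto
  next
    case (Mul s u)
    let ?m = "Node True (plug \<sigma> s) (plug \<sigma> u)"
    have F: "plug \<sigma> (t L) = Node False (plug \<sigma> s) (plug \<sigma> u)" using Mul by simp
    have "multilinear ?m" "leaf_set ?m = L" using m leaf_set F by simp_all
    moreover have "verts ?m = T" using verts leaf_set T(1) F by auto
    moreover have "label ?m A = t A" if "A \<in> T" for A
    proof (cases "A = L")
      case True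
      then show ?thesis using cut Mul leaf_set F by simp
    next
      case False
      then show ?thesis using label[of A] that leaf_set F by simp
    qed
    ultimately show ?thesis by blast
  qed
qed

lemma multilinear_words_nonempty:
  assumes "finite I" "I \<noteq> {}"
  shows "multilinear_words I \<noteq> {}"
  using assms
proof (induction I rule: finite_ne_induct)
  case (singleton x)
  then show ?case by (simp add: words_singleton)
next
  case (insert x F)
  then obtain t where "t \<in> multilinear_words F" by auto
  then have "Var x \<cdot> t \<in> multilinear_words (insert x F)" using insert by (auto simp: multilinear_words_def)
  then show ?case by blast
qed

lemma inputs_finite_nonempty:
  assumes "finite L" "reduced_tree L T" "A \<in> T"
  shows "finite (inputs T A)" "inputs T A \<noteq> {}"
proof -
  let ?S = "{B. B \<in> T \<union> (\<lambda>a. {a}) ` A \<and> B \<subset> A}"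
  have A: "finite A" "2 \<le> card A" using assms finite_subset[of A L] by (auto simp: reduced_tree_def)
  have fS: "finite ?S" using A finite_subset[of ?S "Pow A"] by auto
  then show "finite (inputs T A)" 
    unfolding inputs_def Let_def by (intro finite_imageI finite_subset[OF _ fS]) blast
  obtain a where a: "a \<in> A" using A by fastforce
  then have "{a} \<in> ?S" using A by auto
  then obtain M where "M \<in> ?S" "\<forall>C\<in>?S. M \<subseteq> C \<longrightarrow> M = C"
    using finite_has_maximal2[OF fS] by meson
  then have "M \<in> {B \<in> ?S. \<not> (\<exists>C\<in>?S. B \<subset> C)}" by blast
  then show "inputs T A \<noteq> {}" unfolding inputs_def Let_def by blast
qed

lemma marked_of_reduced_tree:
  assumes "finite L" "reduced_tree L T"
  obtains l r where "multilinear (Node True l r)" "leaf_set (Node True l r) = L" "verts (Node True l r) = T"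
proof -
  have "\<exists>t. t \<in> multilinear_words (inputs T A)" if "A \<in> T" for A
    using multilinear_words_nonempty[OF inputs_finite_nonempty[OF assms that]] by blast
  then obtain t where "\<And>A. A \<in> T \<Longrightarrow> t A \<in> multilinear_words (inputs T A)" by metis
  then show ?thesis using marked_of_tree[OF assms, of t] that by blast
qed

section \<open>Multilinear forms on decorations\<close>

lemma decorations_update:
  "\<lbrakk>p \<in> decorations P T; A \<in> T; x \<in> op_space P (inputs T A)\<rbrakk> \<Longrightarrow> p(A := x) \<in> decorations P T"
  unfolding decorations_def PiE_iff extensional_def by simp

context operad_ideal begin

text \<open>
  Linearity of a form on a component of the quotient operad: the condition that cochains satisfy in each
  vertex separately.
\<close>

definition additive_form :: "nat set \<Rightarrow> ('a set \<Rightarrow> complex) \<Rightarrow> bool" where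
  "additive_form I g \<longleftrightarrow> (\<forall>X\<in>op_space Q I. \<forall>Y\<in>op_space Q I. g (op_add Q I X Y) = g X + g Y)
     \<and> (\<forall>c. \<forall>X\<in>op_space Q I. g (op_scale Q I c X) = c * g X)"

lemma form_of_cochain:
  assumes "\<phi> \<in> cochains Q L n" "reduced_tree L T" "card T = n" "A \<in> T" "p \<in> decorations Q T"
  shows "additive_form (inputs T A) (\<lambda>X. \<phi> T (p(A := X)))"
  using assms unfolding additive_form_def cochains_def by blast

lemma cochainI:
  assumes "\<And>T A p. \<lbrakk>reduced_tree L T; card T = n; A \<in> T; p \<in> decorations Q T\<rbrakk>
    \<Longrightarrow> additive_form (inputs T A) (\<lambda>X. \<phi> T (p(A := X)))"
  shows "\<phi> \<in> cochains Q L n"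
  using assms unfolding cochains_def additive_form_def by blast

lemma form_sum:
  "(\<And>i. i \<in> S \<Longrightarrow> additive_form I (g i)) \<Longrightarrow> additive_form I (\<lambda>X. \<Sum>i\<in>S. c i * g i X)"
  by (simp add: additive_form_def algebra_simps sum.distrib sum_distrib_left)

lemma form_comp:
  assumes "additive_form J g" "op_linear Q I J f"
  shows "additive_form I (\<lambda>X. g (f X))"
  using assms by (simp add: additive_form_def op_linear_def)

end

context magmatic_ideal begin

text \<open>
  Words span the magmatic operad, so their classes span the quotient.
\<close>

lemma form_expand:
  assumes g: "additive_form I g" and I: "finite I" and f: "f \<in> op_space magmatic_operad I"
  shows "g (cl I f) = (\<Sum>t\<in>multilinear_words I. f t * g (cl I (word t)))"
proof -
  have zero: "g (cl I (op_zero magmatic_operad I)) = 0"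
  proof -
    have "op_scale Q I 0 (cl I f) = cl I (op_zero magmatic_operad I)"
      using I f by (simp add: q_scale scale_zero)
    moreover have "g (op_scale Q I 0 (cl I f)) = 0 * g (cl I f)"
      using g f unfolding additive_form_def q_space by blast
    ultimately show ?thesis by simp
  qed
  have "g (cl I (\<lambda>t. if t \<in> S then f t else 0)) = (\<Sum>t\<in>S. f t * g (cl I (word t)))"
    if "finite S" "S \<subseteq> multilinear_words I" for S
    using that
  proof (induction S rule: finite_induct)
    case empty
    then show ?case using zero by (simp add: mag_sel)
  next
    case (insert t S)
    let ?f = "\<lambda>s. if s \<in> S then f s else 0"
    let ?w = "op_scale magmatic_operad I (f t) (word t)"
    have f': "?f \<in> op_space magmatic_operad I" using f by (auto simp: mag_sel)
    have w: "word t \<in> op_space magmatic_operad I" using insert.prems by (intro word_space) simp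
    have w': "?w \<in> op_space magmatic_operad I" using I w by (rule scale_closed)
    have "(\<lambda>s. if s \<in> insert t S then f s else 0) = op_add magmatic_operad I ?w ?f"
      using insert.hyps by (auto simp: mag_sel word_def)
    then have "g (cl I (\<lambda>s. if s \<in> insert t S then f s else 0)) = g (op_add Q I (cl I ?w) (cl I ?f))"
      using I f' w' by (simp add: q_add)
    also have "\<dots> = g (cl I ?w) + g (cl I ?f)"
      using g f' w' unfolding additive_form_def q_space by blast
    also have "cl I ?w = op_scale Q I (f t) (cl I (word t))" using I w by (simp add: q_scale)
    also have "g (op_scale Q I (f t) (cl I (word t))) = f t * g (cl I (word t))"
      using g w unfolding additive_form_def q_space by blast
    finally show ?case using insert by simp
  qed
  from this[of "multilinear_words I"] show ?thesis
  proof -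
    assume *: "\<lbrakk>finite (multilinear_words I); multilinear_words I \<subseteq> multilinear_words I\<rbrakk> \<Longrightarrow>
      g (cl I (\<lambda>t. if t \<in> multilinear_words I then f t else 0)) = (\<Sum>t\<in>multilinear_words I. f t * g (cl I (word t)))"
    have "(\<lambda>t. if t \<in> multilinear_words I then f t else 0) = f" using f by (auto simp: mag_sel)
    then show ?thesis using * I finite_multilinear_words by simp
  qed
qed

text \<open>
  The vertices are treated one after the other: once the decoration of a vertex is expanded in classes of
  words, it may be assumed to be one of them.
\<close>

lemma cochain_vanishes:
  assumes \<phi>: "\<phi> \<in> cochains Q L n" and L: "finite L" and T: "reduced_tree L T" "card T = n"
    and basis: "\<And>t. (\<And>A. A \<in> T \<Longrightarrow> t A \<in> multilinear_words (inputs T A)) \<Longrightarrow>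
      \<phi> T (\<lambda>A\<in>T. cl (inputs T A) (word (t A))) = 0"
    and p: "p \<in> decorations Q T"
  shows "\<phi> T p = 0"
proof -
  have "T \<subseteq> Pow L" using T(1) by (auto simp: reduced_tree_def)
  then have finT: "finite T" using L finite_subset by blast
  have "\<phi> T q = 0" if "finite U" "U \<subseteq> T" "q \<in> decorations Q T"
    "\<And>A. A \<in> T - U \<Longrightarrow> \<exists>t\<in>multilinear_words (inputs T A). q A = cl (inputs T A) (word t)" for U q
    using that
  proof (induction U arbitrary: q rule: finite_induct)
    case empty
    then have "\<forall>A\<in>T. \<exists>t. t \<in> multilinear_words (inputs T A) \<and> q A = cl (inputs T A) (word t)" by auto
    then obtain t where t: "\<And>A. A \<in> T \<Longrightarrow> t A \<in> multilinear_words (inputs T A) \<and> q A = cl (inputs T A) (word (t A))"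
      by metis
    then have "q = (\<lambda>A\<in>T. cl (inputs T A) (word (t A)))"
      using empty.prems(2) by (auto simp: decorations_def PiE_def extensional_def fun_eq_iff)
    moreover have "\<phi> T (\<lambda>A\<in>T. cl (inputs T A) (word (t A))) = 0" using t by (intro basis) simp
    ultimately show ?case by (simp only:)
  next
    case (insert A U)
    let ?I = "inputs T A"
    have A: "A \<in> T" using insert.prems by simp
    have I: "finite ?I" using inputs_finite_nonempty[OF L T(1) A] by simp
    have form: "additive_form ?I (\<lambda>X. \<phi> T (q(A := X)))"
      using form_of_cochain[OF \<phi> T A insert.prems(2)] .
    have "q A \<in> op_space Q ?I" using insert.prems(2) A by (auto simp: decorations_def)
    then obtain f where f: "q A = cl ?I f" "f \<in> op_space magmatic_operad ?I" by (auto simp: q_space)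
    have zero: "\<phi> T (q(A := cl ?I (word t))) = 0" if t: "t \<in> multilinear_words ?I" for t
    proof (rule insert.IH)
      show "U \<subseteq> T" using insert.prems by simp
      show "q(A := cl ?I (word t)) \<in> decorations Q T"
        using insert.prems(2) A word_space[OF t] by (intro decorations_update) (auto simp: q_space)
      show "\<exists>s\<in>multilinear_words (inputs T B). (q(A := cl ?I (word t))) B = cl (inputs T B) (word s)"
        if "B \<in> T - U" for B
        using that t insert.prems(3)[of B] by auto
    qed
    have "\<phi> T (q(A := cl ?I f)) = (\<Sum>t\<in>multilinear_words ?I. f t * \<phi> T (q(A := cl ?I (word t))))"
      by (rule form_expand[OF form I f(2)])
    also have "\<dots> = 0" using zero by (intro sum.neutral) simp
    finally show ?case using f(1) by (metis fun_upd_triv)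
  qed
  from this[OF finT order_refl p] show ?thesis by simp
qed

lemma cochain_vanishes_if_marked:
  assumes \<phi>: "\<phi> \<in> cochains Q L n" and L: "finite L"
    and marked: "\<And>l r. \<lbrakk>multilinear (Node True l r); leaf_set (Node True l r) = L; card (verts (Node True l r)) = n\<rbrakk>
      \<Longrightarrow> val \<phi> (Node True l r) = 0"
  shows "cochain_eq Q L n \<phi> (\<lambda>T p. 0)"
  unfolding cochain_eq_def
proof (intro allI impI ballI, elim conjE)
  fix T p assume T: "reduced_tree L T" "card T = n" and p: "p \<in> decorations Q T"
  show "\<phi> T p = 0"
  proof (rule cochain_vanishes[OF \<phi> L T _ p])
    fix t assume t: "\<And>A. A \<in> T \<Longrightarrow> t A \<in> multilinear_words (inputs T A)"
    then obtain l r where m: "multilinear (Node True l r)" "leaf_set (Node True l r) = L" "verts (Node True l r) = T"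
      "\<forall>A\<in>T. label (Node True l r) A = t A" using marked_of_tree[OF L T(1)] by blast
    have "decor (Node True l r) = (\<lambda>A\<in>T. cl (inputs T A) (word (t A)))"
      unfolding decor_def m(3) using m(4) by (intro restrict_ext) simp
    then show "\<phi> T (\<lambda>A\<in>T. cl (inputs T A) (word (t A))) = 0"
      using marked[OF m(1,2)] m(3) T(2) by (simp add: val_def)
  qed
qed

text \<open>
  Contracting an edge is linear in each of the two decorations it composes and does not touch the others.
\<close>

lemma differential_cochain:
  assumes \<phi>: "\<phi> \<in> cochains Q L n" and L: "finite L"
  shows "differential Q L \<phi> \<in> cochains Q L (n + 1)"
proof (rule cochainI)
  fix T A p assume T: "reduced_tree L T" "card T = n + 1" and A: "A \<in> T" and p: "p \<in> decorations Q T"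
  interpret quot: symmetric_operad Q by (rule symmetric_operad_quotient)
  obtain l r where m: "multilinear (Node True l r)" "leaf_set (Node True l r) = L" "verts (Node True l r) = T"
    by (rule marked_of_reduced_tree[OF L T(1)])
  let ?I = "inputs T A"
  have pA: "p B \<in> op_space Q (inputs T B)" if "B \<in> T" for B using p that by (auto simp: decorations_def)
  have "additive_form ?I (\<lambda>X. \<phi> (T - {C}) (contract Q T C (p(A := X))))" if C: "C \<in> T - {L}" for C
  proof -
    let ?m = "Node True l r"
    let ?B = "parent T C" and ?c = "contract Q T C p"
    have C': "C \<in> verts ?m" "C \<noteq> leaf_set ?m" using C m by auto
    have B: "?B \<in> T" "?B \<noteq> C"
    proof -
      have "finite {B \<in> T. C \<subset> B}" using m(3) finite_verts[of ?m] by simp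
      moreover have "L \<in> {B \<in> T. C \<subset> B}" using T(1) C by (auto simp: reduced_tree_def)
      ultimately obtain M where M: "M \<in> {B \<in> T. C \<subset> B}" "\<forall>D\<in>{B \<in> T. C \<subset> B}. D \<subseteq> M \<longrightarrow> M = D"
        using finite_has_minimal[of "{B \<in> T. C \<subset> B}"] by blast
      then have "\<not> (\<exists>D\<in>T. C \<subset> D \<and> D \<subset> M)" by blast
      then have "M = ?B" using parent_iff[OF T(1) L, of C M] C M(1) by simp
      then show "?B \<in> T" "?B \<noteq> C" using M(1) by auto
    qed
    note cl = contract_labels[OF refl m(1) C' refl, unfolded m(3), OF B(1)]
    note other = inputs_unmark_other[OF refl m(1) C', unfolded m(3)]
    have T': "reduced_tree L (T - {C})" "card (T - {C}) = n"
    proof -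
      show "reduced_tree L (T - {C})" using T(1) C by (auto simp: reduced_tree_def)
      show "card (T - {C}) = n" using T(2) C m(3) finite_verts[of ?m] by simp
    qed
    have cdec: "?c \<in> decorations Q (T - {C})"
      unfolding decorations_def contract_def
    proof (rule restrict_PiE_iff[THEN iffD2], intro ballI)
      fix B assume B': "B \<in> T - {C}"
      show "(if B = parent T C then op_comp Q (inputs T B) (Min C) (inputs T C) (p B) (p C) else p B)
          \<in> op_space Q (inputs (T - {C}) B)"
      proof (cases "B = parent T C")
        case True
        then show ?thesis using cl(1,2) quot.comp_linear_left[OF cl(1) pA] pA C B'
          by (auto simp: op_linear_def)
      next
        case False
        then show ?thesis using other(2)[OF False] B' pA by simp
      qed
    qed
    have B': "?B \<in> T - {C}" and Ct: "C \<in> T" using B C by auto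
    consider "A = C" | "A = ?B" "A \<noteq> C" | "A \<noteq> ?B" "A \<noteq> C" by blast
    then show ?thesis
    proof cases
      case 1
      have eq: "contract Q T C (p(A := X)) = ?c(?B := op_comp Q (inputs T ?B) (Min C) (inputs T C) (p ?B) X)" for X
        using 1 B by (auto simp: contract_def fun_eq_iff)
      show ?thesis unfolding eq
        using form_comp[OF form_of_cochain[OF \<phi> T' B' cdec]] quot.comp_linear_right[OF cl(1) pA[OF B(1)]] cl(2) 1 by simp
    next
      case 2
      have eq: "contract Q T C (p(A := X)) = ?c(?B := op_comp Q (inputs T ?B) (Min C) (inputs T C) X (p C))" for X
        using 2 B by (auto simp: contract_def fun_eq_iff)
      show ?thesis unfolding eq
        using form_comp[OF form_of_cochain[OF \<phi> T' B' cdec]] quot.comp_linear_left[OF cl(1) pA[OF Ct]] cl(2) 2 by simp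
    next
      case 3
      have eq: "contract Q T C (p(A := X)) = ?c(A := X)" for X
        using 3 A B by (auto simp: contract_def fun_eq_iff)
      show ?thesis unfolding eq
        using form_of_cochain[OF \<phi> T', of A] cdec 3 A other(2)[of A] by simp
    qed
  qed
  then show "additive_form ?I (\<lambda>X. differential Q L \<phi> T (p(A := X)))"
    unfolding differential_def by (intro form_sum)
qed

end

section \<open>Relations in the quotient of the magmatic operad\<close>

definition combination :: "(complex \<times> magma) list \<Rightarrow> magma \<Rightarrow> complex" where
  "combination rs = (\<lambda>t. \<Sum>(c, s)\<leftarrow>rs. c * word s t)"

lemma combination_space: "\<forall>x\<in>set rs. snd x \<in> multilinear_words I \<Longrightarrow> combination rs \<in> op_space magmatic_operad I"
  unfolding combination_def mag_sel
proof (intro CollectI allI impI)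
  fix t assume "\<forall>x\<in>set rs. snd x \<in> multilinear_words I" "t \<notin> multilinear_words I"
  then show "(\<Sum>(c, s)\<leftarrow>rs. c * word s t) = 0"
    by (induction rs) (auto simp: word_def)
qed

text \<open>
  A linear map that sends words to words acts on a combination term by term. It covers relabelling and both
  sides of composition at once.
\<close>

lemma linear_combination:
  assumes f: "op_linear magmatic_operad I J f" and I: "finite I" and J: "finite J"
    and word: "\<And>s. s \<in> multilinear_words I \<Longrightarrow> f (word s) = word (h s)"
    and rs: "\<forall>x\<in>set rs. snd x \<in> multilinear_words I"
  shows "f (combination rs) = combination (map (apsnd h) rs)"
proof -
  interpret symmetric_operad magmatic_operad by (rule symmetric_operad_magmatic)
  note lin = f[unfolded op_linear_def]
  show ?thesis using rs
  proof (induction rs)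
    case Nil
    have z: "combination [] = op_scale magmatic_operad I 0 (op_zero magmatic_operad I)"
      by (simp add: combination_def mag_sel)
    have "f (combination []) = op_scale magmatic_operad J 0 (f (op_zero magmatic_operad I))"
      unfolding z using lin zero_closed[OF I] by blast
    then show ?case by (simp add: combination_def mag_sel)
  next
    case (Cons x rs)
    obtain c s where x: "x = (c, s)" by fastforce
    have eq: "combination ((c, s) # rs) = op_add magmatic_operad I (op_scale magmatic_operad I c (word s)) (combination rs)" for c s rs I
      by (simp add: combination_def mag_sel)
    have s: "word s \<in> op_space magmatic_operad I" using Cons.prems x by (auto intro: word_space)
    have r: "combination rs \<in> op_space magmatic_operad I" using Cons.prems by (intro combination_space) simp
    have "f (combination (x # rs)) = op_add magmatic_operad J (f (op_scale magmatic_operad I c (word s))) (f (combination rs))"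
      unfolding x eq[of c s rs I] using lin r scale_closed[OF I s] by blast
    also have "f (op_scale magmatic_operad I c (word s)) = op_scale magmatic_operad J c (f (word s))"
      using lin s by blast
    finally show ?case
      using Cons word[of s] x eq[of c "h s" "map (apsnd h) rs" J] by simp
  qed
qed

primrec instantiate :: "magma \<Rightarrow> magma \<Rightarrow> magma \<Rightarrow> magma \<Rightarrow> magma" where
  "instantiate x y z (Var i) = (if i = 0 then x else if i = 1 then y else z)"
| "instantiate x y z (s \<cdot> t) = instantiate x y z s \<cdot> instantiate x y z t"

lemma leaves_nonempty [simp]: "leaves t \<noteq> []"
  by (induction t) auto

lemma multilinear_words_index: "t \<in> multilinear_words I \<Longrightarrow> finite I \<and> I \<noteq> {}"
  by (auto simp: multilinear_words_def)

context magmatic_ideal begin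

definition relation :: "nat set \<Rightarrow> (complex \<times> magma) list \<Rightarrow> bool" where
  "relation I rs \<longleftrightarrow> finite I \<and> (\<forall>x\<in>set rs. snd x \<in> multilinear_words I) \<and> (I, combination rs) \<in> K"

lemma relation_rename:
  assumes r: "relation I rs" and \<sigma>: "inj_on \<sigma> I"
  shows "relation (\<sigma> ` I) (map (apsnd (rename \<sigma>)) rs)"
proof -
  have *: "finite I" "\<forall>x\<in>set rs. snd x \<in> multilinear_words I" "(I, combination rs) \<in> K" using r by (auto simp: relation_def)
  have "op_relabel magmatic_operad \<sigma> I (combination rs) = combination (map (apsnd (rename \<sigma>)) rs)"
    using * \<sigma> by (intro linear_combination[OF relabel_linear]) (auto simp: relabel_word)
  then show ?thesis
    using * \<sigma> ideal_relabel[OF *(3) \<sigma>] by (auto simp: relation_def rename_words)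
qed

lemma relation_subst:
  assumes r: "relation I rs" and c: "composable I i J" and u: "u \<in> multilinear_words J"
  shows "relation (graft I i J) (map (apsnd (subst i u)) rs)"
proof -
  note fin = finite_composable[OF c]
  have *: "\<forall>x\<in>set rs. snd x \<in> multilinear_words I" "(I, combination rs) \<in> K" using r by (auto simp: relation_def)
  have "op_comp magmatic_operad I i J (combination rs) (word u) = combination (map (apsnd (subst i u)) rs)"
    using fin * u by (intro linear_combination[OF comp_linear_left[OF c]]) (auto simp: comp_word word_space)
  then show ?thesis
    using fin * u ideal_comp_left[OF *(2) c word_space[OF u]] by (auto simp: relation_def subst_words[OF c])
qed

text \<open>
  This puts relations into contexts, because a context with one hole is a word with a variable at the hole.
\<close>

lemma relation_subst_into:
  assumes s: "s \<in> multilinear_words I" and c: "composable I i J" and r: "relation J rs"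
  shows "relation (graft I i J) (map (apsnd (\<lambda>u. subst i u s)) rs)"
proof -
  note fin = finite_composable[OF c]
  have *: "\<forall>x\<in>set rs. snd x \<in> multilinear_words J" "(J, combination rs) \<in> K" using r by (auto simp: relation_def)
  have "op_comp magmatic_operad I i J (word s) (combination rs) = combination (map (apsnd (\<lambda>u. subst i u s)) rs)"
    using fin * s by (intro linear_combination[OF comp_linear_right[OF c]]) (auto simp: comp_word word_space)
  then show ?thesis
    using fin * s ideal_comp_right[OF word_space[OF s] c *(2)] by (auto simp: relation_def subst_words[OF c])
qed

lemma relation_Mul_left:
  assumes r: "relation I rs" and rs: "rs \<noteq> []" and u: "u \<in> multilinear_words J" and d: "I \<inter> J = {}"
  shows "relation (I \<union> J) (map (apsnd (\<lambda>s. s \<cdot> u)) rs)"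
proof -
  have I: "finite I" "I \<noteq> {}"
    using r rs multilinear_words_index[of "snd (hd rs)" I] by (auto simp: relation_def)
  have J: "finite J" using multilinear_words_index[OF u] by simp
  obtain a where a: "a \<in> I" "a \<notin> J" using I d by blast
  have w: "Var a \<cdot> u \<in> multilinear_words (insert a J)" using u a by (auto simp: multilinear_words_def)
  have c: "composable (insert a J) a I" using I J a d by (auto simp: composable_def)
  have g: "graft (insert a J) a I = I \<union> J" using a by (auto simp: graft_def)
  have "subst a v u = u" for v using u a by (intro subst_fresh) (simp add: multilinear_words_def)
  then show ?thesis using relation_subst_into[OF w c r] by (simp add: g)
qed

lemma relation_Mul_right:
  assumes r: "relation I rs" and rs: "rs \<noteq> []" and u: "u \<in> multilinear_words J" and d: "I \<inter> J = {}"
  shows "relation (J \<union> I) (map (apsnd (\<lambda>s. u \<cdot> s)) rs)"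
proof -
  have I: "finite I" "I \<noteq> {}"
    using r rs multilinear_words_index[of "snd (hd rs)" I] by (auto simp: relation_def)
  have J: "finite J" using multilinear_words_index[OF u] by simp
  obtain a where a: "a \<in> I" "a \<notin> J" using I d by blast
  have w: "u \<cdot> Var a \<in> multilinear_words (insert a J)" using u a by (auto simp: multilinear_words_def)
  have c: "composable (insert a J) a I" using I J a d by (auto simp: composable_def)
  have g: "graft (insert a J) a I = J \<union> I" using a by (auto simp: graft_def)
  have "subst a v u = u" for v using u a by (intro subst_fresh) (simp add: multilinear_words_def)
  then show ?thesis using relation_subst_into[OF w c r] by (simp add: g)
qed

text \<open>
  The three variables are first renamed to elements of the three index sets; then the words can be inserted
  one by one without a clash of variables.
\<close>

lemma relation_inst:
  assumes r: "relation {0, 1, 2} rs"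
    and x: "x \<in> multilinear_words X" and y: "y \<in> multilinear_words Y" and z: "z \<in> multilinear_words Z"
    and d: "X \<inter> Y = {}" "X \<inter> Z = {}" "Y \<inter> Z = {}"
  shows "relation (X \<union> Y \<union> Z) (map (apsnd (instantiate x y z)) rs)"
proof -
  have words: "\<forall>t\<in>set rs. snd t \<in> multilinear_words {0, 1, 2}" using r by (simp add: relation_def)
  have fin: "finite X" "finite Y" "finite Z" using multilinear_words_index x y z by auto
  define a b c where "a = Min X" and "b = Min Y" and "c = Min Z"
  have abc: "a \<in> X" "b \<in> Y" "c \<in> Z"
    using multilinear_words_index[OF x] multilinear_words_index[OF y] multilinear_words_index[OF z] by (auto simp: a_def b_def c_def)
  then have ne: "a \<noteq> b" "a \<noteq> c" "b \<noteq> c" using d by auto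
  define \<sigma> where "\<sigma> i = (if i = 0 then a else if i = 1 then b else c)" for i :: nat
  have "\<sigma> ` {0, 1, 2} = {a, b, c}" by (auto simp: \<sigma>_def)
  moreover have "inj_on \<sigma> {0, 1, 2}" using ne by (auto simp: inj_on_def \<sigma>_def)
  ultimately have r0: "relation {a, b, c} (map (apsnd (rename \<sigma>)) rs)" using relation_rename[OF r] by metis
  have r1: "relation (X \<union> {b, c}) (map (apsnd (subst a x)) (map (apsnd (rename \<sigma>)) rs))"
  proof -
    have "composable {a, b, c} a X" using fin ne abc d by (auto simp: composable_def)
    moreover have "graft {a, b, c} a X = X \<union> {b, c}" using ne by (auto simp: graft_def)
    ultimately show ?thesis using relation_subst[OF r0 _ x] by metis
  qed
  have r2: "relation (X \<union> Y \<union> {c}) (map (apsnd (subst b y)) (map (apsnd (subst a x)) (map (apsnd (rename \<sigma>)) rs)))"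
  proof -
    have "composable (X \<union> {b, c}) b Y" using fin ne abc d by (auto simp: composable_def)
    moreover have "graft (X \<union> {b, c}) b Y = X \<union> Y \<union> {c}" using ne abc d by (auto simp: graft_def)
    ultimately show ?thesis using relation_subst[OF r1 _ y] by metis
  qed
  have r3: "relation (X \<union> Y \<union> Z) (map (apsnd (subst c z)) (map (apsnd (subst b y)) (map (apsnd (subst a x)) (map (apsnd (rename \<sigma>)) rs))))"
  proof -
    have "composable (X \<union> Y \<union> {c}) c Z" using fin ne abc d by (auto simp: composable_def)
    moreover have "graft (X \<union> Y \<union> {c}) c Z = X \<union> Y \<union> Z" using ne abc d by (auto simp: graft_def)
    ultimately show ?thesis using relation_subst[OF r2 _ z] by metis
  qed
  have "b \<notin> set (leaves x)" "c \<notin> set (leaves x)" "c \<notin> set (leaves y)"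
    using x y abc d by (auto simp: multilinear_words_def)
  then have instantiate: "subst c z (subst b y (subst a x (rename \<sigma> s))) = instantiate x y z s" for s
    using ne by (induction s) (auto simp: \<sigma>_def subst_fresh)
  have "apsnd (subst c z) (apsnd (subst b y) (apsnd (subst a x) (apsnd (rename \<sigma>) t))) = apsnd (instantiate x y z) t"
    for t :: "complex \<times> magma"
    by (cases t) (simp add: instantiate)
  then show ?thesis using r3 by (simp only: map_map comp_def)
qed

lemma relation_form:
  assumes r: "relation I rs" and g: "additive_form I g"
  shows "(\<Sum>(c, s)\<leftarrow>rs. c * g (cl I (word s))) = 0"
proof -
  have *: "finite I" "\<forall>x\<in>set rs. snd x \<in> multilinear_words I" "(I, combination rs) \<in> K" using r by (auto simp: relation_def)
  have sp: "combination rs \<in> op_space magmatic_operad I" using *(2) by (rule combination_space)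
  have "cl I (combination rs) = cl I (op_zero magmatic_operad I)"
    using coset_absorb[OF *(1) zero_closed[OF *(1)] *(3)] add_zero[OF *(1) sp] by simp
  moreover have "g (cl I (op_zero magmatic_operad I)) = 0"
    using form_expand[OF g *(1) zero_closed[OF *(1)]] by (simp add: mag_sel)
  ultimately have "0 = (\<Sum>t\<in>multilinear_words I. combination rs t * g (cl I (word t)))"
    using form_expand[OF g *(1) sp] by simp
  also have "\<dots> = (\<Sum>(c, s)\<leftarrow>rs. c * g (cl I (word s)))"
    using *(2)
  proof (induction rs)
    case (Cons x rs)
    obtain c s where x: "x = (c, s)" by fastforce
    have "(\<Sum>t\<in>multilinear_words I. (c * word s t) * g (cl I (word t)))
      = (\<Sum>t\<in>multilinear_words I. if t = s then c * g (cl I (word s)) else 0)"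
      by (intro sum.cong) (auto simp: word_def)
    also have "\<dots> = c * g (cl I (word s))" using Cons.prems x *(1) by (simp add: finite_multilinear_words)
    finally show ?case using Cons x by (simp add: combination_def algebra_simps sum.distrib)
  qed (simp add: combination_def)
  finally show ?thesis by simp
qed

end

definition novikov_ideal :: "complex \<Rightarrow> (nat set \<times> (magma \<Rightarrow> complex)) set" where
  "novikov_ideal \<delta> = generated_ideal magmatic_operad
    {({0, 1, 2}, delta_left_symmetry \<delta>), ({0, 1, 2}, right_commutativity)}"

lemma operad_ideal_novikov: "operad_ideal magmatic_operad (novikov_ideal \<delta>)"
proof -
  have W: "s \<in> multilinear_words {0, 1, 2}"
    if "leaves s \<in> {[0, 1, 2], [1, 0, 2], [0, 2, 1]}" for s
    using that by (auto simp: multilinear_words_def)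
  have word: "word s t = 0" if "t \<notin> multilinear_words {0, 1, 2}"
    "leaves s \<in> {[0, 1, 2], [1, 0, 2], [0, 2, 1]}" for s t
    using that W[of s] by (auto simp: word_def)
  have "delta_left_symmetry \<delta> t = 0" "right_commutativity t = 0"
    if "t \<notin> multilinear_words {0, 1, 2}" for t
    by (simp_all only: delta_left_symmetry_def right_commutativity_def Let_def
      word[OF that] leaves.simps append.simps insert_iff simp_thms) simp_all
  then show ?thesis
    unfolding novikov_ideal_def
    by (intro operad_ideal_generated symmetric_operad_magmatic) (auto simp: mag_sel)
qed

locale novikov = magmatic_ideal "novikov_ideal \<delta>" for \<delta> :: complex
begin

lemma relation_right_commutative:
  assumes "x \<in> multilinear_words X" "y \<in> multilinear_words Y" "z \<in> multilinear_words Z"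
    "X \<inter> Y = {}" "X \<inter> Z = {}" "Y \<inter> Z = {}"
  shows "relation (X \<union> Y \<union> Z) [(- 1, x \<cdot> y \<cdot> z), (1, x \<cdot> z \<cdot> y)]"
proof -
  have "({0, 1, 2}, op_scale magmatic_operad {0, 1, 2} (- 1) right_commutativity) \<in> novikov_ideal \<delta>"
    unfolding novikov_ideal_def by (intro generated_ideal.scale generated_ideal.gen) simp
  moreover have "op_scale magmatic_operad {0, 1, 2} (- 1) right_commutativity
      = combination [(- 1, Var 0 \<cdot> Var 1 \<cdot> Var 2), (1, Var 0 \<cdot> Var 2 \<cdot> Var 1)]"
    by (simp add: combination_def right_commutativity_def Let_def mag_sel fun_eq_iff)
  ultimately have "relation {0, 1, 2} [(- 1, Var 0 \<cdot> Var 1 \<cdot> Var 2), (1, Var 0 \<cdot> Var 2 \<cdot> Var 1)]"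
    unfolding relation_def by (intro conjI) (auto simp: multilinear_words_def)
  from relation_inst[OF this assms] show ?thesis by simp
qed

lemma relation_left_symmetric:
  assumes "x \<in> multilinear_words X" "y \<in> multilinear_words Y" "z \<in> multilinear_words Z"
    "X \<inter> Y = {}" "X \<inter> Z = {}" "Y \<inter> Z = {}"
  shows "relation (X \<union> Y \<union> Z)
    [(- 1, x \<cdot> (y \<cdot> z)), (1, y \<cdot> (x \<cdot> z)), (\<delta>, x \<cdot> y \<cdot> z), (- \<delta>, y \<cdot> x \<cdot> z)]"
proof -
  have "({0, 1, 2}, delta_left_symmetry \<delta>) \<in> novikov_ideal \<delta>"
    unfolding novikov_ideal_def by (intro generated_ideal.gen) simp
  moreover have "delta_left_symmetry \<delta>
      = combination [(- 1, Var 0 \<cdot> (Var 1 \<cdot> Var 2)), (1, Var 1 \<cdot> (Var 0 \<cdot> Var 2)),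
          (\<delta>, Var 0 \<cdot> Var 1 \<cdot> Var 2), (- \<delta>, Var 1 \<cdot> Var 0 \<cdot> Var 2)]"
    by (simp add: combination_def delta_left_symmetry_def Let_def mag_sel algebra_simps fun_eq_iff)
  ultimately have "relation {0, 1, 2} [(- 1, Var 0 \<cdot> (Var 1 \<cdot> Var 2)), (1, Var 1 \<cdot> (Var 0 \<cdot> Var 2)),
          (\<delta>, Var 0 \<cdot> Var 1 \<cdot> Var 2), (- \<delta>, Var 1 \<cdot> Var 0 \<cdot> Var 2)]"
    unfolding relation_def by (intro conjI) (auto simp: multilinear_words_def)
  from relation_inst[OF this assms] show ?thesis by simp
qed

end

section \<open>The defining identities on marked words\<close>

lemma words_cut: "multilinear m \<Longrightarrow> cut m \<in> multilinear_words (set (leaves (cut m)))"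
  by (simp add: multilinear_words_def distinct_cut)

lemma disjoint_cuts: "leaf_set m \<inter> leaf_set m' = {} \<Longrightarrow> set (leaves (cut m)) \<inter> set (leaves (cut m')) = {}"
  using leaves_cut_subset[of m] leaves_cut_subset[of m'] by blast

text \<open>
  The two identities as rewrite rules on marked words. The inner one of the two nodes involved is
  unmarked, so that both belong to one vertex; the outer one keeps its mark. The arguments of the
  identities are arbitrary marked words.
\<close>

inductive expands :: "complex \<Rightarrow> marked \<Rightarrow> (complex \<times> marked) list \<Rightarrow> bool" for \<delta> where
  right_commute: "expands \<delta> (Node b (Node False x y) z) [(1, Node b (Node False x z) y)]"
| left_symmetric: "expands \<delta> (Node b x (Node False y z))
    [(1, Node b y (Node False x z)), (\<delta>, Node b (Node False x y) z), (- \<delta>, Node b (Node False y x) z)]"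
| left: "expands \<delta> m es \<Longrightarrow> expands \<delta> (Node b m r) (map (apsnd (\<lambda>m. Node b m r)) es)"
| right: "expands \<delta> m es \<Longrightarrow> expands \<delta> (Node b l m) (map (apsnd (\<lambda>m. Node b l m)) es)"

lemma expands_shape:
  "\<lbrakk>expands \<delta> m es; multilinear m; x \<in> set es\<rbrakk> \<Longrightarrow>
    multilinear (snd x) \<and> leaf_set (snd x) = leaf_set m \<and> verts (snd x) = verts m"
proof (induction arbitrary: x rule: expands.induct)
  case (left m es b r)
  then show ?case by fastforce
next
  case (right m es b l)
  then show ?case by fastforce
qed auto

lemma expands_sum: "expands \<delta> m es \<Longrightarrow> (\<Sum>(c, x)\<leftarrow>es. c) = 1"
  by (induction rule: expands.induct) (simp_all add: comp_def case_prod_beta')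

context novikov begin

definition same_labels :: "nat set set \<Rightarrow> marked \<Rightarrow> (complex \<times> marked) list \<Rightarrow> bool" where
  "same_labels V m es \<longleftrightarrow> (\<forall>x\<in>set es. \<forall>B\<in>V. label (snd x) B = label m B)"

lemma same_labels_Un: "\<lbrakk>same_labels U m es; same_labels W m es; V \<subseteq> U \<union> W\<rbrakk> \<Longrightarrow> same_labels V m es"
  unfolding same_labels_def by blast

text \<open>
  An expansion changes one word only: the word of a vertex or, as long as no marked node encloses the place
  of the change, the word that \<^const>\<open>cut\<close> leaves at the root.
\<close>

definition expansion_relation :: "marked \<Rightarrow> (complex \<times> marked) list \<Rightarrow> bool" where
  "expansion_relation m es \<longleftrightarrow>
    (\<exists>I. relation I (map (apsnd cut) ((- 1, m) # es))) \<and> same_labels (verts m) m es \<or>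
    (\<exists>A\<in>verts m. (\<exists>I. relation I (map (apsnd (\<lambda>x. label x A)) ((- 1, m) # es)))
       \<and> same_labels (verts m - {A}) m es \<and> (\<forall>x\<in>set es. cut (snd x) = cut m))"

text \<open>
  One step down the tree. The map \<open>N\<close> attaches a sibling to a marked word, and \<open>w\<close> is the
  effect of this on the word left at the root. If the new root is marked, the relation moves from the
  root word into the word of the vertex \<open>A\<close>.
\<close>

lemma expansion_relation_context:
  assumes m: "expansion_relation m es"
    and verts: "verts (N m) = (if b then {A} else {}) \<union> verts m \<union> V"
    and inner: "\<And>x B. \<lbrakk>x \<in> insert m (snd ` set es); B \<in> verts m\<rbrakk> \<Longrightarrow> label (N x) B = label x B"
    and outer: "\<And>x B. \<lbrakk>x \<in> insert m (snd ` set es); B \<in> V\<rbrakk> \<Longrightarrow> label (N x) B = label (N m) B"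
    and top: "\<And>x. x \<in> insert m (snd ` set es) \<Longrightarrow> label (N x) A = w (cut x)"
    and cut: "\<And>x. x \<in> insert m (snd ` set es) \<Longrightarrow> cut (N x) = (if b then c else w (cut x))"
    and rel: "\<And>I. relation I (map (apsnd cut) ((- 1, m) # es)) \<Longrightarrow>
      \<exists>J. relation J (map (apsnd w) (map (apsnd cut) ((- 1, m) # es)))"
  shows "expansion_relation (N m) (map (apsnd N) es)"
proof -
  let ?es = "map (apsnd N) es"
  have off: "same_labels V (N m) ?es"
    unfolding same_labels_def
  proof (intro ballI)
    fix y B assume "y \<in> set ?es" "B \<in> V"
    then obtain x where "x \<in> set es" "snd y = N (snd x)" by auto
    then show "label (snd y) B = label (N m) B" using outer[of "snd x" B] \<open>B \<in> V\<close> by simp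
  qed
  have off_inner: "same_labels U (N m) ?es" if "same_labels U m es" "U \<subseteq> verts m" for U
    unfolding same_labels_def
  proof (intro ballI)
    fix y B assume "y \<in> set ?es" and B: "B \<in> U"
    then obtain x where x: "x \<in> set es" "snd y = N (snd x)" by auto
    have "label (snd x) B = label m B" using that(1) x(1) B by (simp add: same_labels_def)
    then show "label (snd y) B = label (N m) B"
      using inner[of "snd x" B] inner[of m B] x B that(2) by auto
  qed
  have map_eq: "map (apsnd f) ((- 1, N m) # ?es) = map (apsnd g) ((- 1, m) # es)"
    if "\<And>x. x \<in> insert m (snd ` set es) \<Longrightarrow> f (N x) = g x" for f g :: "marked \<Rightarrow> magma"
  proof -
    have "apsnd f (apsnd N x) = apsnd g x" if "x \<in> set es" for x
      using \<open>\<And>x. x \<in> insert m (snd ` set es) \<Longrightarrow> f (N x) = g x\<close>[of "snd x"] that by (cases x) force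
    then show ?thesis using that[of m] by simp
  qed
  from m consider I where "relation I (map (apsnd cut) ((- 1, m) # es))" "same_labels (verts m) m es"
    | B I where "B \<in> verts m" "relation I (map (apsnd (\<lambda>x. label x B)) ((- 1, m) # es))"
        "same_labels (verts m - {B}) m es" "\<forall>x\<in>set es. cut (snd x) = cut m"
    unfolding expansion_relation_def by blast
  then show ?thesis
  proof cases
    case 1
    have s: "same_labels (verts m) (N m) ?es" using off_inner 1(2) by blast
    have "map (apsnd w) (map (apsnd cut) xs) = map (apsnd (\<lambda>x. w (cut x))) xs" for xs :: "(complex \<times> marked) list"
      by auto
    then obtain J where R: "relation J (map (apsnd (\<lambda>x. w (cut x))) ((- 1, m) # es))"
      using rel[OF 1(1)] by metis
    show ?thesis
    proof (cases b)
      case False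
      have "relation J (map (apsnd cut) ((- 1, N m) # ?es))"
        using R map_eq[of cut "\<lambda>x. w (cut x)"] cut False by metis
      moreover have "same_labels (verts (N m)) (N m) ?es"
        by (rule same_labels_Un[OF s off]) (simp add: verts False)
      ultimately show ?thesis unfolding expansion_relation_def by blast
    next
      case True
      have "relation J (map (apsnd (\<lambda>x. label x A)) ((- 1, N m) # ?es))"
        using R map_eq[of "\<lambda>x. label x A" "\<lambda>x. w (cut x)"] top by metis
      moreover have "same_labels (verts (N m) - {A}) (N m) ?es"
        by (rule same_labels_Un[OF s off]) (auto simp: verts)
      moreover have "\<forall>x\<in>set ?es. cut (snd x) = cut (N m)"
      proof
        fix y assume "y \<in> set ?es"
        then obtain x where "x \<in> set es" "snd y = N (snd x)" by auto
        then show "cut (snd y) = cut (N m)" using cut[of m] cut[of "snd x"] True by simp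
      qed
      moreover have "A \<in> verts (N m)" using verts True by simp
      ultimately show ?thesis unfolding expansion_relation_def by blast
    qed
  next
    case 2
    have "relation I (map (apsnd (\<lambda>x. label x B)) ((- 1, N m) # ?es))"
      using 2(2) map_eq[of "\<lambda>x. label x B" "\<lambda>x. label x B"] inner 2(1) by metis
    moreover have "same_labels (verts (N m) - {B}) (N m) ?es"
    proof (rule same_labels_Un)
      show "same_labels (verts m - {B}) (N m) ?es" using off_inner 2(3) by blast
      have "same_labels {A} (N m) ?es"
        unfolding same_labels_def
      proof (intro ballI)
        fix y B assume "y \<in> set ?es" "B \<in> {A}"
        then obtain x where "x \<in> set es" "snd y = N (snd x)" by auto
        then show "label (snd y) B = label (N m) B" using top[of "snd x"] top[of m] 2(4) \<open>B \<in> {A}\<close> by simp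
      qed
      then show "same_labels (insert A V) (N m) ?es" by (rule same_labels_Un[OF _ off]) simp
      show "verts (N m) - {B} \<subseteq> verts m - {B} \<union> insert A V" using verts by (auto split: if_splits)
    qed
    moreover have "\<forall>x\<in>set ?es. cut (snd x) = cut (N m)"
    proof
      fix y assume "y \<in> set ?es"
      then obtain x where "x \<in> set es" "snd y = N (snd x)" by auto
      then show "cut (snd y) = cut (N m)" using cut[of m] cut[of "snd x"] 2(4) by simp
    qed
    moreover have "B \<in> verts (N m)" using verts 2(1) by simp
    ultimately show ?thesis unfolding expansion_relation_def by blast
  qed
qed

lemma expands_relation: "\<lbrakk>expands \<delta> m es; multilinear m\<rbrakk> \<Longrightarrow> expansion_relation m es"
proof (induction rule: expands.induct)
  case (right_commute b x y z)
  let ?m = "Node b (Node False x y) z" and ?m' = "Node b (Node False x z) y"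
  have m: "multilinear ?m" "multilinear ?m'" using right_commute by auto
  have i: "multilinear (Node False x y)" "multilinear (Node False x z)" using right_commute by auto
  have r: "\<exists>I. relation I [(- 1, cut x \<cdot> cut y \<cdot> cut z), (1, cut x \<cdot> cut z \<cdot> cut y)]"
  proof -
    have d: "leaf_set x \<inter> leaf_set y = {}" "leaf_set x \<inter> leaf_set z = {}" "leaf_set y \<inter> leaf_set z = {}" using m by auto
    have l: "multilinear x" "multilinear y" "multilinear z" using m by simp_all
    show ?thesis
      using relation_right_commutative[OF l[THEN words_cut] d[THEN disjoint_cuts]] by blast
  qed
  have "label ?m B = label ?m' B" if "B \<in> verts x \<union> verts y \<union> verts z" for B
    using that label_left[OF m(1), of B] label_left[OF m(2), of B] label_right[OF m(1), of B] label_right[OF m(2), of B]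
      label_left[OF i(1), of B] label_left[OF i(2), of B] label_right[OF i(1), of B] label_right[OF i(2), of B]
    by (auto simp del: label.simps)
  then have same: "same_labels (verts x \<union> verts y \<union> verts z) ?m [(1, ?m')]" by (simp add: same_labels_def del: label.simps)
  show ?case
  proof (cases b)
    case True
    have S: "leaf_set ?m' = leaf_set ?m" by auto
    have "label ?m (leaf_set ?m) = cut x \<cdot> cut y \<cdot> cut z" "label ?m' (leaf_set ?m) = cut x \<cdot> cut z \<cdot> cut y"
      using S by auto
    then have "\<exists>I. relation I (map (apsnd (\<lambda>x. label x (leaf_set ?m))) [(- 1, ?m), (1, ?m')])"
      using r by (simp del: label.simps leaf_set.simps)
    moreover have "leaf_set ?m \<in> verts ?m" using True by simp
    moreover have "same_labels (verts ?m - {leaf_set ?m}) ?m [(1, ?m')]"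
      by (rule same_labels_Un[OF same same]) (use True in auto)
    moreover have "\<forall>x\<in>set [(1, ?m')]. cut (snd x) = cut ?m"
      using True by (simp add: min.assoc min.commute min.left_commute)
    ultimately show ?thesis
      unfolding expansion_relation_def by (intro disjI2 bexI[of _ "leaf_set ?m"] conjI)
  next
    case False
    then show ?thesis using r same by (simp add: expansion_relation_def)
  qed
next
  case (left_symmetric b x y z)
  let ?m = "Node b x (Node False y z)" and ?m1 = "Node b y (Node False x z)"
    and ?m2 = "Node b (Node False x y) z" and ?m3 = "Node b (Node False y x) z"
  let ?es = "[(1, ?m1), (\<delta>, ?m2), (- \<delta>, ?m3)]"
  have m: "multilinear ?m" "multilinear ?m1" "multilinear ?m2" "multilinear ?m3" using left_symmetric by auto
  have i: "multilinear (Node False y z)" "multilinear (Node False x z)" "multilinear (Node False x y)"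
    "multilinear (Node False y x)" using left_symmetric by auto
  have r: "\<exists>I. relation I [(- 1, cut x \<cdot> (cut y \<cdot> cut z)), (1, cut y \<cdot> (cut x \<cdot> cut z)),
      (\<delta>, cut x \<cdot> cut y \<cdot> cut z), (- \<delta>, cut y \<cdot> cut x \<cdot> cut z)]"
  proof -
    have d: "leaf_set x \<inter> leaf_set y = {}" "leaf_set x \<inter> leaf_set z = {}" "leaf_set y \<inter> leaf_set z = {}" using m by auto
    have l: "multilinear x" "multilinear y" "multilinear z" using m by simp_all
    show ?thesis
      using relation_left_symmetric[OF l[THEN words_cut] d[THEN disjoint_cuts]] by blast
  qed
  have "label ?m1 B = label ?m B \<and> label ?m2 B = label ?m B \<and> label ?m3 B = label ?m B" if "B \<in> verts x \<union> verts y \<union> verts z" for B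
    using that m[THEN label_left, of B] m[THEN label_right, of B] i[THEN label_left, of B] i[THEN label_right, of B]
    by (auto simp del: label.simps)
  then have same: "same_labels (verts x \<union> verts y \<union> verts z) ?m ?es" by (simp add: same_labels_def del: label.simps)
  show ?case
  proof (cases b)
    case True
    have S: "leaf_set ?m1 = leaf_set ?m" "leaf_set ?m2 = leaf_set ?m" "leaf_set ?m3 = leaf_set ?m" by auto
    have "label ?m (leaf_set ?m) = cut x \<cdot> (cut y \<cdot> cut z)" "label ?m1 (leaf_set ?m) = cut y \<cdot> (cut x \<cdot> cut z)"
      "label ?m2 (leaf_set ?m) = cut x \<cdot> cut y \<cdot> cut z" "label ?m3 (leaf_set ?m) = cut y \<cdot> cut x \<cdot> cut z"
      using S by auto
    then have "\<exists>I. relation I (map (apsnd (\<lambda>x. label x (leaf_set ?m))) ((- 1, ?m) # ?es))"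
      using r by (simp del: label.simps leaf_set.simps)
    moreover have "leaf_set ?m \<in> verts ?m" using True by simp
    moreover have "same_labels (verts ?m - {leaf_set ?m}) ?m ?es"
      by (rule same_labels_Un[OF same same]) (use True in auto)
    moreover have "\<forall>x\<in>set ?es. cut (snd x) = cut ?m"
      using True by (simp add: min.assoc min.commute min.left_commute)
    ultimately show ?thesis
      unfolding expansion_relation_def by (intro disjI2 bexI[of _ "leaf_set ?m"] conjI)
  next
    case False
    then show ?thesis using r same by (simp add: expansion_relation_def Un_assoc)
  qed
next
  case (left m es b r)
  let ?N = "\<lambda>m. Node b m r"
  have m: "multilinear (?N m)" by fact
  then have mm: "multilinear m" by simp
  have x: "multilinear (?N x)" "verts x = verts m" "leaf_set x = leaf_set m" if "x \<in> insert m (snd ` set es)" for x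
    using that expands_shape[OF left.hyps mm] m by auto
  show ?case
  proof (rule expansion_relation_context)
    show "expansion_relation m es" using left.IH[OF mm] .
    show "verts (?N m) = (if b then {leaf_set m \<union> leaf_set r} else {}) \<union> verts m \<union> verts r" by auto
    show "label (?N y) B = label y B" if "y \<in> insert m (snd ` set es)" "B \<in> verts m" for y B
      using label_left[OF x(1)[OF that(1)]] x(2)[OF that(1)] that(2) by blast
    show "label (?N y) B = label (?N m) B" if "y \<in> insert m (snd ` set es)" "B \<in> verts r" for y B
      using label_right[OF x(1)[OF that(1)] that(2)] label_right[OF m that(2)] by simp
    show "label (?N y) (leaf_set m \<union> leaf_set r) = cut y \<cdot> cut r" if "y \<in> insert m (snd ` set es)" for y
      using x(3)[OF that] by (simp add: Un_commute)
    show "cut (?N y) = (if b then Var (min (least m) (least r)) else cut y \<cdot> cut r)"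
      if "y \<in> insert m (snd ` set es)" for y
      using x(3)[OF that] by (simp add: least_eq_Min min.commute)
    fix I assume I: "relation I (map (apsnd cut) ((- 1, m) # es))"
    have "I = set (leaves (cut m))" using I by (simp add: relation_def multilinear_words_def)
    moreover have "leaf_set m \<inter> leaf_set r = {}" using m by auto
    ultimately have d: "I \<inter> set (leaves (cut r)) = {}" using disjoint_cuts[of m r] by simp
    have ne: "map (apsnd cut) ((- 1, m) # es) \<noteq> []" and w: "multilinear r" using m by simp_all
    show "\<exists>J. relation J (map (apsnd (\<lambda>s. s \<cdot> cut r)) (map (apsnd cut) ((- 1, m) # es)))"
      using relation_Mul_left[OF I ne words_cut[OF w] d] by (rule exI)
  qed
next
  case (right m es b l)
  let ?N = "\<lambda>m. Node b l m"
  have m: "multilinear (?N m)" by fact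
  then have mm: "multilinear m" by simp
  have x: "multilinear (?N x)" "verts x = verts m" "leaf_set x = leaf_set m" if "x \<in> insert m (snd ` set es)" for x
    using that expands_shape[OF right.hyps mm] m by auto
  show ?case
  proof (rule expansion_relation_context)
    show "expansion_relation m es" using right.IH[OF mm] .
    show "verts (?N m) = (if b then {leaf_set m \<union> leaf_set l} else {}) \<union> verts m \<union> verts l" by auto
    show "label (?N y) B = label y B" if "y \<in> insert m (snd ` set es)" "B \<in> verts m" for y B
      using label_right[OF x(1)[OF that(1)]] x(2)[OF that(1)] that(2) by blast
    show "label (?N y) B = label (?N m) B" if "y \<in> insert m (snd ` set es)" "B \<in> verts l" for y B
      using label_left[OF x(1)[OF that(1)] that(2)] label_left[OF m that(2)] by simp
    show "label (?N y) (leaf_set m \<union> leaf_set l) = cut l \<cdot> cut y" if "y \<in> insert m (snd ` set es)" for y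
      using x(3)[OF that] by (simp add: Un_commute)
    show "cut (?N y) = (if b then Var (min (least m) (least l)) else cut l \<cdot> cut y)"
      if "y \<in> insert m (snd ` set es)" for y
      using x(3)[OF that] by (simp add: least_eq_Min min.commute)
    fix I assume I: "relation I (map (apsnd cut) ((- 1, m) # es))"
    have "I = set (leaves (cut m))" using I by (simp add: relation_def multilinear_words_def)
    moreover have "leaf_set m \<inter> leaf_set l = {}" using m by auto
    ultimately have d: "I \<inter> set (leaves (cut l)) = {}" using disjoint_cuts[of m l] by simp
    have ne: "map (apsnd cut) ((- 1, m) # es) \<noteq> []" and w: "multilinear l" using m by simp_all
    show "\<exists>J. relation J (map (apsnd (\<lambda>s. cut l \<cdot> s)) (map (apsnd cut) ((- 1, m) # es)))"
      using relation_Mul_right[OF I ne words_cut[OF w] d] by (rule exI)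
  qed
qed

text \<open>
  A cochain is linear in the one word that an expansion changes, and kills the relation there. If no vertex
  word changes, all terms have the same value, and the coefficients add up to one.
\<close>

lemma val_expand:
  assumes \<psi>: "\<psi> \<in> cochains Q L n" and T: "reduced_tree L (verts m)" "card (verts m) = n"
    and m: "multilinear m" and e: "expands \<delta> m es"
  shows "val \<psi> m = (\<Sum>(c, x)\<leftarrow>es. c * val \<psi> x)"
proof -
  note shape = expands_shape[OF e m]
  have dec: "decor m \<in> decorations Q (verts m)" by (rule decor_decorations[OF m])
  consider "same_labels (verts m) m es"
    | A I where "A \<in> verts m" "relation I (map (apsnd (\<lambda>x. label x A)) ((- 1, m) # es))" "same_labels (verts m - {A}) m es"
    using expands_relation[OF e m] unfolding expansion_relation_def by blast
  then show ?thesis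
  proof cases
    case 1
    have "val \<psi> (snd x) = val \<psi> m" if "x \<in> set es" for x
    proof -
      have "decor (snd x) = decor m"
        using shape[OF that] 1 that by (auto simp: decor_def same_labels_def intro!: restrict_ext)
      then show ?thesis using shape[OF that] by (simp add: val_def)
    qed
    then have "(\<Sum>(c, x)\<leftarrow>es. c * val \<psi> x) = (\<Sum>(c, x)\<leftarrow>es. c * val \<psi> m)"
      by (intro arg_cong[where f = sum_list] map_cong) auto
    also have "\<dots> = (\<Sum>(c, x)\<leftarrow>es. c) * val \<psi> m"
      by (induction es) (auto simp: algebra_simps)
    finally show ?thesis using expands_sum[OF e] by simp
  next
    case 2
    let ?I = "inputs (verts m) A"
    have I: "I = ?I" using 2 inputs_verts[OF m 2(1)] by (simp add: relation_def multilinear_words_def)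
    have form: "additive_form ?I (\<lambda>X. \<psi> (verts m) ((decor m)(A := X)))"
      using form_of_cochain[OF \<psi> T 2(1) dec] .
    have upd: "decor x = (decor m)(A := cl ?I (word (label x A)))"
      if "verts x = verts m" "\<forall>B\<in>verts m - {A}. label x B = label m B" for x
      using that 2(1) by (auto simp: decor_def fun_eq_iff)
    have v: "val \<psi> x = \<psi> (verts m) ((decor m)(A := cl ?I (word (label x A))))" if "x = m \<or> x \<in> snd ` set es" for x
      using that upd[of x] shape 2(3) by (auto simp: val_def same_labels_def)
    have "(\<Sum>(c, s)\<leftarrow>map (apsnd (\<lambda>x. label x A)) ((- 1, m) # es). c * \<psi> (verts m) ((decor m)(A := cl ?I (word s)))) = 0"
      using relation_form[OF 2(2)[unfolded I] form] .
    then have "val \<psi> m = (\<Sum>(c, x)\<leftarrow>es. c * \<psi> (verts m) ((decor m)(A := cl ?I (word (label x A)))))"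
      using v[of m] by (simp add: comp_def case_prod_beta')
    also have "\<dots> = (\<Sum>(c, x)\<leftarrow>es. c * val \<psi> x)"
    proof (intro arg_cong[where f = sum_list] map_cong refl)
      fix x assume "x \<in> set es"
      then show "(case x of (c, x) \<Rightarrow> c * \<psi> (verts m) ((decor m)(A := cl ?I (word (label x A)))))
          = (case x of (c, x) \<Rightarrow> c * val \<psi> x)"
        using v[of "snd x"] by (simp add: case_prod_beta')
    qed
    finally show ?thesis .
  qed
qed

end

section \<open>The ideal in arity at most three\<close>

lemma op_linear_zero:
  assumes "symmetric_operad P" "finite I" "finite J" "op_linear P I J f"
  shows "f (op_zero P I) = op_zero P J"
proof -
  interpret symmetric_operad P by fact
  have z: "op_zero P I \<in> op_space P I" using assms zero_closed by blast
  have "f (op_zero P I) = f (op_scale P I 0 (op_zero P I))" using z assms scale_zero by metis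
  also have "\<dots> = op_scale P J 0 (f (op_zero P I))" using assms z unfolding op_linear_def by blast
  also have "\<dots> = op_zero P J" using assms z scale_zero unfolding op_linear_def by blast
  finally show ?thesis .
qed

lemma rename_inj: "\<lbrakk>inj_on \<sigma> I; set (leaves s) \<subseteq> I; set (leaves t) \<subseteq> I; rename \<sigma> s = rename \<sigma> t\<rbrakk> \<Longrightarrow> s = t"
proof -
  assume *: "inj_on \<sigma> I" "set (leaves s) \<subseteq> I" "set (leaves t) \<subseteq> I" "rename \<sigma> s = rename \<sigma> t"
  have inv: "rename (inv_into I \<sigma>) (rename \<sigma> u) = u" if u: "set (leaves u) \<subseteq> I" for u
  proof -
    have "rename (inv_into I \<sigma> \<circ> \<sigma>) u = rename id u"
    proof (rule rename_cong)
      fix i assume "i \<in> set (leaves u)"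
      then have "i \<in> I" using u by blast
      then show "(inv_into I \<sigma> \<circ> \<sigma>) i = id i" using *(1) by simp
    qed
    then show ?thesis by (simp only: rename_rename rename_id)
  qed
  show ?thesis using inv[OF *(2)] inv[OF *(3)] *(4) by metis
qed

lemma relabel_apply:
  assumes "finite I" "inj_on \<sigma> I" "s \<in> multilinear_words I"
  shows "op_relabel magmatic_operad \<sigma> I f (rename \<sigma> s) = f s"
proof -
  have "(if rename \<sigma> t = rename \<sigma> s then f t else 0) = (if t = s then f t else 0)" if "t \<in> multilinear_words I" for t
    using that rename_inj[OF assms(2), of t s] assms(3) by (auto simp: multilinear_words_def)
  then have "op_relabel magmatic_operad \<sigma> I f (rename \<sigma> s) = (\<Sum>t\<in>multilinear_words I. if t = s then f t else 0)"
    by (simp add: mag_sel push_def cong: sum.cong)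
  then show ?thesis using assms by (simp add: finite_multilinear_words)
qed

lemma card_graft:
  assumes "composable I i J" shows "card (graft I i J) + 1 = card I + card J"
proof -
  have "card (graft I i J) = card (I - {i}) + card J"
    using assms unfolding graft_def composable_def by (intro card_Un_disjoint) auto
  moreover have "card (I - {i}) + 1 = card I"
    using assms unfolding composable_def by (metis Suc_eq_plus1 card_Suc_Diff1)
  ultimately show ?thesis by simp
qed

text \<open>
  Modulo the identities, the products \<open>(xy)z\<close> are symmetric in \<open>y, z\<close> and the
  elements \<open>x(yz) - \<delta>(xy)z\<close> are symmetric in \<open>x, y\<close>, and no further relation holds.
  So the component in arity three has three coordinates of each kind. The form \<open>left_form\<close> reads off
  the coefficient of \<open>(xy)z\<close>, where a word \<open>x(yz)\<close> counts with the factor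
  \<open>\<delta>\<close>, and \<open>right_form\<close> the coefficient of
  \<open>x(yz) - \<delta>(xy)z\<close>.
\<close>

definition left_form :: "complex \<Rightarrow> nat \<Rightarrow> nat \<Rightarrow> nat \<Rightarrow> (magma \<Rightarrow> complex) \<Rightarrow> complex" where
  "left_form \<delta> x y z r = r (Var x \<cdot> Var y \<cdot> Var z) + r (Var x \<cdot> Var z \<cdot> Var y)
     + \<delta> * (r (Var x \<cdot> (Var y \<cdot> Var z)) + r (Var x \<cdot> (Var z \<cdot> Var y)))"

definition right_form :: "nat \<Rightarrow> nat \<Rightarrow> nat \<Rightarrow> (magma \<Rightarrow> complex) \<Rightarrow> complex" where
  "right_form x y z r = r (Var x \<cdot> (Var y \<cdot> Var z)) + r (Var y \<cdot> (Var x \<cdot> Var z))"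

lemma form_linear:
  "left_form \<delta> x y z (\<lambda>t. 0) = 0" "right_form x y z (\<lambda>t. 0) = 0"
  "left_form \<delta> x y z (\<lambda>t. r t + s t) = left_form \<delta> x y z r + left_form \<delta> x y z s"
  "right_form x y z (\<lambda>t. r t + s t) = right_form x y z r + right_form x y z s"
  "left_form \<delta> x y z (\<lambda>t. c * r t) = c * left_form \<delta> x y z r"
  "right_form x y z (\<lambda>t. c * r t) = c * right_form x y z r"
  by (simp_all add: left_form_def right_form_def algebra_simps)

text \<open>
  If \<open>I\<close> has three elements, then \<open>x, y, z\<close> are forced to be distinct.
\<close>

definition cubic_relations :: "complex \<Rightarrow> nat set \<Rightarrow> (magma \<Rightarrow> complex) \<Rightarrow> bool" where
  "cubic_relations \<delta> I r \<longleftrightarrow> (\<forall>x y z. I = {x, y, z} \<longrightarrow> left_form \<delta> x y z r = 0 \<and> right_form x y z r = 0)"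

definition small_relations :: "complex \<Rightarrow> nat set \<Rightarrow> (magma \<Rightarrow> complex) \<Rightarrow> bool" where
  "small_relations \<delta> I r \<longleftrightarrow> (card I \<le> 2 \<longrightarrow> r = (\<lambda>t. 0)) \<and> (card I = 3 \<longrightarrow> cubic_relations \<delta> I r)"

lemma small_relations_zero: "small_relations \<delta> I (\<lambda>t. 0)"
  by (simp add: small_relations_def cubic_relations_def form_linear)

lemma small_relations_add:
  "\<lbrakk>small_relations \<delta> I r; small_relations \<delta> I s\<rbrakk> \<Longrightarrow> small_relations \<delta> I (\<lambda>t. r t + s t)"
  by (auto simp: small_relations_def cubic_relations_def form_linear)

lemma small_relations_scale: "small_relations \<delta> I r \<Longrightarrow> small_relations \<delta> I (\<lambda>t. c * r t)"
  by (auto simp: small_relations_def cubic_relations_def form_linear)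

lemma small_relations_relabel:
  assumes r: "small_relations \<delta> I r" and I: "finite I" and \<sigma>: "inj_on \<sigma> I"
  shows "small_relations \<delta> (\<sigma> ` I) (op_relabel magmatic_operad \<sigma> I r)"
  unfolding small_relations_def
proof (intro conjI impI)
  have c: "card (\<sigma> ` I) = card I" using \<sigma> by (rule card_image)
  {
    assume "card (\<sigma> ` I) \<le> 2"
    then have "r = (\<lambda>t. 0)" using r c by (simp add: small_relations_def)
    then show "op_relabel magmatic_operad \<sigma> I r = (\<lambda>t. 0)" by (simp add: mag_sel push_def)
  }
  assume "card (\<sigma> ` I) = 3"
  then have r3: "cubic_relations \<delta> I r" and I3: "card I = 3" using r c by (auto simp: small_relations_def)
  show "cubic_relations \<delta> (\<sigma> ` I) (op_relabel magmatic_operad \<sigma> I r)"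
    unfolding cubic_relations_def
  proof (intro allI impI)
    fix x' y' z' assume eq: "\<sigma> ` I = {x', y', z'}"
    have "x' \<in> \<sigma> ` I" "y' \<in> \<sigma> ` I" "z' \<in> \<sigma> ` I" by (simp_all add: eq)
    then obtain x y z where xyz: "x \<in> I" "y \<in> I" "z \<in> I" "x' = \<sigma> x" "y' = \<sigma> y" "z' = \<sigma> z"
      by (elim imageE) iprover
    have "card {x', y', z'} = 3" using c I3 by (simp add: eq)
    then have "x' \<noteq> y'" "x' \<noteq> z'" "y' \<noteq> z'" by (auto simp: card_insert_if split: if_splits)
    then have ne: "x \<noteq> y" "x \<noteq> z" "y \<noteq> z" using xyz(4-6) by blast+
    then have "card {x, y, z} = 3" by simp
    then have Ieq: "I = {x, y, z}" using xyz I I3 card_subset_eq[OF I, of "{x, y, z}"] by auto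
    have app: "op_relabel magmatic_operad \<sigma> I r (rename \<sigma> s) = r s" if "s \<in> multilinear_words I" for s
      using relabel_apply[OF I \<sigma> that] .
    have w: "Var x \<cdot> Var y \<cdot> Var z \<in> multilinear_words I" "Var x \<cdot> Var z \<cdot> Var y \<in> multilinear_words I"
      "Var x \<cdot> (Var y \<cdot> Var z) \<in> multilinear_words I" "Var x \<cdot> (Var z \<cdot> Var y) \<in> multilinear_words I"
      "Var y \<cdot> (Var x \<cdot> Var z) \<in> multilinear_words I"
      using Ieq ne by (auto simp: multilinear_words_def)
    note a = w[THEN app, simplified]
    have "left_form \<delta> x' y' z' (op_relabel magmatic_operad \<sigma> I r) = left_form \<delta> x y z r"
      "right_form x' y' z' (op_relabel magmatic_operad \<sigma> I r) = right_form x y z r"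
      unfolding left_form_def right_form_def xyz a by simp_all
    then show "left_form \<delta> x' y' z' (op_relabel magmatic_operad \<sigma> I r) = 0 \<and>
        right_form x' y' z' (op_relabel magmatic_operad \<sigma> I r) = 0"
      using r3 Ieq unfolding cubic_relations_def by simp
  qed
qed

text \<open>
  The ideal starts in arity three, and there only with the relabelled identities: a composition that lands in
  arity three either involves an element of the ideal in arity at most two, which is zero, or one factor
  is a multiple of a unit.
\<close>

lemma novikov_small_relations: "(I, r) \<in> novikov_ideal \<delta> \<Longrightarrow> small_relations \<delta> I r"
proof -
  interpret operad_ideal magmatic_operad "novikov_ideal \<delta>" by (rule operad_ideal_novikov)
  have cases3: "(x, y, z) \<in> {(0, 1, 2), (0, 2, 1), (1, 0, 2), (1, 2, 0), (2, 0, 1), (2, 1, 0)}"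
    if "{0, 1, 2} = {x, y, z}" for x y z :: nat
  proof -
    have "x \<in> {0, 1, 2}" "y \<in> {0, 1, 2}" "z \<in> {0, 1, 2}" using that by simp_all
    moreover have "card {x, y, z} = 3" using that[symmetric] by simp
    then have "x \<noteq> y" "x \<noteq> z" "y \<noteq> z" by (auto simp: card_insert_if split: if_splits)
    ultimately show ?thesis by auto
  qed
  show "small_relations \<delta> I r" if "(I, r) \<in> novikov_ideal \<delta>"
    using that unfolding novikov_ideal_def
  proof (induction rule: generated_ideal.induct)
    case (gen I x)
    have "cubic_relations \<delta> {0, 1, 2} (delta_left_symmetry \<delta>)" "cubic_relations \<delta> {0, 1, 2} right_commutativity"
      unfolding cubic_relations_def using cases3
      by (force simp: left_form_def right_form_def delta_left_symmetry_def right_commutativity_def word_def Let_def algebra_simps)+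
    then show ?case using gen by (auto simp: small_relations_def)
  next
    case (zero I)
    then show ?case by (simp add: mag_sel small_relations_zero)
  next
    case (add I x y)
    then show ?case by (simp add: mag_sel small_relations_add)
  next
    case (scale I x c)
    then show ?case by (simp add: mag_sel small_relations_scale)
  next
    case (relabel I x \<sigma>)
    then have "finite I" using ideal_finite unfolding novikov_ideal_def by blast
    then show ?case using relabel by (intro small_relations_relabel)
  next
    case (comp_left I x i J y)
    note c = comp_left(2)
    have I: "finite I" and J: "finite J" and iI: "i \<in> I" using c by (auto simp: composable_def)
    have fg: "finite (graft I i J)" using finite_composable[OF c] by simp
    have xs: "x \<in> op_space magmatic_operad I" using comp_left ideal_space unfolding novikov_ideal_def by blast
    consider "J = {}" | j where "J = {j}" | "2 \<le> card J"
      by (metis J One_nat_def Suc_1 card_1_singletonE card_0_eq le_less_linear less_2_cases_iff)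
    then show ?case
    proof cases
      case 1
      then have "y = op_zero magmatic_operad J" using comp_left(3) by (auto simp: mag_sel multilinear_words_def)
      then have "op_comp magmatic_operad I i J x y = op_zero magmatic_operad (graft I i J)"
        using op_linear_zero[OF symmetric_operad_magmatic J fg comp_linear_right[OF c xs]] by simp
      then show ?thesis by (simp add: mag_sel small_relations_zero)
    next
      case (2 j)
      \<comment> \<open>composing with a multiple of a unit only renames the input\<close>
      define \<sigma> where "\<sigma> = id(i := j)"
      have \<sigma>: "inj_on \<sigma> I" using c 2 by (auto simp: \<sigma>_def composable_def inj_on_def)
      have ci: "composable I i {i}" using I iI by (simp add: composable_def)
      have gi: "graft I i {i} = I" using iI by (auto simp: graft_def)
      have img: "\<sigma> ` I = graft I i J" using 2 iI by (auto simp: \<sigma>_def graft_def)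
      have "op_comp magmatic_operad (id ` I) (id i) (\<sigma> ` {i}) (op_relabel magmatic_operad id I x)
          (op_relabel magmatic_operad \<sigma> {i} (op_unit magmatic_operad i))
        = op_relabel magmatic_operad \<sigma> (graft I i {i}) (op_comp magmatic_operad I i {i} x (op_unit magmatic_operad i))"
        using ci xs unit_closed \<sigma> gi by (intro comp_equivariant) (auto simp: \<sigma>_def)
      then have rel: "op_comp magmatic_operad I i J x (op_unit magmatic_operad j) = op_relabel magmatic_operad \<sigma> I x"
        using relabel_id[OF I xs] relabel_unit comp_unit_right[OF I iI xs] gi 2 by (simp add: \<sigma>_def)
      have "y = op_scale magmatic_operad J (y (Var j)) (op_unit magmatic_operad j)"
        using comp_left(3) 2 by (auto simp: mag_sel words_singleton word_def)
      then have "op_comp magmatic_operad I i J x y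
          = op_scale magmatic_operad (graft I i J) (y (Var j)) (op_comp magmatic_operad I i J x (op_unit magmatic_operad j))"
        using comp_linear_right[OF c xs] unit_closed[of j] 2 unfolding op_linear_def by metis
      then show ?thesis
        unfolding rel using small_relations_relabel[OF comp_left(4) I \<sigma>] unfolding img
        by (simp add: small_relations_scale mag_sel(4))
    next
      case 3
      show ?thesis
      proof (cases "card I \<le> 2")
        case True
        then have "x = op_zero magmatic_operad I" using comp_left(4) by (simp add: small_relations_def mag_sel)
        then have "op_comp magmatic_operad I i J x y = op_zero magmatic_operad (graft I i J)"
          using op_linear_zero[OF symmetric_operad_magmatic I fg comp_linear_left[OF c comp_left(3)]] by simp
        then show ?thesis by (simp add: mag_sel small_relations_zero)
      next
        case False
        then show ?thesis using 3 card_graft[OF c] by (auto simp: small_relations_def)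
      qed
    qed
  next
    case (comp_right x I i J y)
    note c = comp_right(2)
    have I: "finite I" and J: "finite J" and iI: "i \<in> I" using c by (auto simp: composable_def)
    have fg: "finite (graft I i J)" using finite_composable[OF c] by simp
    have ys: "y \<in> op_space magmatic_operad J" using comp_right(3) ideal_space unfolding novikov_ideal_def by blast
    have cI: "1 \<le> card I" using I iI by (simp add: Suc_le_eq card_gt_0_iff) blast
    show ?case
    proof (cases "card J \<le> 2")
      case True
      then have "y = op_zero magmatic_operad J" using comp_right(4) by (simp add: small_relations_def mag_sel)
      then have "op_comp magmatic_operad I i J x y = op_zero magmatic_operad (graft I i J)"
        using op_linear_zero[OF symmetric_operad_magmatic J fg comp_linear_right[OF c comp_right(1)]] by simp
      then show ?thesis by (simp add: mag_sel small_relations_zero)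
    next
      case J3: False
      show ?thesis
      proof (cases "card I = 1")
        case True
        \<comment> \<open>here the element of the operad is a multiple of a unit\<close>
        then have Ii: "I = {i}" using iI by (auto simp: card_1_singleton_iff)
        then have g: "graft I i J = J" by (auto simp: graft_def)
        have "x = op_scale magmatic_operad I (x (Var i)) (op_unit magmatic_operad i)"
          using comp_right(1) Ii by (auto simp: mag_sel words_singleton word_def)
        then have "op_comp magmatic_operad I i J x y
            = op_scale magmatic_operad (graft I i J) (x (Var i)) (op_comp magmatic_operad I i J (op_unit magmatic_operad i) y)"
          using comp_linear_left[OF c ys] unit_closed[of i] Ii unfolding op_linear_def by metis
        also have "\<dots> = op_scale magmatic_operad J (x (Var i)) y"
          using comp_unit_left[OF J ys] Ii g by simp
        finally show ?thesis unfolding g using comp_right(4) by (simp add: small_relations_scale mag_sel(4))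
      next
        case False
        then show ?thesis using J3 cI card_graft[OF c] by (auto simp: small_relations_def)
      qed
    qed
  qed
qed

section \<open>Codes of vertices and cochains given by coordinates\<close>

text \<open>
  The number \<^const>\<open>set_encode\<close> of the leaf set, by which the differential orders edges.
\<close>

primrec vertex_code :: "marked \<Rightarrow> int" where
  "vertex_code (Leaf i) = 2 ^ i"
| "vertex_code (Node b l r) = vertex_code l + vertex_code r"

primrec vertex_list :: "marked \<Rightarrow> nat set list" where
  "vertex_list (Leaf i) = []"
| "vertex_list (Node b l r) = (if b then [leaf_set l \<union> leaf_set r] else []) @ vertex_list l @ vertex_list r"

primrec label_list :: "marked \<Rightarrow> (int \<times> magma) list" where
  "label_list (Leaf i) = []"
| "label_list (Node b l r) = (if b then [(vertex_code l + vertex_code r, cut l \<cdot> cut r)] else []) @ label_list l @ label_list r"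

primrec unmarkings :: "marked \<Rightarrow> (int \<times> marked) list" where
  "unmarkings (Leaf i) = []"
| "unmarkings (Node b l r) = (if b then [(vertex_code l + vertex_code r, Node False l r)] else [])
     @ map (\<lambda>(k, x). (k, Node b x r)) (unmarkings l) @ map (\<lambda>(k, x). (k, Node b l x)) (unmarkings r)"

text \<open>
  The first unmarking concerns the root, which has no outgoing edge.
\<close>

definition contractions :: "marked \<Rightarrow> (int \<times> marked) list" where
  "contractions m = (let us = tl (unmarkings m) in
     map (\<lambda>(k, x). ((- 1) ^ length (filter (\<lambda>(j, _). j < k) us), x)) us)"

text \<open>
  The value of a coordinate form on a word is zero or a power of \<open>\<delta>\<close>, and only the exponent is
  recorded. The first argument selects the form: in arity three \<open>left_form\<close> for
  \<open>(xy)z\<close> and \<open>right_form\<close> for \<open>x(yz)\<close>. In arity two the words are a basis.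
\<close>

fun coord_exponent :: "magma \<Rightarrow> magma \<Rightarrow> nat option" where
  "coord_exponent (Var x \<cdot> Var y \<cdot> Var z) t =
     (if t = Var x \<cdot> Var y \<cdot> Var z \<or> t = Var x \<cdot> Var z \<cdot> Var y then Some 0
      else if t = Var x \<cdot> (Var y \<cdot> Var z) \<or> t = Var x \<cdot> (Var z \<cdot> Var y) then Some 1 else None)"
| "coord_exponent (Var x \<cdot> (Var y \<cdot> Var z)) t =
     (if t = Var x \<cdot> (Var y \<cdot> Var z) \<or> t = Var y \<cdot> (Var x \<cdot> Var z) then Some 0 else None)"
| "coord_exponent s t = (if s = t then Some 0 else None)"

text \<open>
  The words for which \<^const>\<open>coord_exponent\<close> describes a form on the quotient.
\<close>

fun has_coordinate :: "magma \<Rightarrow> bool" where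
  "has_coordinate (Var x \<cdot> Var y) = True"
| "has_coordinate (Var x \<cdot> Var y \<cdot> Var z) = True"
| "has_coordinate (Var x \<cdot> (Var y \<cdot> Var z)) = True"
| "has_coordinate _ = False"

fun pairing_exponent :: "(int \<times> magma) list \<Rightarrow> (int \<times> magma) list \<Rightarrow> nat option" where
  "pairing_exponent [] ys = Some 0"
| "pairing_exponent ((k, s) # xs) ys = (case map_of ys k of None \<Rightarrow> None | Some t \<Rightarrow>
     (case coord_exponent s t of None \<Rightarrow> None | Some a \<Rightarrow> map_option (\<lambda>b. a + b) (pairing_exponent xs ys)))"

fun cocycle_terms :: "(int \<times> nat \<times> (int \<times> magma) list) list \<Rightarrow> int \<Rightarrow> (int \<times> magma) list \<Rightarrow> (int \<times> nat) list" where
  "cocycle_terms [] s cs = []"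
| "cocycle_terms ((c, k, e) # es) s cs = (case pairing_exponent e cs of None \<Rightarrow> cocycle_terms es s cs | Some a \<Rightarrow> (s * c, k + a) # cocycle_terms es s cs)"

fun differential_terms :: "(int \<times> nat \<times> (int \<times> magma) list) list \<Rightarrow> (int \<times> marked) list \<Rightarrow> (int \<times> nat) list" where
  "differential_terms es [] = []"
| "differential_terms es ((s, x) # xs) = cocycle_terms es s (label_list x) @ differential_terms es xs"

fun cancels :: "(int \<times> 'k) list \<Rightarrow> bool" where
  "cancels [] = True"
| "cancels ((c, k) # xs) = (c + sum_list (map fst (filter (\<lambda>(d, l). l = k) xs)) = 0
     \<and> cancels (filter (\<lambda>(d, l). l \<noteq> k) xs))"

text \<open>
  Terms on different trees never cancel, so equal terms need only be searched among those with the same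
  key.
\<close>

fun cancels_by_key :: "('a \<times> int \<times> 'k) list \<Rightarrow> bool" where
  "cancels_by_key [] = True"
| "cancels_by_key ((k, x) # xs) = (cancels (x # map snd (filter (\<lambda>(l, _). l = k) xs))
     \<and> cancels_by_key (filter (\<lambda>(l, _). l \<noteq> k) xs))"

lemma vertex_code_eq: "multilinear m \<Longrightarrow> vertex_code m = int (set_encode (leaf_set m))"
  by (induction m) (auto simp: set_encode_def sum.union_disjoint)

lemma vertex_code_Node: "multilinear (Node b l r) \<Longrightarrow> vertex_code l + vertex_code r = int (set_encode (leaf_set l \<union> leaf_set r))"
  using vertex_code_eq[of "Node b l r"] by simp

lemma set_vertex_list [simp]: "set (vertex_list m) = verts m"
  by (induction m) auto

lemma distinct_vertex_list: "multilinear m \<Longrightarrow> distinct (vertex_list m)"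
proof (induction m)
  case (Node b l r)
  have "verts l \<inter> verts r = {}"
    using multilinear_split(4)[OF Node.prems] verts_subset by blast
  then show ?case using Node multilinear_split(1,2)[OF Node.prems] by simp
qed auto

lemma label_list_eq: "multilinear m \<Longrightarrow> label_list m = map (\<lambda>A. (int (set_encode A), label m A)) (vertex_list m)"
proof (induction m)
  case (Node b l r)
  have "map (\<lambda>A. (int (set_encode A), label l A)) (vertex_list l) = map (\<lambda>A. (int (set_encode A), label (Node b l r) A)) (vertex_list l)"
    "map (\<lambda>A. (int (set_encode A), label r A)) (vertex_list r) = map (\<lambda>A. (int (set_encode A), label (Node b l r) A)) (vertex_list r)"
    using label_left[OF Node.prems] label_right[OF Node.prems] by (auto simp del: label.simps)
  moreover have "label (Node b' l r) (leaf_set l \<union> leaf_set r) = cut l \<cdot> cut r" for b' by simp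
  ultimately show ?case using Node vertex_code_Node[OF Node.prems] by (cases b) (simp_all del: label.simps)
qed auto

lemma unmarkings_eq: "multilinear m \<Longrightarrow> unmarkings m = map (\<lambda>A. (int (set_encode A), unmark A m)) (vertex_list m)"
proof (induction m)
  case (Node b l r)
  have "Node b (unmark A l) r = unmark A (Node b l r)" if "A \<in> verts l" for A
    using that multilinear_split(1,3)[OF Node.prems] unmark_fresh[of A r] by auto
  moreover have "Node b l (unmark A r) = unmark A (Node b l r)" if "A \<in> verts r" for A
    using that multilinear_split(2,4)[OF Node.prems] unmark_fresh[of A l] by auto
  moreover have "unmark (leaf_set l \<union> leaf_set r) (Node b' l r) = Node False l r" for b' by simp
  ultimately show ?case using Node vertex_code_Node[OF Node.prems] by (cases b) (simp_all del: unmark.simps)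
qed auto

lemma set_encode_eq_iff: "finite A \<Longrightarrow> finite B \<Longrightarrow> set_encode A = set_encode B \<longleftrightarrow> A = B"
  using inj_on_set_encode by (auto simp: inj_on_def)

lemma finite_vert: "A \<in> verts m \<Longrightarrow> finite A"
  using verts_subset finite_leaf_set finite_subset by blast

context magmatic_ideal begin

lemma differential_contractions:
  assumes m: "m = Node True l r" "multilinear m"
  shows "differential Q (leaf_set m) \<phi> (verts m) (decor m) = (\<Sum>(c, x)\<leftarrow>contractions m. of_int c * val \<phi> x)"
proof -
  let ?vs = "tl (vertex_list m)"
  have vs: "distinct ?vs" "set ?vs = verts m - {leaf_set m}"
    using distinct_vertex_list[OF m(2)] set_vertex_list[of m] unfolding m(1) by auto
  have us: "tl (unmarkings m) = map (\<lambda>A. (int (set_encode A), unmark A m)) ?vs"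
    by (simp add: unmarkings_eq[OF m(2)] map_tl)
  have len: "length (filter (\<lambda>(j, _). j < int (set_encode A)) (tl (unmarkings m)))
      = card {B \<in> verts m - {leaf_set m}. set_encode B < set_encode A}" for A
  proof -
    have "length (filter (\<lambda>(j, _). j < int (set_encode A)) (tl (unmarkings m)))
        = length (filter (\<lambda>B. set_encode B < set_encode A) ?vs)"
      unfolding us by (simp add: filter_map comp_def)
    also have "\<dots> = card {B \<in> set ?vs. set_encode B < set_encode A}"
      using vs(1) by (metis distinct_card distinct_filter set_filter)
    finally show ?thesis using vs(2) by simp
  qed
  have "(\<Sum>(c, x)\<leftarrow>contractions m. of_int c * val \<phi> x)
      = (\<Sum>A\<leftarrow>?vs. (- 1) ^ card {B \<in> verts m - {leaf_set m}. set_encode B < set_encode A} * val \<phi> (unmark A m))"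
    unfolding contractions_def Let_def len[symmetric]
    by (simp add: us comp_def case_prod_beta')
  also have "\<dots> = (\<Sum>A\<in>verts m - {leaf_set m}. (- 1) ^ card {B \<in> verts m - {leaf_set m}. set_encode B < set_encode A} * val \<phi> (unmark A m))"
    using vs by (simp add: sum_list_distinct_conv_sum_set)
  finally show ?thesis using differential_marked[OF m] by simp
qed

lemma contractions_shape:
  assumes m: "m = Node True l r" "multilinear m" and x: "(c, x) \<in> set (contractions m)"
  shows "multilinear x" "leaf_set x = leaf_set m" "reduced_tree (leaf_set m) (verts x)" "card (verts x) + 1 = card (verts m)"
proof -
  have "tl (unmarkings m) = map (\<lambda>A. (int (set_encode A), unmark A m)) (tl (vertex_list m))"
    by (simp add: unmarkings_eq[OF m(2)] map_tl)
  then have "x \<in> (\<lambda>A. unmark A m) ` set (tl (vertex_list m))"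
    using x by (auto simp: contractions_def Let_def)
  then obtain A where A: "A \<in> set (tl (vertex_list m))" "x = unmark A m" by blast
  have "A \<in> verts m - {leaf_set m}" using A(1) distinct_vertex_list[OF m(2)] set_vertex_list[of m] unfolding m(1) by auto
  then have A': "A \<in> verts m" "A \<noteq> leaf_set m" by auto
  show "multilinear x" "leaf_set x = leaf_set m" using A m(2) by auto
  have v: "verts x = verts m - {A}" using A m(2) by (simp add: verts_unmark)
  have "reduced_tree (leaf_set m) (verts m)" using reduced_tree_verts m by simp
  then show "reduced_tree (leaf_set m) (verts x)" unfolding v using A'(2) by (simp add: reduced_tree_def)
  show "card (verts x) + 1 = card (verts m)" unfolding v using A' by (metis Suc_eq_plus1 card_Suc_Diff1 finite_verts)
qed

end

lemma sum_list_filter_split: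
  "(\<Sum>x\<leftarrow>xs. f x) = (\<Sum>x\<leftarrow>filter P xs. f x) + (\<Sum>x\<leftarrow>filter (\<lambda>x. \<not> P x) xs. (f x :: complex))"
  by (induction xs) (auto simp: algebra_simps)

lemma cancels_sum: "cancels xs \<Longrightarrow> (\<Sum>(c, k)\<leftarrow>xs. of_int c * (F k :: complex)) = 0"
proof (induction xs rule: cancels.induct)
  case (2 c k xs)
  have "(\<Sum>(d, l)\<leftarrow>filter (\<lambda>(d, l). l = k) xs. of_int d * F l) = of_int (sum_list (map fst (filter (\<lambda>(d, l). l = k) xs))) * F k"
    by (induction xs) (auto simp: algebra_simps)
  moreover have "(\<Sum>(d, l)\<leftarrow>filter (\<lambda>(d, l). l \<noteq> k) xs. of_int d * F l) = 0"
    using 2 by simp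
  moreover have "of_int c * F k + of_int (sum_list (map fst (filter (\<lambda>(d, l). l = k) xs))) * F k = 0"
  proof -
    have "of_int c * F k + of_int (sum_list (map fst (filter (\<lambda>(d, l). l = k) xs))) * F k
        = of_int (c + sum_list (map fst (filter (\<lambda>(d, l). l = k) xs))) * F k"
      by (simp add: algebra_simps)
    also have "c + sum_list (map fst (filter (\<lambda>(d, l). l = k) xs)) = 0" using 2(2) by simp
    finally show ?thesis by simp
  qed
  ultimately show ?case
    using sum_list_filter_split[of "\<lambda>(c, k). of_int c * F k" xs "\<lambda>(d, l). l = k"]
    by (simp add: case_prod_beta')
qed simp

lemma cancels_by_key_sum: "cancels_by_key xs \<Longrightarrow> (\<Sum>(k, c, q)\<leftarrow>xs. of_int c * (F q :: complex)) = 0"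
proof (induction xs rule: cancels_by_key.induct)
  case (2 k x xs)
  have "(\<Sum>(c, q)\<leftarrow>x # map snd (filter (\<lambda>(l, _). l = k) xs). of_int c * F q) = 0"
    using 2(2) by (intro cancels_sum) simp
  moreover have "(\<Sum>(k, c, q)\<leftarrow>filter (\<lambda>(l, _). l \<noteq> k) xs. of_int c * F q) = 0"
    using 2 by simp
  ultimately show ?case
    using sum_list_filter_split[of "\<lambda>(k, c, q). of_int c * F q" xs "\<lambda>(l, _). l = k"]
    by (simp add: case_prod_beta' comp_def)
qed simp

definition coordinate :: "complex \<Rightarrow> magma \<Rightarrow> magma \<Rightarrow> complex" where
  "coordinate \<delta> s t = (case coord_exponent s t of None \<Rightarrow> 0 | Some k \<Rightarrow> \<delta> ^ k)"

text \<open>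
  This makes the coordinates well defined on the quotient operad.
\<close>

lemma coordinate_annihilates:
  assumes s: "has_coordinate s" "s \<in> multilinear_words I" and r: "(I, r) \<in> novikov_ideal \<delta>"
  shows "(\<Sum>t\<in>multilinear_words I. coordinate \<delta> s t * r t) = 0"
proof -
  have rel: "small_relations \<delta> I r" using r by (rule novikov_small_relations)
  have fin: "finite (multilinear_words I)" using s(2) multilinear_words_index finite_multilinear_words by blast
  have restr: "(\<Sum>t\<in>multilinear_words I. coordinate \<delta> s t * r t) = (\<Sum>t\<in>S. coordinate \<delta> s t * r t)"
    if "S \<subseteq> multilinear_words I" "\<And>t. t \<notin> S \<Longrightarrow> coordinate \<delta> s t = 0" for S
    using that fin by (intro sum.mono_neutral_right) auto
  from s(1) show ?thesis
  proof (cases s rule: has_coordinate.cases)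
    case (1 x y)
    then have "card I = 2" using s(2) by (auto simp: multilinear_words_def)
    then show ?thesis using rel by (simp add: small_relations_def)
  next
    case (2 x y z)
    then have I: "I = {x, y, z}" "x \<noteq> y" "x \<noteq> z" "y \<noteq> z" using s(2) by (auto simp: multilinear_words_def)
    let ?S = "{Var x \<cdot> Var y \<cdot> Var z, Var x \<cdot> Var z \<cdot> Var y, Var x \<cdot> (Var y \<cdot> Var z), Var x \<cdot> (Var z \<cdot> Var y)}"
    have "(\<Sum>t\<in>multilinear_words I. coordinate \<delta> s t * r t) = (\<Sum>t\<in>?S. coordinate \<delta> s t * r t)"
      using I 2 by (intro restr) (auto simp: multilinear_words_def coordinate_def)
    also have "\<dots> = left_form \<delta> x y z r"
      using I 2 by (simp add: coordinate_def left_form_def algebra_simps)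
    also have "\<dots> = 0" using rel I by (simp add: small_relations_def cubic_relations_def)
    finally show ?thesis .
  next
    case (3 x y z)
    then have I: "I = {x, y, z}" "x \<noteq> y" "x \<noteq> z" "y \<noteq> z" using s(2) by (auto simp: multilinear_words_def)
    let ?S = "{Var x \<cdot> (Var y \<cdot> Var z), Var y \<cdot> (Var x \<cdot> Var z)}"
    have "(\<Sum>t\<in>multilinear_words I. coordinate \<delta> s t * r t) = (\<Sum>t\<in>?S. coordinate \<delta> s t * r t)"
      using I 3 by (intro restr) (auto simp: multilinear_words_def coordinate_def)
    also have "\<dots> = right_form x y z r"
      using I 3 by (simp add: coordinate_def right_form_def algebra_simps)
    also have "\<dots> = 0" using rel I by (simp add: small_relations_def cubic_relations_def)
    finally show ?thesis .
  qed simp_all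
qed

text \<open>
  The value of the linear form \<open>k\<close> on words at a representative of a coset. It does not depend on the
  representative if \<open>k\<close> annihilates the ideal.
\<close>

definition functional :: "nat set \<Rightarrow> (magma \<Rightarrow> complex) \<Rightarrow> (magma \<Rightarrow> complex) set \<Rightarrow> complex" where
  "functional I k X = (\<Sum>t\<in>multilinear_words I. k t * (SOME f. f \<in> X) t)"

context magmatic_ideal begin

lemma functional_cl:
  assumes I: "finite I" and k: "\<And>r. (I, r) \<in> K \<Longrightarrow> (\<Sum>t\<in>multilinear_words I. k t * r t) = 0"
    and f: "f \<in> op_space magmatic_operad I"
  shows "functional I k (cl I f) = (\<Sum>t\<in>multilinear_words I. k t * f t)"
proof -
  have "(SOME g. g \<in> cl I f) \<in> cl I f" using someI[of "\<lambda>g. g \<in> cl I f", OF coset_self[OF I f]] .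
  then obtain r where r: "(I, r) \<in> K" "(SOME g. g \<in> cl I f) = op_add magmatic_operad I f r"
    by (rule coset_memE)
  then have "functional I k (cl I f) = (\<Sum>t\<in>multilinear_words I. k t * f t) + (\<Sum>t\<in>multilinear_words I. k t * r t)"
    by (simp add: functional_def mag_sel algebra_simps sum.distrib)
  then show ?thesis using k[OF r(1)] by simp
qed

lemma functional_form:
  assumes I: "finite I" and k: "\<And>r. (I, r) \<in> K \<Longrightarrow> (\<Sum>t\<in>multilinear_words I. k t * r t) = 0"
  shows "additive_form I (functional I k)"
  unfolding additive_form_def q_space
proof (intro conjI ballI allI)
  fix X Y assume "X \<in> cl I ` op_space magmatic_operad I" "Y \<in> cl I ` op_space magmatic_operad I"
  then obtain f g where fg: "X = cl I f" "f \<in> op_space magmatic_operad I" "Y = cl I g" "g \<in> op_space magmatic_operad I"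
    by blast
  have "functional I k (op_add Q I X Y) = (\<Sum>t\<in>multilinear_words I. k t * op_add magmatic_operad I f g t)"
    using fg I by (simp add: q_add functional_cl[OF I k] add_closed)
  then show "functional I k (op_add Q I X Y) = functional I k X + functional I k Y"
    using fg functional_cl[OF I k] by (simp add: mag_sel algebra_simps sum.distrib)
next
  fix c X assume "X \<in> cl I ` op_space magmatic_operad I"
  then obtain f where f: "X = cl I f" "f \<in> op_space magmatic_operad I" by blast
  have "functional I k (op_scale Q I c X) = (\<Sum>t\<in>multilinear_words I. k t * op_scale magmatic_operad I c f t)"
    using f I by (simp add: q_scale functional_cl[OF I k] scale_closed)
  then show "functional I k (op_scale Q I c X) = c * functional I k X"
    using f functional_cl[OF I k] by (simp add: mag_sel algebra_simps sum_distrib_left)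
qed

lemma functional_word:
  assumes I: "finite I" and k: "\<And>r. (I, r) \<in> K \<Longrightarrow> (\<Sum>t\<in>multilinear_words I. k t * r t) = 0"
    and s: "s \<in> multilinear_words I"
  shows "functional I k (cl I (word s)) = k s"
proof -
  have "functional I k (cl I (word s)) = (\<Sum>t\<in>multilinear_words I. k t * word s t)"
    by (rule functional_cl[OF I k word_space[OF s]])
  also have "\<dots> = (\<Sum>t\<in>multilinear_words I. if t = s then k s else 0)"
    by (intro sum.cong) (auto simp: word_def)
  finally have "functional I k (cl I (word s)) = (\<Sum>t\<in>multilinear_words I. if t = s then k s else 0)" .
  then show ?thesis using I s by (simp add: finite_multilinear_words)
qed

lemma form_add: "\<lbrakk>additive_form I g; additive_form I h\<rbrakk> \<Longrightarrow> additive_form I (\<lambda>X. g X + h X)"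
  by (simp add: additive_form_def algebra_simps)

lemma form_scale: "additive_form I g \<Longrightarrow> additive_form I (\<lambda>X. c * g X)"
  by (simp add: additive_form_def algebra_simps)

lemma form_zero: "additive_form I (\<lambda>X. 0)"
  by (simp add: additive_form_def)

end

context novikov begin

text \<open>
  The product of the coordinates selected by the words of \<open>e\<close>, supported on the tree of \<open>e\<close>.
  Products of this kind span the cochains on trees with binary and ternary vertices.
\<close>

definition elementary_cochain :: "marked \<Rightarrow> nat set set \<Rightarrow> (nat set \<Rightarrow> (magma \<Rightarrow> complex) set) \<Rightarrow> complex" where
  "elementary_cochain e T p = (if T = verts e then \<Prod>A\<in>T. functional (inputs T A) (coordinate \<delta> (label e A)) (p A) else 0)"

definition admissible :: "marked \<Rightarrow> bool" where
  "admissible e \<longleftrightarrow> multilinear e \<and> (\<forall>A\<in>verts e. has_coordinate (label e A))"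

lemma admissible_annihilates:
  assumes e: "admissible e" and A: "A \<in> verts e"
  shows "finite (inputs (verts e) A)"
    "(inputs (verts e) A, r) \<in> novikov_ideal \<delta> \<Longrightarrow>
      (\<Sum>t\<in>multilinear_words (inputs (verts e) A). coordinate \<delta> (label e A) t * r t) = 0"
proof -
  have w: "label e A \<in> multilinear_words (inputs (verts e) A)" using e A label_words by (simp add: admissible_def)
  then show "finite (inputs (verts e) A)" using multilinear_words_index by blast
  show "(inputs (verts e) A, r) \<in> novikov_ideal \<delta> \<Longrightarrow>
      (\<Sum>t\<in>multilinear_words (inputs (verts e) A). coordinate \<delta> (label e A) t * r t) = 0"
    using coordinate_annihilates[OF _ w] e A by (simp add: admissible_def)
qed

lemma elementary_cochain_additive:
  assumes e: "admissible e" and A: "A \<in> T"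
  shows "additive_form (inputs T A) (\<lambda>X. elementary_cochain e T (p(A := X)))"
proof (cases "T = verts e")
  case False
  then show ?thesis by (simp add: elementary_cochain_def form_zero)
next
  case True
  have "(\<Prod>B\<in>T. functional (inputs T B) (coordinate \<delta> (label e B)) ((p(A := X)) B))
      = (\<Prod>B\<in>T - {A}. functional (inputs T B) (coordinate \<delta> (label e B)) (p B)) * functional (inputs T A) (coordinate \<delta> (label e A)) X" for X
  proof -
    have "finite T" using True by simp
    moreover have "(\<Prod>B\<in>T - {A}. functional (inputs T B) (coordinate \<delta> (label e B)) ((p(A := X)) B))
        = (\<Prod>B\<in>T - {A}. functional (inputs T B) (coordinate \<delta> (label e B)) (p B))"
      by (intro prod.cong) auto
    ultimately show ?thesis
      using prod.remove[of T A "\<lambda>B. functional (inputs T B) (coordinate \<delta> (label e B)) ((p(A := X)) B)"] A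
      by (simp add: mult.commute)
  qed
  then have "(\<lambda>X. elementary_cochain e T (p(A := X)))
      = (\<lambda>X. (\<Prod>B\<in>T - {A}. functional (inputs T B) (coordinate \<delta> (label e B)) (p B)) * functional (inputs T A) (coordinate \<delta> (label e A)) X)"
    using True by (simp add: elementary_cochain_def)
  moreover have "additive_form (inputs T A) (functional (inputs T A) (coordinate \<delta> (label e A)))"
    using admissible_annihilates[OF e] A True by (intro functional_form) auto
  ultimately show ?thesis by (simp add: form_scale)
qed

lemma val_elementary_cochain:
  assumes e: "admissible e" and m: "multilinear m"
  shows "val (elementary_cochain e) m = (if verts m = verts e then \<Prod>A\<in>verts e. coordinate \<delta> (label e A) (label m A) else 0)"
proof (cases "verts m = verts e")
  case True
  have "functional (inputs (verts e) A) (coordinate \<delta> (label e A)) (decor m A) = coordinate \<delta> (label e A) (label m A)" if A: "A \<in> verts e" for A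
  proof -
    have "label m A \<in> multilinear_words (inputs (verts e) A)" using label_words[OF m, of A] A True by simp
    moreover have "decor m A = cl (inputs (verts e) A) (word (label m A))" using A True by (simp add: decor_def)
    ultimately show ?thesis using functional_word[OF admissible_annihilates[OF e A]] by simp
  qed
  then show ?thesis using True by (simp add: val_def elementary_cochain_def)
qed (simp add: val_def elementary_cochain_def)

lemma map_of_label_list:
  assumes m: "multilinear m" and A: "finite A"
  shows "map_of (label_list m) (int (set_encode A)) = (if A \<in> verts m then Some (label m A) else None)"
proof -
  have "map_of (map (\<lambda>A. (int (set_encode A), label m A)) vs) (int (set_encode A)) = (if A \<in> set vs then Some (label m A) else None)"
    if "\<forall>B\<in>set vs. finite B" for vs
    using that A by (induction vs) (auto simp: set_encode_eq_iff)
  from this[of "vertex_list m"] show ?thesis using finite_vert[of _ m] by (simp add: label_list_eq[OF m])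
qed

lemma pairing_exponent_prod:
  assumes m: "multilinear m" and vs: "\<forall>A\<in>set vs. finite A"
  shows "(case pairing_exponent (map (\<lambda>A. (int (set_encode A), label e A)) vs) (label_list m) of None \<Rightarrow> 0 | Some a \<Rightarrow> \<delta> ^ a)
    = (\<Prod>A\<leftarrow>vs. if A \<in> verts m then coordinate \<delta> (label e A) (label m A) else 0)"
  using vs
proof (induction vs)
  case (Cons A vs)
  then have IH: "(case pairing_exponent (map (\<lambda>A. (int (set_encode A), label e A)) vs) (label_list m) of None \<Rightarrow> 0 | Some a \<Rightarrow> \<delta> ^ a)
    = (\<Prod>A\<leftarrow>vs. if A \<in> verts m then coordinate \<delta> (label e A) (label m A) else 0)" and A: "finite A" by auto
  show ?case
    unfolding prod_list.Cons list.map IH[symmetric] pairing_exponent.simps map_of_label_list[OF m A]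
    by (auto simp: coordinate_def power_add split: option.splits)
qed simp

text \<open>
  The list-based computation only compares the vertices of \<open>e\<close> with those of \<open>m\<close>; since both
  trees have the same number of vertices, containment already means equality.
\<close>

lemma val_elementary_cochain_exponent:
  assumes e: "admissible e" and m: "multilinear m" and card: "card (verts m) = card (verts e)"
  shows "val (elementary_cochain e) m = (case pairing_exponent (label_list e) (label_list m) of None \<Rightarrow> 0 | Some a \<Rightarrow> \<delta> ^ a)"
proof -
  have em: "multilinear e" using e by (simp add: admissible_def)
  have "(case pairing_exponent (label_list e) (label_list m) of None \<Rightarrow> 0 | Some a \<Rightarrow> \<delta> ^ a)
      = (\<Prod>A\<leftarrow>vertex_list e. if A \<in> verts m then coordinate \<delta> (label e A) (label m A) else 0)"
    unfolding label_list_eq[OF em] using finite_vert[of _ e] by (intro pairing_exponent_prod[OF m]) simp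
  also have "\<dots> = (\<Prod>A\<in>verts e. if A \<in> verts m then coordinate \<delta> (label e A) (label m A) else 0)"
    using distinct_vertex_list[OF em] by (simp add: prod.distinct_set_conv_list[symmetric])
  also have "\<dots> = (if verts m = verts e then \<Prod>A\<in>verts e. coordinate \<delta> (label e A) (label m A) else 0)"
  proof (cases "verts e \<subseteq> verts m")
    case True
    then have "verts m = verts e" using card card_subset_eq[of "verts m" "verts e"] by simp
    then show ?thesis by simp
  next
    case False
    then obtain A where "A \<in> verts e" "A \<notin> verts m" by blast
    then have "(\<Prod>A\<in>verts e. if A \<in> verts m then coordinate \<delta> (label e A) (label m A) else 0) = 0"
      by (intro prod_zero) auto
    then show ?thesis using False by auto
  qed
  finally show ?thesis using val_elementary_cochain[OF e m] by simp
qed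

end

section \<open>Reducing and enumerating marked words\<close>

primrec leaf_count :: "marked \<Rightarrow> nat" where
  "leaf_count (Leaf i) = 1"
| "leaf_count (Node b l r) = leaf_count l + leaf_count r"

text \<open>
  The order by which the arguments of products are sorted: by size, and then by the least leaf.
\<close>

definition later :: "marked \<Rightarrow> marked \<Rightarrow> bool" where
  "later s t \<longleftrightarrow> leaf_count t < leaf_count s \<or> leaf_count t = leaf_count s \<and> least t < least s"

fun left_symmetry_reduction :: "bool \<Rightarrow> marked \<Rightarrow> marked \<Rightarrow> (int \<times> nat \<times> marked) list" where
  "left_symmetry_reduction b x (Node False y z) = (if later y x then
     [(1, 0, Node b y (Node False x z)), (1, 1, Node b (Node False x y) z), (- 1, 1, Node b (Node False y x) z)] else [])"
| "left_symmetry_reduction b x m = []"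

fun top_reduction :: "bool \<Rightarrow> marked \<Rightarrow> marked \<Rightarrow> (int \<times> nat \<times> marked) list" where
  "top_reduction b (Node False x y) z = (if later z y then [(1, 0, Node b (Node False x z) y)]
     else left_symmetry_reduction b (Node False x y) z)"
| "top_reduction b m z = left_symmetry_reduction b m z"

text \<open>
  One rewriting step at an innermost reducible place. Right commutativity moves the later of two right
  factors inside, and left symmetry moves the later of two left factors outside, at the cost of two
  words with coefficients \<open>\<delta>\<close> and \<open>- \<delta>\<close>.
\<close>

primrec reduction :: "marked \<Rightarrow> (int \<times> nat \<times> marked) list" where
  "reduction (Leaf i) = []"
| "reduction (Node b l r) = (case reduction l of
     [] \<Rightarrow> (case reduction r of [] \<Rightarrow> top_reduction b l r | s \<Rightarrow> map (\<lambda>(c, k, x). (c, k, Node b l x)) s)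
   | s \<Rightarrow> map (\<lambda>(c, k, x). (c, k, Node b x r)) s)"

text \<open>
  The number bounds the length of the reduction. Every step is an identity for cochains, so every
  bound gives a valid identity.
\<close>

fun reduce :: "nat \<Rightarrow> (int \<times> nat \<times> marked) \<Rightarrow> (int \<times> nat \<times> marked) list" where
  "reduce 0 x = [x]"
| "reduce (Suc n) (c, k, m) = (case reduction m of [] \<Rightarrow> [(c, k, m)]
     | s \<Rightarrow> concat (map (\<lambda>(d, j, x). reduce n (c * d, k + j, x)) s))"

definition at_delta :: "complex \<Rightarrow> int \<times> nat \<times> 'a \<Rightarrow> complex \<times> 'a" where
  "at_delta \<delta> = (\<lambda>(c, k, x). (of_int c * \<delta> ^ k, x))"

lemma left_symmetry_reduction_expands:
  "left_symmetry_reduction b l r \<noteq> [] \<Longrightarrow> expands \<delta> (Node b l r) (map (at_delta \<delta>) (left_symmetry_reduction b l r))"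
  using expands.left_symmetric[of \<delta> b l]
  by (cases "(b, l, r)" rule: left_symmetry_reduction.cases) (auto simp: at_delta_def split: if_splits)

lemma top_reduction_expands:
  "top_reduction b l r \<noteq> [] \<Longrightarrow> expands \<delta> (Node b l r) (map (at_delta \<delta>) (top_reduction b l r))"
proof (cases "(b, l, r)" rule: top_reduction.cases)
  case (1 b' x y z)
  then show "top_reduction b l r \<noteq> [] \<Longrightarrow> ?thesis"
    using expands.right_commute[of \<delta> b x y z] left_symmetry_reduction_expands[of b l r \<delta>]
    by (auto simp: at_delta_def split: if_splits)
qed (use left_symmetry_reduction_expands[of b l r \<delta>] in auto)

lemma reduction_expands: "reduction m \<noteq> [] \<Longrightarrow> expands \<delta> m (map (at_delta \<delta>) (reduction m))"
proof (induction m)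
  case (Node b l r)
  have l: "map (at_delta \<delta>) (map (\<lambda>(c, k, x). (c, k, Node b x r)) s) = map (apsnd (\<lambda>m. Node b m r)) (map (at_delta \<delta>) s)"
    and r: "map (at_delta \<delta>) (map (\<lambda>(c, k, x). (c, k, Node b l x)) s) = map (apsnd (\<lambda>m. Node b l m)) (map (at_delta \<delta>) s)"
    for s by (auto simp: at_delta_def)
  consider "reduction l \<noteq> []" | "reduction l = []" "reduction r \<noteq> []" | "reduction l = []" "reduction r = []" by blast
  then show ?case
  proof cases
    case 1
    then have "reduction (Node b l r) = map (\<lambda>(c, k, x). (c, k, Node b x r)) (reduction l)" by (cases "reduction l") auto
    then show ?thesis using expands.left[OF Node.IH(1)[OF 1]] by (simp only: l)
  next
    case 2
    then have "reduction (Node b l r) = map (\<lambda>(c, k, x). (c, k, Node b l x)) (reduction r)" by (cases "reduction r") auto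
    then show ?thesis using expands.right[OF Node.IH(2)[OF 2(2)]] by (simp only: r)
  next
    case 3
    then have "reduction (Node b l r) = top_reduction b l r" by simp
    then show ?thesis using top_reduction_expands[of b l r \<delta>] Node.prems by simp
  qed
qed simp

lemma sum_list_concat_map:
  "(\<Sum>y\<leftarrow>concat (map g xs). f y) = (\<Sum>x\<leftarrow>xs. \<Sum>y\<leftarrow>g x. (f y :: complex))"
  by (induction xs) auto

lemma (in novikov) val_reduce:
  assumes \<psi>: "\<psi> \<in> cochains Q L n" and T: "reduced_tree L (verts m)" "card (verts m) = n" and m: "multilinear m"
  shows "(\<Sum>(d, j, x)\<leftarrow>reduce fuel (c, k, m). of_int d * (\<delta> ^ j * val \<psi> x)) = of_int c * (\<delta> ^ k * val \<psi> m)"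
  using T m
proof (induction fuel arbitrary: c k m)
  case (Suc fuel)
  show ?case
  proof (cases "reduction m = []")
    case True
    then show ?thesis by simp
  next
    case False
    let ?v = "\<lambda>(d, j, x). of_int d * (\<delta> ^ j * val \<psi> x)"
    note e = reduction_expands[OF False, of \<delta>]
    have IH: "(\<Sum>y\<leftarrow>reduce fuel (c * d, k + j, x). ?v y) = of_int (c * d) * (\<delta> ^ (k + j) * val \<psi> x)"
      if "(d, j, x) \<in> set (reduction m)" for d j x
    proof -
      have "(of_int d * \<delta> ^ j, x) \<in> set (map (at_delta \<delta>) (reduction m))"
        using that by (force simp: at_delta_def)
      from expands_shape[OF e Suc.prems(3) this] show ?thesis using Suc.IH[of x] Suc.prems by simp
    qed
    have "reduce (Suc fuel) (c, k, m) = concat (map (\<lambda>(d, j, x). reduce fuel (c * d, k + j, x)) (reduction m))"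
      using False by (cases "reduction m") auto
    then have "(\<Sum>y\<leftarrow>reduce (Suc fuel) (c, k, m). ?v y)
        = (\<Sum>(d, j, x)\<leftarrow>reduction m. \<Sum>y\<leftarrow>reduce fuel (c * d, k + j, x). ?v y)"
      by (simp only: sum_list_concat_map) (simp add: case_prod_beta')
    also have "\<dots> = (\<Sum>(d, j, x)\<leftarrow>reduction m. (of_int c * \<delta> ^ k) * (of_int d * \<delta> ^ j * val \<psi> x))"
      using IH by (intro arg_cong[where f = sum_list] map_cong) (auto simp: power_add)
    also have "\<dots> = of_int c * \<delta> ^ k * (\<Sum>(d, j, x)\<leftarrow>reduction m. of_int d * \<delta> ^ j * val \<psi> x)"
      by (simp add: sum_list_const_mult case_prod_beta')
    also have "(\<Sum>(d, j, x)\<leftarrow>reduction m. of_int d * \<delta> ^ j * val \<psi> x) = (\<Sum>(c, x)\<leftarrow>map (at_delta \<delta>) (reduction m). c * val \<psi> x)"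
      by (simp add: at_delta_def comp_def case_prod_beta')
    also have "\<dots> = val \<psi> m" using val_expand[OF \<psi> Suc.prems(1,2,3) e] by simp
    finally show ?thesis by (simp add: mult.assoc)
  qed
qed simp

primrec all_marked :: "marked \<Rightarrow> bool" where
  "all_marked (Leaf i) = True"
| "all_marked (Node b l r) \<longleftrightarrow> b \<and> all_marked l \<and> all_marked r"

text \<open>
  A marked word with \<open>n\<close> leaves has \<open>n - 1\<close> inner nodes.
\<close>

lemma all_marked_if_card:
  "multilinear m \<Longrightarrow> card (verts m) + 1 \<le> card (leaf_set m) \<and> (card (verts m) + 1 = card (leaf_set m) \<longrightarrow> all_marked m)"
proof (induction m)
  case (Node b l r)
  have s: "card (leaf_set l \<union> leaf_set r) = card (leaf_set l) + card (leaf_set r)"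
    using Node.prems by (auto intro: card_Un_disjoint)
  have v: "card (verts (Node b l r)) \<le> (if b then 1 else 0) + (card (verts l) + card (verts r))"
    using card_Un_le[of "if b then {leaf_set l \<union> leaf_set r} else {}" "verts l \<union> verts r"] card_Un_le[of "verts l" "verts r"]
    by (auto simp: Un_assoc split: if_splits)
  show ?case using Node s v by (auto split: if_splits)
qed auto

fun marked_words_on :: "nat \<Rightarrow> nat list \<Rightarrow> marked list" where
  "marked_words_on 0 xs = []"
| "marked_words_on (Suc n) xs = (case xs of [x] \<Rightarrow> [Leaf x] | _ \<Rightarrow>
     concat (map (\<lambda>ys. concat (map (\<lambda>l. map (Node True l) (marked_words_on n (filter (\<lambda>x. x \<notin> set ys) xs))) (marked_words_on n ys))) (subseqs xs)))"

lemma filter_in_subseqs: "filter P xs \<in> set (subseqs xs)"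
  by (induction xs) (auto simp: Let_def)

lemma marked_split:
  assumes "multilinear (Node b l r)" "leaf_set (Node b l r) = set xs"
  shows "\<exists>ys\<in>set (subseqs xs). leaf_set l = set ys \<and> leaf_set r = set (filter (\<lambda>x. x \<notin> set ys) xs)"
proof (rule bexI[of _ "filter (\<lambda>x. x \<in> leaf_set l) xs"])
  show "filter (\<lambda>x. x \<in> leaf_set l) xs \<in> set (subseqs xs)" by (rule filter_in_subseqs)
  show "leaf_set l = set (filter (\<lambda>x. x \<in> leaf_set l) xs) \<and>
      leaf_set r = set (filter (\<lambda>x. x \<notin> set (filter (\<lambda>x. x \<in> leaf_set l) xs)) xs)"
    using assms by auto
qed

lemma all_marked_in_marked_words_on:
  "\<lbrakk>all_marked m; multilinear m; leaf_set m = set xs; distinct xs; card (leaf_set m) \<le> n\<rbrakk> \<Longrightarrow> m \<in> set (marked_words_on n xs)"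
proof (induction m arbitrary: xs n)
  case (Leaf i)
  then have "xs = [i]" using distinct_card[of xs] by (cases xs) (auto simp: subset_singleton_iff)
  moreover obtain n' where "n = Suc n'" using Leaf by (cases n) auto
  ultimately show ?case by simp
next
  case (Node b l r)
  obtain ys where ys: "ys \<in> set (subseqs xs)" "leaf_set l = set ys" "leaf_set r = set (filter (\<lambda>x. x \<notin> set ys) xs)"
    using marked_split[OF Node.prems(2,3)] by blast
  have s: "card (leaf_set (Node b l r)) = card (leaf_set l) + card (leaf_set r)"
    using Node.prems(2) card_Un_disjoint[of "leaf_set l" "leaf_set r"] by simp
  have ne: "1 \<le> card (leaf_set l)" "1 \<le> card (leaf_set r)" by (simp_all add: Suc_le_eq card_gt_0_iff)
  then obtain n' where n: "n = Suc n'" using Node.prems(5) s by (cases n) auto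
  have "distinct ys" using ys(1) Node.prems(4) by (rule subseqs_distinctD)
  then have l: "l \<in> set (marked_words_on n' ys)" using Node.IH(1)[of ys n'] Node.prems ys n s ne by auto
  have r: "r \<in> set (marked_words_on n' (filter (\<lambda>x. x \<notin> set ys) xs))"
    using Node.IH(2)[of "filter (\<lambda>x. x \<notin> set ys) xs" n'] Node.prems ys n s ne by auto
  have "length xs = card (leaf_set (Node b l r))" using Node.prems distinct_card by metis
  then have "2 \<le> length xs" using s ne by simp
  then have "marked_words_on n xs = concat (map (\<lambda>ys. concat (map (\<lambda>l. map (Node True l)
      (marked_words_on n' (filter (\<lambda>x. x \<notin> set ys) xs))) (marked_words_on n' ys))) (subseqs xs))"
    using n by (auto split: list.splits)
  then show ?case using l r ys(1) Node.prems(1) by auto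
qed

section \<open>The cocycle and the cycle in arity five\<close>

text \<open>
  The cocycle is the sum of the elementary cochains of these marked words, with coefficient
  \<open>c * \<delta> ^ k\<close> for an entry \<open>(c, k, e)\<close>. The eighteen entries lie on different trees.
\<close>

definition cocycle_table :: "(int \<times> nat \<times> marked) list" where
  "cocycle_table = [
    (1, 1, Node True (Leaf 3) (Node True (Node True (Leaf 4) (Leaf 0)) (Node False (Leaf 1) (Leaf 2)))),
    (-1, 0, Node True (Node False (Leaf 3) (Node True (Leaf 4) (Leaf 0))) (Node True (Leaf 1) (Leaf 2))),
    (-1, 1, Node True (Leaf 4) (Node True (Leaf 3) (Node True (Leaf 0) (Node False (Leaf 1) (Leaf 2))))),
    (-1, 1, Node True (Leaf 3) (Node True (Node True (Leaf 1) (Leaf 2)) (Node False (Leaf 4) (Leaf 0)))),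
    (-1, 0, Node True (Node True (Leaf 3) (Node True (Leaf 1) (Leaf 2))) (Node False (Leaf 4) (Leaf 0))),
    (1, 0, Node True (Leaf 1) (Node True (Node False (Leaf 3) (Node True (Leaf 4) (Leaf 0))) (Leaf 2))),
    (-1, 1, Node True (Leaf 4) (Node True (Leaf 1) (Node False (Leaf 3) (Node True (Leaf 0) (Leaf 2))))),
    (-1, 0, Node True (Leaf 4) (Node True (Node True (Leaf 3) (Leaf 0)) (Node False (Leaf 1) (Leaf 2)))),
    (1, 0, Node True (Leaf 1) (Node True (Node True (Leaf 3) (Leaf 2)) (Node False (Leaf 4) (Leaf 0)))),
    (-1, 1, Node True (Leaf 1) (Node False (Leaf 4) (Node True (Leaf 3) (Node True (Leaf 0) (Leaf 2))))),
    (-1, 0, Node True (Leaf 1) (Node False (Leaf 4) (Node True (Node True (Leaf 3) (Leaf 0)) (Leaf 2)))),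
    (1, 1, Node True (Leaf 1) (Node False (Leaf 3) (Node True (Node True (Leaf 4) (Leaf 0)) (Leaf 2)))),
    (1, 0, Node True (Node True (Leaf 3) (Node True (Leaf 4) (Leaf 0))) (Node False (Leaf 1) (Leaf 2))),
    (-1, 0, Node True (Leaf 4) (Node True (Node False (Leaf 3) (Leaf 0)) (Node True (Leaf 1) (Leaf 2)))),
    (1, 1, Node True (Leaf 1) (Node True (Leaf 3) (Node True (Leaf 2) (Node False (Leaf 4) (Leaf 0))))),
    (1, 0, Node True (Leaf 1) (Node True (Leaf 4) (Node True (Node False (Leaf 3) (Leaf 0)) (Leaf 2)))),
    (-1, 1, Node True (Leaf 3) (Node False (Leaf 4) (Node True (Node True (Leaf 1) (Leaf 2)) (Leaf 0)))),
    (1, 1, Node True (Leaf 1) (Node True (Leaf 3) (Node False (Leaf 4) (Node True (Leaf 2) (Leaf 0)))))]"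

text \<open>
  The cycle pairs to \<open>- 1\<close> with the cocycle. Its coefficients do not involve \<open>\<delta>\<close>, and its
  boundary vanishes by the identities alone, without dividing by a polynomial in \<open>\<delta>\<close>; this is why
  the same pair serves all parameters, although the dimension in arity four depends on \<open>\<delta>\<close>.
\<close>

definition cycle_table :: "(int \<times> marked) list" where
  "cycle_table = [
    (1, Node True (Node False (Leaf 3) (Node True (Leaf 4) (Leaf 0))) (Node True (Leaf 1) (Leaf 2))),
    (1, Node True (Node True (Leaf 4) (Node False (Leaf 3) (Node True (Leaf 1) (Leaf 2)))) (Leaf 0)),
    (-1, Node True (Node True (Leaf 3) (Node False (Leaf 4) (Node True (Leaf 1) (Leaf 2)))) (Leaf 0)),
    (-1, Node True (Node True (Leaf 1) (Node False (Leaf 3) (Node True (Leaf 4) (Leaf 0)))) (Leaf 2)),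
    (1, Node True (Node True (Leaf 3) (Node False (Leaf 1) (Node True (Leaf 4) (Leaf 0)))) (Leaf 2)),
    (1, Node True (Node False (Leaf 1) (Node True (Leaf 4) (Node True (Leaf 3) (Leaf 0)))) (Leaf 2)),
    (1, Node True (Node True (Leaf 4) (Node True (Leaf 3) (Leaf 0))) (Node False (Leaf 1) (Leaf 2))),
    (1, Node True (Node True (Leaf 1) (Node True (Leaf 4) (Node False (Leaf 3) (Leaf 0)))) (Leaf 2)),
    (1, Node True (Node True (Leaf 1) (Node False (Leaf 4) (Node True (Leaf 2) (Leaf 3)))) (Leaf 0)),
    (-1, Node True (Node True (Leaf 4) (Node False (Leaf 1) (Node True (Leaf 3) (Leaf 2)))) (Leaf 0)),
    (-1, Node True (Node False (Leaf 1) (Node True (Leaf 3) (Node True (Leaf 4) (Leaf 2)))) (Leaf 0)),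
    (-1, Node True (Node True (Leaf 4) (Node False (Leaf 1) (Node True (Leaf 3) (Leaf 0)))) (Leaf 2)),
    (-1, Node True (Node False (Leaf 1) (Node True (Leaf 4) (Leaf 0))) (Node True (Leaf 3) (Leaf 2))),
    (-1, Node True (Node False (Leaf 4) (Node True (Leaf 3) (Leaf 2))) (Node True (Leaf 1) (Leaf 0))),
    (-1, Node True (Node True (Leaf 3) (Node False (Leaf 4) (Node True (Leaf 1) (Leaf 0)))) (Leaf 2)),
    (1, Node True (Node True (Leaf 4) (Node False (Leaf 3) (Node True (Leaf 1) (Leaf 0)))) (Leaf 2)),
    (-1, Node True (Node False (Leaf 1) (Leaf 0)) (Node True (Leaf 4) (Node True (Leaf 2) (Leaf 3)))),
    (1, Node True (Node False (Leaf 1) (Leaf 0)) (Node True (Leaf 4) (Node True (Leaf 3) (Leaf 2)))),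
    (-1, Node True (Node True (Leaf 1) (Node True (Leaf 3) (Node False (Leaf 2) (Leaf 4)))) (Leaf 0)),
    (1, Node True (Node True (Leaf 1) (Node True (Leaf 2) (Node False (Leaf 3) (Leaf 4)))) (Leaf 0)),
    (-1, Node True (Node True (Leaf 1) (Node True (Leaf 2) (Node False (Leaf 4) (Leaf 3)))) (Leaf 0)),
    (-1, Node True (Node True (Leaf 4) (Node False (Leaf 3) (Leaf 0))) (Node True (Leaf 1) (Leaf 2))),
    (-1, Node True (Node False (Leaf 1) (Node True (Leaf 3) (Leaf 0))) (Node True (Leaf 4) (Leaf 2))),
    (1, Node True (Node False (Leaf 3) (Node True (Leaf 1) (Leaf 0))) (Node True (Leaf 4) (Leaf 2))),
    (1, Node True (Node True (Leaf 3) (Node False (Leaf 1) (Node True (Leaf 4) (Leaf 2)))) (Leaf 0))]"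


definition entries :: "(int \<times> nat \<times> (int \<times> magma) list) list" where
  "entries = map (\<lambda>(c, k, e). (c, k, label_list e)) cocycle_table"

lemma cocycle_table_admissible:
  "list_all (\<lambda>(c, k, e). multilinear e \<and> list_all (\<lambda>(k, s). has_coordinate s) (label_list e) \<and> length (label_list e) = 3) cocycle_table"
  by (simp add: cocycle_table_def)

primrec rooted :: "marked \<Rightarrow> bool" where
  "rooted (Leaf i) = False"
| "rooted (Node b l r) = b"

lemma cycle_table_marked:
  "list_all (\<lambda>(c, m). multilinear m \<and> rooted m \<and> leaf_set m = {0, 1, 2, 3, 4} \<and> length (label_list m) = 3) cycle_table"
  by (auto simp: cycle_table_def)

fun cocycle_on_row :: "(int \<times> nat \<times> (int \<times> magma) list) list \<Rightarrow> marked \<Rightarrow> marked list \<Rightarrow> bool" where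
  "cocycle_on_row es l [] = True"
| "cocycle_on_row es l (r # rs) =
     (if cancels (differential_terms es (contractions (Node True l r))) then cocycle_on_row es l rs else False)"

fun cocycle_on_rows :: "(int \<times> nat \<times> (int \<times> magma) list) list \<Rightarrow> marked list \<Rightarrow> marked list \<Rightarrow> bool" where
  "cocycle_on_rows es [] rs = True"
| "cocycle_on_rows es (l # ls) rs = (if cocycle_on_row es l rs then cocycle_on_rows es ls rs else False)"

fun cocycle_on_splits :: "(int \<times> nat \<times> (int \<times> magma) list) list \<Rightarrow> nat list \<Rightarrow> nat list list \<Rightarrow> bool" where
  "cocycle_on_splits es xs [] = True"
| "cocycle_on_splits es xs (ys # yss) =
     (if cocycle_on_rows es (marked_words_on 4 ys) (marked_words_on 4 (filter (\<lambda>x. x \<notin> set ys) xs))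
      then cocycle_on_splits es xs yss else False)"

lemma cocycle_on_row_all:
  "cocycle_on_row es l rs \<Longrightarrow> \<forall>r\<in>set rs. cancels (differential_terms es (contractions (Node True l r)))"
  by (induction rs) (auto split: if_splits)

lemma cocycle_on_rows_all:
  "cocycle_on_rows es ls rs \<Longrightarrow> \<forall>l\<in>set ls. \<forall>r\<in>set rs. cancels (differential_terms es (contractions (Node True l r)))"
  by (induction ls) (auto split: if_splits dest: cocycle_on_row_all)

lemma cocycle_on_splits_all:
  "cocycle_on_splits es xs yss \<Longrightarrow> ys \<in> set yss \<Longrightarrow> l \<in> set (marked_words_on 4 ys) \<Longrightarrow>
    r \<in> set (marked_words_on 4 (filter (\<lambda>x. x \<notin> set ys) xs)) \<Longrightarrow> cancels (differential_terms es (contractions (Node True l r)))"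
  by (induction yss) (auto split: if_splits dest: cocycle_on_rows_all)

text \<open>
  All binary trees with five leaves and all words of two letters at their vertices: \<open>14 * 5!\<close> marked
  words, grouped by the leaves of the left factor.
\<close>

lemma cocycle_check: "cocycle_on_splits entries [0, 1, 2, 3, 4] (subseqs [0, 1, 2, 3, 4])"
  by code_simp

text \<open>
  The boundary of the cycle consists of words on trees with two vertices. Their reductions cancel as
  polynomials in \<open>\<delta>\<close>.
\<close>

lemma boundary_check:
  "cancels_by_key (map (\<lambda>x. (map fst (label_list (snd (snd x))), x))
     (concat (map (\<lambda>(c, m). concat (map (\<lambda>(d, x). reduce 12 (c * d, 0, x)) (contractions m))) cycle_table)))"
  by code_simp

lemma pairing_check:
  "cancels ((1, 0) # concat (map (\<lambda>(c, m). cocycle_terms entries c (label_list m)) cycle_table))"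
  by code_simp

lemma rootedE: "rooted m \<Longrightarrow> (\<And>l r. m = Node True l r \<Longrightarrow> thesis) \<Longrightarrow> thesis"
  by (cases m) auto

lemma card_verts: "multilinear m \<Longrightarrow> card (verts m) = length (label_list m)"
  using distinct_card[OF distinct_vertex_list[of m]] by (simp add: label_list_eq)

context novikov begin

definition cocycle :: "nat set set \<Rightarrow> (nat set \<Rightarrow> (magma \<Rightarrow> complex) set) \<Rightarrow> complex" where
  "cocycle T p = (\<Sum>(c, k, e)\<leftarrow>cocycle_table. of_int c * \<delta> ^ k * elementary_cochain e T p)"

lemma cocycle_entry:
  assumes "(c, k, e) \<in> set cocycle_table"
  shows "admissible e" "card (verts e) = 3"
proof -
  have *: "multilinear e" "list_all (\<lambda>(k, s). has_coordinate s) (label_list e)" "length (label_list e) = 3"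
    using cocycle_table_admissible assms by (auto simp: list_all_iff)
  then show "admissible e" by (auto simp: admissible_def label_list_eq list_all_iff)
  show "card (verts e) = 3" using card_verts * by simp
qed

lemma cocycle_cochain: "cocycle \<in> cochains Q L 3"
proof (rule cochainI)
  fix T :: "nat set set" and A and p :: "nat set \<Rightarrow> (magma \<Rightarrow> complex) set"
  assume "A \<in> T"
  have "additive_form (inputs T A) (\<lambda>X. \<Sum>(c, k, e)\<leftarrow>es. of_int c * \<delta> ^ k * elementary_cochain e T (p(A := X)))"
    if "set es \<subseteq> set cocycle_table" for es
    using that
  proof (induction es)
    case (Cons y es)
    obtain c k e where y: "y = (c, k, e)" by (cases y) auto
    have head: "additive_form (inputs T A) (\<lambda>X. of_int c * \<delta> ^ k * elementary_cochain e T (p(A := X)))"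
      using Cons.prems y \<open>A \<in> T\<close> cocycle_entry(1) by (intro form_scale elementary_cochain_additive) auto
    have "set es \<subseteq> set cocycle_table" using Cons.prems by simp
    from form_add[OF head Cons.IH[OF this]] show ?case
      unfolding y by (simp only: list.map sum_list.Cons prod.case)
  qed (simp add: form_zero)
  then show "additive_form (inputs T A) (\<lambda>X. cocycle T (p(A := X)))" unfolding cocycle_def by blast
qed

lemma val_cocycle:
  assumes m: "multilinear m" "card (verts m) = 3"
  shows "of_int s * val cocycle m = (\<Sum>(c, k)\<leftarrow>cocycle_terms entries s (label_list m). of_int c * \<delta> ^ k)"
proof -
  have "of_int s * (\<Sum>(c, k, e)\<leftarrow>es. of_int c * \<delta> ^ k * elementary_cochain e (verts m) (decor m))
      = (\<Sum>(c, k)\<leftarrow>cocycle_terms (map (\<lambda>(c, k, e). (c, k, label_list e)) es) s (label_list m). of_int c * \<delta> ^ k)"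
    if "set es \<subseteq> set cocycle_table" for es
    using that
  proof (induction es)
    case (Cons y es)
    obtain c k e where y: "y = (c, k, e)" by (cases y) auto
    have e: "admissible e" "card (verts e) = 3" using Cons.prems y cocycle_entry[of c k e] by auto
    have v: "elementary_cochain e (verts m) (decor m) = (case pairing_exponent (label_list e) (label_list m) of None \<Rightarrow> 0 | Some a \<Rightarrow> \<delta> ^ a)"
      using val_elementary_cochain_exponent[OF e(1) m(1)] m(2) e(2) by (simp add: val_def)
    show ?case using Cons y v by (auto simp: algebra_simps power_add split: option.splits)
  qed simp
  then show ?thesis by (simp add: val_def cocycle_def entries_def)
qed

text \<open>
  The coboundary is a cochain on binary trees, so it is determined by its values on marked words.
\<close>

lemma cocycle_closed: "cochain_eq Q {..<5} 4 (differential Q {..<5} cocycle) (\<lambda>T p. 0)"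
proof -
  have L: "{..<5} = set [0, 1, 2, 3, 4::nat]" by auto
  have "differential Q {..<5} cocycle \<in> cochains Q {..<5} 4"
    using differential_cochain[OF cocycle_cochain, of "{..<5}"] by simp
  then show ?thesis
  proof (rule cochain_vanishes_if_marked)
    fix l r assume m: "multilinear (Node True l r)" "leaf_set (Node True l r) = {..<5}" "card (verts (Node True l r)) = 4"
    let ?m = "Node True l r"
    \<comment> \<open>four vertices on five leaves: every inner node is a vertex\<close>
    have "all_marked ?m" using all_marked_if_card[OF m(1)] m(2,3) by simp
    then have all_marked: "all_marked l" "all_marked r" by auto
    have "leaf_set ?m = set [0, 1, 2, 3, 4]" using m(2) L by (rule trans)
    then obtain ys where ys: "ys \<in> set (subseqs [0, 1, 2, 3, 4])" "leaf_set l = set ys"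
      "leaf_set r = set (filter (\<lambda>x. x \<notin> set ys) [0, 1, 2, 3, 4])"
      using marked_split[OF m(1)] by blast
    have "card (leaf_set l) + card (leaf_set r) = 5"
      using m(1,2) card_Un_disjoint[of "leaf_set l" "leaf_set r"] by simp
    moreover have "1 \<le> card (leaf_set l)" "1 \<le> card (leaf_set r)" by (simp_all add: Suc_le_eq card_gt_0_iff)
    ultimately have card: "card (leaf_set l) \<le> 4" "card (leaf_set r) \<le> 4" by linarith+
    have "distinct ys" using ys(1) by (rule subseqs_distinctD) simp
    then have "l \<in> set (marked_words_on 4 ys)"
      using all_marked(1) m(1) ys(2) card(1) by (intro all_marked_in_marked_words_on) simp_all
    moreover have "distinct (filter (\<lambda>x. x \<notin> set ys) [0, 1, 2, 3, 4])" by (intro distinct_filter) simp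
    then have "r \<in> set (marked_words_on 4 (filter (\<lambda>x. x \<notin> set ys) [0, 1, 2, 3, 4]))"
      using m(1) by (intro all_marked_in_marked_words_on[OF all_marked(2) _ ys(3) _ card(2)]) simp_all
    ultimately have c: "cancels (differential_terms entries (contractions ?m))"
      using cocycle_on_splits_all[OF cocycle_check ys(1)] by blast
    have "val (differential Q {..<5} cocycle) ?m = (\<Sum>(s, x)\<leftarrow>contractions ?m. of_int s * val cocycle x)"
      using differential_contractions[OF refl m(1)] m(2) by (simp add: val_def)
    also have "\<dots> = (\<Sum>(c, k)\<leftarrow>differential_terms entries (contractions ?m). of_int c * \<delta> ^ k)"
    proof -
      have "(\<Sum>(s, x)\<leftarrow>xs. of_int s * val cocycle x) = (\<Sum>(c, k)\<leftarrow>differential_terms entries xs. of_int c * \<delta> ^ k)"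
        if "set xs \<subseteq> set (contractions ?m)" for xs
        using that
      proof (induction xs)
        case (Cons y xs)
        obtain s x where y: "y = (s, x)" by fastforce
        then have "multilinear x" "card (verts x) = 3"
          using contractions_shape[OF refl m(1), of s x] Cons.prems m(3) by auto
        then show ?case using Cons y val_cocycle[of x s] by simp
      qed simp
      then show ?thesis by blast
    qed
    also have "\<dots> = 0" using cancels_sum[OF c] .
    finally show "val (differential Q {..<5} cocycle) ?m = 0" .
  qed simp
qed

lemma cycle_entry:
  assumes "(c, m) \<in> set cycle_table"
  obtains l r where "m = Node True l r" "multilinear m" "leaf_set m = {..<5}" "card (verts m) = 3"
proof -
  have *: "multilinear m" "rooted m" "leaf_set m = {0, 1, 2, 3, 4}" "length (label_list m) = 3"
    using cycle_table_marked assms by (auto simp: list_all_iff)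
  have "{0, 1, 2, 3, 4} = {..<5::nat}" by auto
  then have "leaf_set m = {..<5}" using *(3) by (rule trans[rotated])
  moreover have "card (verts m) = 3" using *(1,4) card_verts by simp
  moreover obtain l r where "m = Node True l r" using *(2) by (rule rootedE)
  ultimately show ?thesis using *(1) that by blast
qed

lemma cocycle_on_cycle: "(\<Sum>(c, m)\<leftarrow>cycle_table. of_int c * val cocycle m) = - 1"
proof -
  have "of_int c * val cocycle m = (\<Sum>(c, k)\<leftarrow>cocycle_terms entries c (label_list m). of_int c * \<delta> ^ k)"
    if "(c, m) \<in> set cycle_table" for c m
    using cycle_entry[OF that] val_cocycle by metis
  then have "(\<Sum>(c, m)\<leftarrow>cycle_table. of_int c * val cocycle m)
      = (\<Sum>(c, m)\<leftarrow>cycle_table. \<Sum>(c, k)\<leftarrow>cocycle_terms entries c (label_list m). of_int c * \<delta> ^ k)"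
    by (intro arg_cong[where f = sum_list] map_cong) auto
  also have "\<dots> = (\<Sum>(c, k)\<leftarrow>concat (map (\<lambda>(c, m). cocycle_terms entries c (label_list m)) cycle_table). of_int c * \<delta> ^ k)"
    unfolding sum_list_concat_map by (simp add: case_prod_beta')
  also have "1 + \<dots> = 0"
    using cancels_sum[OF pairing_check, of "\<lambda>k. \<delta> ^ k"] by simp
  then have "(\<Sum>(c, k)\<leftarrow>concat (map (\<lambda>(c, m). cocycle_terms entries c (label_list m)) cycle_table). of_int c * \<delta> ^ k) = - 1"
    by (simp add: add_eq_0_iff)
  finally show ?thesis .
qed

lemma coboundary_on_cycle:
  assumes \<psi>: "\<psi> \<in> cochains Q {..<5} 2"
  shows "(\<Sum>(c, m)\<leftarrow>cycle_table. of_int c * val (differential Q {..<5} \<psi>) m) = 0"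
proof -
  let ?v = "\<lambda>(d, j, x). of_int d * (\<delta> ^ j * val \<psi> x)"
  have d: "of_int c * val (differential Q {..<5} \<psi>) m
      = (\<Sum>y\<leftarrow>concat (map (\<lambda>(d, x). reduce 12 (c * d, 0, x)) (contractions m)). ?v y)"
    if cm: "(c, m) \<in> set cycle_table" for c m
  proof -
    obtain l r where m: "m = Node True l r" "multilinear m" "leaf_set m = {..<5}" "card (verts m) = 3"
      by (rule cycle_entry[OF cm])
    have reduce: "(\<Sum>y\<leftarrow>reduce 12 (c * d, 0, x). ?v y) = of_int c * (of_int d * val \<psi> x)" if "(d, x) \<in> set (contractions m)" for d x
      using val_reduce[OF \<psi>, of x 12 "c * d" 0] contractions_shape[OF m(1,2) that] m(3,4) by simp
    have "of_int c * val (differential Q {..<5} \<psi>) m = of_int c * (\<Sum>(d, x)\<leftarrow>contractions m. of_int d * val \<psi> x)"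
      using differential_contractions[OF m(1,2), of \<psi>] m(3) by (simp add: val_def)
    also have "\<dots> = (\<Sum>(d, x)\<leftarrow>contractions m. of_int c * (of_int d * val \<psi> x))"
      by (simp add: sum_list_const_mult case_prod_beta')
    also have "\<dots> = (\<Sum>(d, x)\<leftarrow>contractions m. \<Sum>y\<leftarrow>reduce 12 (c * d, 0, x). ?v y)"
      using reduce by (intro arg_cong[where f = sum_list] map_cong) auto
    finally show ?thesis unfolding sum_list_concat_map by (simp add: case_prod_beta')
  qed
  let ?zs = "concat (map (\<lambda>(c, m). concat (map (\<lambda>(d, x). reduce 12 (c * d, 0, x)) (contractions m))) cycle_table)"
  have "(\<Sum>(c, m)\<leftarrow>cycle_table. of_int c * val (differential Q {..<5} \<psi>) m)
      = (\<Sum>(c, m)\<leftarrow>cycle_table. \<Sum>y\<leftarrow>concat (map (\<lambda>(d, x). reduce 12 (c * d, 0, x)) (contractions m)). ?v y)"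
    using d by (intro arg_cong[where f = sum_list] map_cong) auto
  also have "\<dots> = (\<Sum>y\<leftarrow>?zs. ?v y)"
    unfolding sum_list_concat_map[of _ _ cycle_table] by (simp only: case_prod_beta')
  also have "\<dots> = 0"
    using cancels_by_key_sum[OF boundary_check, of "\<lambda>(j, x). \<delta> ^ j * val \<psi> x"]
    by (simp add: comp_def case_prod_beta')
  finally show ?thesis .
qed

text \<open>
  If the cocycle were the coboundary of \<open>\<psi>\<close>, its value on the cycle would be the value of
  \<open>\<psi>\<close> on the boundary of the cycle.
\<close>

lemma not_cobar_exact: "\<not> cobar_exact_at Q {..<5} 3"
proof
  assume "cobar_exact_at Q {..<5} 3"
  then obtain \<psi> where \<psi>: "\<psi> \<in> cochains Q {..<5} 2" "cochain_eq Q {..<5} 3 cocycle (differential Q {..<5} \<psi>)"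
    using cocycle_cochain cocycle_closed unfolding cobar_exact_at_def by fastforce
  have "val cocycle m = val (differential Q {..<5} \<psi>) m" if cm: "(c, m) \<in> set cycle_table" for c m
  proof -
    obtain l r where m: "m = Node True l r" "multilinear m" "leaf_set m = {..<5}" "card (verts m) = 3"
      by (rule cycle_entry[OF cm])
    then have "reduced_tree {..<5} (verts m)" using reduced_tree_verts[of l r] by simp
    then show ?thesis using \<psi>(2) m(4) decor_decorations[OF m(2)] by (simp add: cochain_eq_def val_def)
  qed
  then have "(\<Sum>(c, m)\<leftarrow>cycle_table. of_int c * val cocycle m)
      = (\<Sum>(c, m)\<leftarrow>cycle_table. of_int c * val (differential Q {..<5} \<psi>) m)"
    by (intro arg_cong[where f = sum_list] map_cong) auto
  then show False using cocycle_on_cycle coboundary_on_cycle[OF \<psi>(1)] by simp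
qed

end

theorem theorem48:
  fixes \<delta> :: complex
  shows "\<not> koszul (delta_novikov_operad \<delta>)"
proof
  interpret novikov \<delta>
    by (intro novikov.intro magmatic_ideal.intro operad_ideal_novikov)
  assume "koszul (delta_novikov_operad \<delta>)"
  then have "cobar_exact_at (delta_novikov_operad \<delta>) {..<5} 3"
    unfolding koszul_def by (elim allE[of _ 5] allE[of _ 3]) simp
  then show False using not_cobar_exact by (simp add: delta_novikov_operad_def novikov_ideal_def)
qed

end
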